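(* Let $(\mathfrak g,r')$ be a nondegenerate quasitriangular Lie bialgebra over a field $\mathbb K$ of characteristic $0$, and let $\Theta:Z(U(\mathfrak g))\to U(\mathfrak g^* )$ be Semenov-Tian-Shansky's morphism. Then $\mathrm{Im}(\Theta)=C_1\subset U(\mathfrak g^* )$. The associated graded of $C_1$ (for the degree filtration of $U(\mathfrak g^* )$) is $S(\mathfrak g^* )^{\mathfrak g}$.
   Context: A quasitriangular Lie bialgebra is a pair $(\mathfrak g,r')$ of a Lie algebra $\mathfrak g$ and $r'\in\mathfrak g^{\otimes2}$ with $[r'^{1,2},r'^{1,3}]+[r'^{1,2},r'^{2,3}]+[r'^{1,3},r'^{2,3}]=0$ and $t:=r'+r'^{2,1}\in S^2(\mathfrak g)^{\mathfrak g}$; its cobracket is $x\mapsto[x\otimes1+1\otimes x,r]$ with $r=(r'-r'^{2,1})/2$. It is nondegenerate if $\mathfrak g$ is finite dimensional and $t$ is nondegenerate. $\mathfrak g^*$ is the dual Lie bialgebra (bracket dual to the cobracket of $\mathfrak g$, cobracket dual to the bracket of $\mathfrak g$). $\mathfrak g$ acts on $S(\mathfrak g^* )$ by symmetric powers of the coadjoint action. $Z(A)$ is the center of an algebra $A$. Definition of $\Theta$: the maps $L,R:\mathfrak g^*\to\mathfrak g$, $L(\ell)=(\ell\otimes\mathrm{id})(r')$, $R(\ell)=-(\mathrm{id}\otimes\ell)(r')$, are Lie algebra morphisms; denote also by $L,R$ the induced algebra morphisms $U(\mathfrak g^* )\to U(\mathfrak g)$. Let $\alpha=m_0\circ(L\otimes(S_0\circ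 R))\circ\Delta_0:U(\mathfrak g^* )\to U(\mathfrak g)$, with $\Delta_0$ the standard (cocommutative) coproduct of $U(\mathfrak g^* )$, and $m_0,S_0$ the product and antipode of $U(\mathfrak g)$. The associated graded of $\alpha$ is the isomorphism $S(\mathfrak g^* )\to S(\mathfrak g)$ induced by $t$, hence $\alpha$ is a linear isomorphism, and $\Theta$ is the restriction of $\alpha^{-1}$ to $Z(U(\mathfrak g))$; it is an algebra morphism. Definition of $C_1$: let $D:\mathfrak g^*\to\mathfrak g^*$ be the composition of the Lie cobracket $\delta:\mathfrak g^*\to\wedge^2(\mathfrak g^* )$ with the Lie bracket of $\mathfrak g^*$. It is a derivation and a coderivation, and it induces a derivation of $U(\mathfrak g^* )$, also denoted by $D$. Then $C_1:=\mathrm{Ker}(\delta-(D\otimes\mathrm{id})\circ\Delta_0)\subset U(\mathfrak g^* )$, where $\delta:U(\mathfrak g^* )\to\wedge^2U(\mathfrak g^* )\subset U(\mathfrak g^* )^{\otimes2}$ is the co-Poisson map of $U(\mathfrak g^* )$ (extending the cobracket of $\mathfrak g^*$, with $\delta(xy)=\delta(x)\Delta_0(y)+\Delta_0(x)\delta(y)$).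
   Formalization: C_1 is taken as Ker(δ − (id⊗D)∘Δ_0) in place of Ker(δ − (D⊗id)∘Δ_0); with the printed form Im(Θ)=C_1 fails, e.g. for sl_2 with r'=h⊗h/4+e⊗f and the Casimir element. The bracket on ∧² is normalised by m∧n ↦ [m,n]. *)

theory Defs
  imports Complex_Main "HOL-Library.Poly_Mapping" "HOL-Library.Function_Algebras" "HOL-Library.FuncSet"
begin

text \<open>
  A vector space over \<open>'k\<close> is a subspace \<open>carr M\<close> of an ambient vector space: addition comes from
  the type class of \<open>'v\<close>, scalar multiplication is \<open>scl M\<close>.
\<close>

record ('k, 'v) vspace =
  carr :: "'v set"
  scl :: "'k \<Rightarrow> 'v \<Rightarrow> 'v"

record ('k, 'v) lie = "('k, 'v) vspace" +
  brk :: "'v \<Rightarrow> 'v \<Rightarrow> 'v"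

definition is_vspace :: "('k::field, 'v::ab_group_add, 'm) vspace_scheme \<Rightarrow> bool" where
  "is_vspace M \<longleftrightarrow> vector_space (scl M) \<and> module.subspace (scl M) (carr M)"

definition bilinear_on ::
  "('k::field, 'v::ab_group_add, 'm) vspace_scheme \<Rightarrow> ('k, 'w::ab_group_add, 'n) vspace_scheme \<Rightarrow>
   ('k \<Rightarrow> 'a::ab_group_add \<Rightarrow> 'a) \<Rightarrow> ('v \<Rightarrow> 'w \<Rightarrow> 'a) \<Rightarrow> bool" where
  "bilinear_on M N s \<beta> \<longleftrightarrow>
     (\<forall>x\<in>carr M. \<forall>x'\<in>carr M. \<forall>y\<in>carr N. \<beta> (x + x') y = \<beta> x y + \<beta> x' y) \<and>
     (\<forall>x\<in>carr M. \<forall>y\<in>carr N. \<forall>y'\<in>carr N. \<beta> x (y + y') = \<beta> x y + \<beta> x y') \<and>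
     (\<forall>c. \<forall>x\<in>carr M. \<forall>y\<in>carr N. \<beta> (scl M c x) y = s c (\<beta> x y) \<and> \<beta> x (scl N c y) = s c (\<beta> x y))"

definition lie_algebra :: "('k::field, 'v::ab_group_add) lie \<Rightarrow> bool" where
  "lie_algebra g \<longleftrightarrow> is_vspace g \<and>
     (\<forall>x\<in>carr g. \<forall>y\<in>carr g. brk g x y \<in> carr g) \<and>
     bilinear_on g g (scl g) (brk g) \<and>
     (\<forall>x\<in>carr g. brk g x x = 0) \<and>
     (\<forall>x\<in>carr g. \<forall>y\<in>carr g. \<forall>z\<in>carr g.
        brk g x (brk g y z) + brk g y (brk g z x) + brk g z (brk g x y) = 0)"

section \<open>Tensor products of vector spaces\<close>

text \<open>
  \<open>M \<otimes> N\<close> is realised inside the linear dual of the space of bilinear forms on \<open>M \<times> N\<close>: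
  \<open>v \<otimes> w\<close> is the evaluation \<open>\<beta> \<mapsto> \<beta> v w\<close>, and \<open>M \<otimes> N\<close> is the span of these evaluations. Over a
  field this has the universal property of the tensor product, see \<open>lift_sum\<close> below.
\<close>

type_synonym ('k, 'v, 'w) tens = "('v \<Rightarrow> 'w \<Rightarrow> 'k) \<Rightarrow> 'k"

definition tens ::
  "('k::field, 'v::ab_group_add, 'm) vspace_scheme \<Rightarrow> ('k, 'w::ab_group_add, 'n) vspace_scheme \<Rightarrow>
   'v \<Rightarrow> 'w \<Rightarrow> ('k, 'v, 'w) tens" where
  "tens M N v w = (\<lambda>\<beta>. if bilinear_on M N (*) \<beta> then \<beta> v w else 0)"

definition tensor ::
  "('k::field, 'v::ab_group_add, 'm) vspace_scheme \<Rightarrow> ('k, 'w::ab_group_add, 'n) vspace_scheme \<Rightarrow>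
   ('k, ('k, 'v, 'w) tens) vspace" where
  "tensor M N =
     \<lparr>carr = {\<Sum>(v, w)\<leftarrow>ps. tens M N v w | ps. set ps \<subseteq> carr M \<times> carr N},
      scl = (\<lambda>c T \<beta>. c * T \<beta>)\<rparr>"

text \<open>The linear map on \<open>M \<otimes> N\<close> induced by a bilinear map \<open>\<beta>\<close>, i.e. \<open>v \<otimes> w \<mapsto> \<beta> v w\<close>.\<close>

definition lift ::
  "('k::field, 'v::ab_group_add, 'm) vspace_scheme \<Rightarrow> ('k, 'w::ab_group_add, 'n) vspace_scheme \<Rightarrow>
   ('v \<Rightarrow> 'w \<Rightarrow> 'a::ab_group_add) \<Rightarrow> ('k, 'v, 'w) tens \<Rightarrow> 'a" where
  "lift M N \<beta> T =
     (let ps = (SOME ps. set ps \<subseteq> carr M \<times> carr N \<and> (\<Sum>(v, w)\<leftarrow>ps. tens M N v w) = T)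
      in \<Sum>(v, w)\<leftarrow>ps. \<beta> v w)"

lemma sum_list_fun_apply: "(sum_list (fs :: ('a \<Rightarrow> 'b::ab_group_add) list)) x = (\<Sum>f\<leftarrow>fs. f x)"
  by (induction fs) auto

lemma vector_space_field: "vector_space ((*) :: 'k::field \<Rightarrow> 'k \<Rightarrow> 'k)"
  by unfold_locales (auto simp: algebra_simps)

lemma separating_functional:
  fixes s :: "'k::field \<Rightarrow> 'a::ab_group_add \<Rightarrow> 'a"
  assumes "vector_space s" and "d \<noteq> 0"
  shows "\<exists>\<phi>. Vector_Spaces.linear s (*) \<phi> \<and> \<phi> d = (1::'k)"
proof -
  interpret vector_space_pair s "(*) :: 'k \<Rightarrow> 'k \<Rightarrow> 'k"
    by (simp add: vector_space_pair_def assms(1) vector_space_field)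
  have "vs1.independent {d}"
    using assms(2) by simp
  from linear_independent_extend[OF this, of "\<lambda>_. 1"] show ?thesis
    by auto
qed

lemma tens_sum_apply:
  "bilinear_on M N (*) \<beta> \<Longrightarrow> (\<Sum>(v, w)\<leftarrow>ps. tens M N v w) \<beta> = (\<Sum>(v, w)\<leftarrow>ps. \<beta> v w)"
  by (induction ps) (auto simp: tens_def)

lemma lift_well_defined:
  fixes s :: "'k::field \<Rightarrow> 'a::ab_group_add \<Rightarrow> 'a"
  assumes "vector_space s" and "bilinear_on M N s \<beta>"
    and eq: "(\<Sum>(v, w)\<leftarrow>ps. tens M N v w) = (\<Sum>(v, w)\<leftarrow>qs. tens M N v w)"
  shows "(\<Sum>(v, w)\<leftarrow>ps. \<beta> v w) = (\<Sum>(v, w)\<leftarrow>qs. \<beta> v w)"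
proof (rule ccontr)
  let ?d = "(\<Sum>(v, w)\<leftarrow>ps. \<beta> v w) - (\<Sum>(v, w)\<leftarrow>qs. \<beta> v w)"
  assume "\<not> ?thesis"
  then have "?d \<noteq> 0" by simp
  from separating_functional[OF assms(1) this] obtain \<phi> where
    \<phi>: "Vector_Spaces.linear s (*) \<phi>" "\<phi> ?d = (1::'k)" by blast
  interpret Vector_Spaces.linear s "(*)" \<phi> by (fact \<phi>(1))
  have 1: "bilinear_on M N (*) (\<lambda>v w. \<phi> (\<beta> v w))"
    using assms(2) by (auto simp: bilinear_on_def add scale)
  have 2: "\<phi> (\<Sum>(v, w)\<leftarrow>rs. \<beta> v w) = (\<Sum>(v, w)\<leftarrow>rs. \<phi> (\<beta> v w))" for rs
    by (induction rs) (auto simp: add zero)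
  have "(\<Sum>(v, w)\<leftarrow>ps. \<phi> (\<beta> v w)) = (\<Sum>(v, w)\<leftarrow>qs. \<phi> (\<beta> v w))"
    using eq by (metis (no_types, lifting) tens_sum_apply[OF 1])
  then have "\<phi> ?d = 0"
    by (simp add: diff 2)
  with \<phi>(2) show False by simp
qed

lemma lift_sum:
  fixes s :: "'k::field \<Rightarrow> 'a::ab_group_add \<Rightarrow> 'a"
  assumes "vector_space s" and "bilinear_on M N s \<beta>" and "set ps \<subseteq> carr M \<times> carr N"
  shows "lift M N \<beta> (\<Sum>(v, w)\<leftarrow>ps. tens M N v w) = (\<Sum>(v, w)\<leftarrow>ps. \<beta> v w)"
proof -
  let ?P = "\<lambda>qs. set qs \<subseteq> carr M \<times> carr N \<and>
    (\<Sum>(v, w)\<leftarrow>qs. tens M N v w) = (\<Sum>(v, w)\<leftarrow>ps. tens M N v w)"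
  have "?P (SOME qs. ?P qs)"
    by (rule someI[of ?P ps]) (use assms(3) in simp)
  then show ?thesis
    unfolding lift_def Let_def using lift_well_defined[OF assms(1,2)] by blast
qed

section \<open>Quasitriangular Lie bialgebras\<close>

text \<open>From here on the whole type \<open>'g\<close> is the Lie algebra, i.e. \<open>carr g = UNIV\<close>.\<close>

definition flip :: "('k::field, 'g::ab_group_add) lie \<Rightarrow> ('k, 'g, 'g) tens \<Rightarrow> ('k, 'g, 'g) tens" where
  "flip g = lift g g (\<lambda>a b. tens g g b a)"

text \<open>\<open>ad2 g x T = [x \<otimes> 1 + 1 \<otimes> x, T]\<close>\<close>

definition ad2 ::
  "('k::field, 'g::ab_group_add) lie \<Rightarrow> 'g \<Rightarrow> ('k, 'g, 'g) tens \<Rightarrow> ('k, 'g, 'g) tens" where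
  "ad2 g x = lift g g (\<lambda>a b. tens g g (brk g x a) b + tens g g a (brk g x b))"

definition tens3 ::
  "('k::field, 'g::ab_group_add) lie \<Rightarrow> 'g \<Rightarrow> 'g \<Rightarrow> 'g \<Rightarrow> ('k, ('k, 'g, 'g) tens, 'g) tens" where
  "tens3 g x y z = tens (tensor g g) g (tens g g x y) z"

text \<open>\<open>[r\<^sup>1\<^sup>2, r\<^sup>1\<^sup>3] + [r\<^sup>1\<^sup>2, r\<^sup>2\<^sup>3] + [r\<^sup>1\<^sup>3, r\<^sup>2\<^sup>3]\<close>, where \<open>a \<otimes> b\<close> runs through the
  left and \<open>c \<otimes> d\<close> through the right factor of each commutator.\<close>

definition cyb ::
  "('k::field, 'g::ab_group_add) lie \<Rightarrow> ('k, 'g, 'g) tens \<Rightarrow> ('k, ('k, 'g, 'g) tens, 'g) tens" where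
  "cyb g r =
     lift g g (\<lambda>a b. lift g g (\<lambda>c d.
       tens3 g (brk g a c) b d + tens3 g a (brk g b c) d + tens3 g a c (brk g b d)) r) r"

definition sym_part :: "('k::field, 'g::ab_group_add) lie \<Rightarrow> ('k, 'g, 'g) tens \<Rightarrow> ('k, 'g, 'g) tens"
  where "sym_part g r = r + flip g r"

definition quasitriangular ::
  "('k::field_char_0, 'g::ab_group_add) lie \<Rightarrow> ('k, 'g, 'g) tens \<Rightarrow> bool" where
  "quasitriangular g r \<longleftrightarrow> lie_algebra g \<and> r \<in> carr (tensor g g) \<and> cyb g r = 0 \<and>
     flip g (sym_part g r) = sym_part g r \<and> (\<forall>x\<in>carr g. ad2 g x (sym_part g r) = 0)"

definition dual_carr :: "('k::field, 'g::ab_group_add) lie \<Rightarrow> ('g \<Rightarrow> 'k) set" where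
  "dual_carr g = {\<xi>. Vector_Spaces.linear (scl g) (*) \<xi>}"

definition nondegenerate ::
  "('k::field_char_0, 'g::ab_group_add) lie \<Rightarrow> ('k, 'g, 'g) tens \<Rightarrow> bool" where
  "nondegenerate g r \<longleftrightarrow>
     (\<exists>B. finite B \<and> module.span (scl g) B = carr g) \<and>
     bij_betw (\<lambda>\<xi>. lift g g (\<lambda>a b. scl g (\<xi> a) b) (sym_part g r)) (dual_carr g) (carr g)"

definition cobracket ::
  "('k::field_char_0, 'g::ab_group_add) lie \<Rightarrow> ('k, 'g, 'g) tens \<Rightarrow> 'g \<Rightarrow> ('k, 'g, 'g) tens" where
  "cobracket g r x = ad2 g x (scl (tensor g g) (1 / 2) (r - flip g r))"

definition dual_lie ::
  "('k::field_char_0, 'g::ab_group_add) lie \<Rightarrow> ('k, 'g, 'g) tens \<Rightarrow> ('k, 'g \<Rightarrow> 'k) lie" where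
  "dual_lie g r =
     \<lparr>carr = dual_carr g, scl = (\<lambda>c \<xi> x. c * \<xi> x),
      brk = (\<lambda>\<xi> m x. lift g g (\<lambda>a b. \<xi> a * m b) (cobracket g r x))\<rparr>"

definition dual_cobracket ::
  "('k::field_char_0, 'g::ab_group_add) lie \<Rightarrow> ('k, 'g, 'g) tens \<Rightarrow> ('g \<Rightarrow> 'k) \<Rightarrow>
   ('k, 'g \<Rightarrow> 'k, 'g \<Rightarrow> 'k) tens" where
  "dual_cobracket g r \<xi> =
     (let d = dual_lie g r in
      THE T. T \<in> carr (tensor d d) \<and>
        (\<forall>x\<in>carr g. \<forall>y\<in>carr g. lift d d (\<lambda>m n. m x * n y) T = \<xi> (brk g x y)))"

text \<open>
  The composite of \<open>\<delta>\<close> with the Lie bracket. Here \<open>\<And>\<^sup>2\<close> is embedded into the tensor square by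
  \<open>m \<and> n \<mapsto> m \<otimes> n - n \<otimes> m\<close> and the bracket on \<open>\<And>\<^sup>2\<close> is \<open>m \<and> n \<mapsto> [m, n]\<close>; in terms of tensors
  this is \<open>1/2\<close> of \<open>m \<otimes> n \<mapsto> [m, n]\<close>.
\<close>

definition dual_D ::
  "('k::field_char_0, 'g::ab_group_add) lie \<Rightarrow> ('k, 'g, 'g) tens \<Rightarrow> ('g \<Rightarrow> 'k) \<Rightarrow> ('g \<Rightarrow> 'k)" where
  "dual_D g r \<xi> =
     (let d = dual_lie g r in scl d (1 / 2) (lift d d (brk d) (dual_cobracket g r \<xi>)))"

section \<open>Enveloping algebras and symmetric algebras\<close>

text \<open>
  An algebra is given by its scalar multiplication; it is the whole type, with the ring structure
  of the type class.
\<close>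

definition is_algebra :: "('k::field \<Rightarrow> 'u::ring_1 \<Rightarrow> 'u) \<Rightarrow> bool" where
  "is_algebra s \<longleftrightarrow> vector_space s \<and> (\<forall>c x y. s c (x * y) = s c x * y \<and> s c (x * y) = x * s c y)"

abbreviation full :: "('k \<Rightarrow> 'u \<Rightarrow> 'u) \<Rightarrow> ('k, 'u) vspace" where
  "full s \<equiv> \<lparr>carr = UNIV, scl = s\<rparr>"

text \<open>
  The free algebra on the set \<open>carr g\<close> consists of finite linear combinations of words over it.
  \<open>U(g)\<close> is its quotient by the two-sided ideal making the generators depend linearly on
  \<open>x \<in> g\<close> and satisfy \<open>x y - y x = [x, y]\<close>; equivalently the tensor algebra modulo the latter. As
  it depends on the term \<open>g\<close>, it is not a type; \<open>enveloping_algebra g s \<iota>\<close> says that the algebra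
  \<open>s\<close> together with \<open>\<iota>\<close> is a copy of this quotient: evaluation of words is onto, and its kernel
  is that ideal.
\<close>

definition word_combs :: "'v set \<Rightarrow> ('v list \<Rightarrow>\<^sub>0 'k::field) set" where
  "word_combs V = {p. \<forall>w\<in>Poly_Mapping.keys p. set w \<subseteq> V}"

definition word_eval ::
  "('k::field \<Rightarrow> 'u::ring_1 \<Rightarrow> 'u) \<Rightarrow> ('v \<Rightarrow> 'u) \<Rightarrow> ('v list \<Rightarrow>\<^sub>0 'k) \<Rightarrow> 'u" where
  "word_eval s \<iota> p =
     (\<Sum>w\<in>Poly_Mapping.keys p. s (Poly_Mapping.lookup p w) (prod_list (map \<iota> w)))"

definition enveloping_ideal ::
  "('k::field, 'v::ab_group_add) lie \<Rightarrow> ('v list \<Rightarrow>\<^sub>0 'k) set" where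
  "enveloping_ideal g = module.span (\<lambda>c. Poly_Mapping.map ((*) c))
     ({Poly_Mapping.single (u @ [x + y] @ v) 1 - Poly_Mapping.single (u @ [x] @ v) 1
         - Poly_Mapping.single (u @ [y] @ v) 1 |
         u x y v. set u \<subseteq> carr g \<and> x \<in> carr g \<and> y \<in> carr g \<and> set v \<subseteq> carr g} \<union>
      {Poly_Mapping.single (u @ [scl g c x] @ v) 1 - Poly_Mapping.single (u @ [x] @ v) c |
         u c x v. set u \<subseteq> carr g \<and> x \<in> carr g \<and> set v \<subseteq> carr g} \<union>
      {Poly_Mapping.single (u @ [x, y] @ v) 1 - Poly_Mapping.single (u @ [y, x] @ v) 1
         - Poly_Mapping.single (u @ [brk g x y] @ v) 1 |
         u x y v. set u \<subseteq> carr g \<and> x \<in> carr g \<and> y \<in> carr g \<and> set v \<subseteq> carr g})"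

definition enveloping_algebra ::
  "('k::field, 'v::ab_group_add) lie \<Rightarrow> ('k \<Rightarrow> 'u::ring_1 \<Rightarrow> 'u) \<Rightarrow> ('v \<Rightarrow> 'u) \<Rightarrow> bool" where
  "enveloping_algebra g s \<iota> \<longleftrightarrow> is_algebra s \<and>
     word_eval s \<iota> ` word_combs (carr g) = UNIV \<and>
     {p \<in> word_combs (carr g). word_eval s \<iota> p = 0} = enveloping_ideal g"

text \<open>For the zero bracket the above presentation is that of the symmetric algebra.\<close>

definition symmetric_algebra ::
  "('k::field, 'v::ab_group_add) lie \<Rightarrow> ('k \<Rightarrow> 's::comm_ring_1 \<Rightarrow> 's) \<Rightarrow> ('v \<Rightarrow> 's) \<Rightarrow> bool" where
  "symmetric_algebra g s \<iota> \<longleftrightarrow> enveloping_algebra (g\<lparr>brk := \<lambda>x y. 0\<rparr>) s \<iota>"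

text \<open>
  In the definitions by \<open>THE\<close> below, \<open>s\<close>, \<open>\<iota>\<close> is an enveloping (or symmetric) algebra of \<open>g\<close>, and
  the map in question is determined by its values on the generators \<open>\<iota> x\<close>.
\<close>

definition alg_extension ::
  "('k::field, 'v::ab_group_add) lie \<Rightarrow> ('k \<Rightarrow> 'u::ring_1 \<Rightarrow> 'u) \<Rightarrow> ('v \<Rightarrow> 'u) \<Rightarrow>
   ('k \<Rightarrow> 'a::ring_1 \<Rightarrow> 'a) \<Rightarrow> ('v \<Rightarrow> 'a) \<Rightarrow> 'u \<Rightarrow> 'a" where
  "alg_extension g s \<iota> sA f =
     (THE \<phi>. Vector_Spaces.linear s sA \<phi> \<and> \<phi> 1 = 1 \<and> (\<forall>x y. \<phi> (x * y) = \<phi> x * \<phi> y) \<and>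
        (\<forall>x\<in>carr g. \<phi> (\<iota> x) = f x))"

definition der_extension ::
  "('k::field, 'v::ab_group_add) lie \<Rightarrow> ('k \<Rightarrow> 'u::ring_1 \<Rightarrow> 'u) \<Rightarrow> ('v \<Rightarrow> 'u) \<Rightarrow>
   ('v \<Rightarrow> 'v) \<Rightarrow> 'u \<Rightarrow> 'u" where
  "der_extension g s \<iota> f =
     (THE \<phi>. Vector_Spaces.linear s s \<phi> \<and> (\<forall>x y. \<phi> (x * y) = \<phi> x * y + x * \<phi> y) \<and>
        (\<forall>x\<in>carr g. \<phi> (\<iota> x) = \<iota> (f x)))"

definition antipode ::
  "('k::field, 'v::ab_group_add) lie \<Rightarrow> ('k \<Rightarrow> 'u::ring_1 \<Rightarrow> 'u) \<Rightarrow> ('v \<Rightarrow> 'u) \<Rightarrow> 'u \<Rightarrow> 'u" where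
  "antipode g s \<iota> =
     (THE \<phi>. Vector_Spaces.linear s s \<phi> \<and> \<phi> 1 = 1 \<and> (\<forall>x y. \<phi> (x * y) = \<phi> y * \<phi> x) \<and>
        (\<forall>x\<in>carr g. \<phi> (\<iota> x) = - \<iota> x))"

abbreviation tens_alg :: "('k::field \<Rightarrow> 'u::ring_1 \<Rightarrow> 'u) \<Rightarrow> 'u \<Rightarrow> 'u \<Rightarrow> ('k, 'u, 'u) tens" where
  "tens_alg s \<equiv> tens (full s) (full s)"

abbreviation lift_alg ::
  "('k::field \<Rightarrow> 'u::ring_1 \<Rightarrow> 'u) \<Rightarrow> ('u \<Rightarrow> 'u \<Rightarrow> 'a::ab_group_add) \<Rightarrow> ('k, 'u, 'u) tens \<Rightarrow> 'a" where
  "lift_alg s \<equiv> lift (full s) (full s)"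

text \<open>The product of the algebra \<open>U \<otimes> U\<close>.\<close>

definition tens_mult ::
  "('k::field \<Rightarrow> 'u::ring_1 \<Rightarrow> 'u) \<Rightarrow> ('k, 'u, 'u) tens \<Rightarrow> ('k, 'u, 'u) tens \<Rightarrow> ('k, 'u, 'u) tens" where
  "tens_mult s T T' =
     lift_alg s (\<lambda>a b. lift_alg s (\<lambda>c d. tens_alg s (a * c) (b * d)) T') T"

definition coproduct ::
  "('k::field, 'v::ab_group_add) lie \<Rightarrow> ('k \<Rightarrow> 'u::ring_1 \<Rightarrow> 'u) \<Rightarrow> ('v \<Rightarrow> 'u) \<Rightarrow>
   'u \<Rightarrow> ('k, 'u, 'u) tens" where
  "coproduct g s \<iota> =
     (let UU = tensor (full s) (full s) in
      THE \<phi>. Vector_Spaces.linear s (scl UU) \<phi> \<and> (\<forall>x. \<phi> x \<in> carr UU) \<and> \<phi> 1 = tens_alg s 1 1 \<and>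
        (\<forall>x y. \<phi> (x * y) = tens_mult s (\<phi> x) (\<phi> y)) \<and>
        (\<forall>x\<in>carr g. \<phi> (\<iota> x) = tens_alg s (\<iota> x) 1 + tens_alg s 1 (\<iota> x)))"

definition center :: "'u::ring_1 set" where
  "center = {z. \<forall>u. z * u = u * z}"

section \<open>The map \<open>\<Theta>\<close>\<close>

text \<open>\<open>sU\<close>, \<open>\<iota>U\<close> stands for \<open>U(g)\<close> and \<open>sW\<close>, \<open>\<iota>W\<close> for \<open>U(g*)\<close>.\<close>

definition Lmap :: "('k::field_char_0, 'g::ab_group_add) lie \<Rightarrow> ('k, 'g, 'g) tens \<Rightarrow> ('g \<Rightarrow> 'k) \<Rightarrow> 'g"
  where "Lmap g r \<xi> = lift g g (\<lambda>a b. scl g (\<xi> a) b) r"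

definition Rmap :: "('k::field_char_0, 'g::ab_group_add) lie \<Rightarrow> ('k, 'g, 'g) tens \<Rightarrow> ('g \<Rightarrow> 'k) \<Rightarrow> 'g"
  where "Rmap g r \<xi> = - lift g g (\<lambda>a b. scl g (\<xi> b) a) r"

definition alpha ::
  "('k::field_char_0, 'g::ab_group_add) lie \<Rightarrow> ('k, 'g, 'g) tens \<Rightarrow>
   ('k \<Rightarrow> 'u::ring_1 \<Rightarrow> 'u) \<Rightarrow> ('g \<Rightarrow> 'u) \<Rightarrow>
   ('k \<Rightarrow> 'w::ring_1 \<Rightarrow> 'w) \<Rightarrow> (('g \<Rightarrow> 'k) \<Rightarrow> 'w) \<Rightarrow> 'w \<Rightarrow> 'u" where
  "alpha g r sU \<iota>U sW \<iota>W u =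
     (let L = alg_extension (dual_lie g r) sW \<iota>W sU (\<lambda>\<xi>. \<iota>U (Lmap g r \<xi>));
          R = alg_extension (dual_lie g r) sW \<iota>W sU (\<lambda>\<xi>. \<iota>U (Rmap g r \<xi>));
          S\<^sub>0 = antipode g sU \<iota>U
      in lift_alg sW (\<lambda>a b. L a * S\<^sub>0 (R b)) (coproduct (dual_lie g r) sW \<iota>W u))"

definition Theta ::
  "('k::field_char_0, 'g::ab_group_add) lie \<Rightarrow> ('k, 'g, 'g) tens \<Rightarrow>
   ('k \<Rightarrow> 'u::ring_1 \<Rightarrow> 'u) \<Rightarrow> ('g \<Rightarrow> 'u) \<Rightarrow>
   ('k \<Rightarrow> 'w::ring_1 \<Rightarrow> 'w) \<Rightarrow> (('g \<Rightarrow> 'k) \<Rightarrow> 'w) \<Rightarrow> 'u \<Rightarrow> 'w" where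
  "Theta g r sU \<iota>U sW \<iota>W = restrict (inv (alpha g r sU \<iota>U sW \<iota>W)) center"

section \<open>The subalgebra \<open>C\<^sub>1\<close>\<close>

definition copoisson ::
  "('k::field_char_0, 'g::ab_group_add) lie \<Rightarrow> ('k, 'g, 'g) tens \<Rightarrow>
   ('k \<Rightarrow> 'w::ring_1 \<Rightarrow> 'w) \<Rightarrow> (('g \<Rightarrow> 'k) \<Rightarrow> 'w) \<Rightarrow> 'w \<Rightarrow> ('k, 'w, 'w) tens" where
  "copoisson g r sW \<iota>W =
     (let d = dual_lie g r; \<Delta> = coproduct d sW \<iota>W; WW = tensor (full sW) (full sW) in
      THE \<phi>. Vector_Spaces.linear sW (scl WW) \<phi> \<and> (\<forall>x. \<phi> x \<in> carr WW) \<and>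
        (\<forall>x y. \<phi> (x * y) = tens_mult sW (\<phi> x) (\<Delta> y) + tens_mult sW (\<Delta> x) (\<phi> y)) \<and>
        (\<forall>\<xi>\<in>carr d. \<phi> (\<iota>W \<xi>) =
           lift d d (\<lambda>m n. tens_alg sW (\<iota>W m) (\<iota>W n)) (dual_cobracket g r \<xi>)))"

text \<open>
  \<open>C\<^sub>1\<close> is the kernel of \<open>\<delta> - (id \<otimes> D) \<circ> \<Delta>\<^sub>0\<close>. Since \<open>\<delta>\<close> is antisymmetric and \<open>\<Delta>\<^sub>0\<close> symmetric,
  this is the kernel of \<open>\<delta> + (D \<otimes> id) \<circ> \<Delta>\<^sub>0\<close>. The factor on which \<open>D\<close> acts (equivalently the sign)
  matters and is forced by the conventions for \<open>L\<close>, \<open>R\<close> and \<open>alpha\<close>: take \<open>g = sl\<^sub>2\<close> with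
  \<open>r = h \<otimes> h / 4 + e \<otimes> f\<close>, and let \<open>H, E, F\<close> be the basis of \<open>g*\<close> dual to \<open>h, e, f\<close>. The Casimir
  element \<open>h\<^sup>2 / 2 + e f + f e\<close> is the image under \<open>alpha\<close> of \<open>u = 2 H\<^sup>2 + 2 E F + 2 H\<close>, for which
  \<open>\<delta> u = 2 (E \<otimes> F - F \<otimes> E) = (id \<otimes> D) (\<Delta>\<^sub>0 u) = - (D \<otimes> id) (\<Delta>\<^sub>0 u)\<close>.
\<close>

definition C1 ::
  "('k::field_char_0, 'g::ab_group_add) lie \<Rightarrow> ('k, 'g, 'g) tens \<Rightarrow>
   ('k \<Rightarrow> 'w::ring_1 \<Rightarrow> 'w) \<Rightarrow> (('g \<Rightarrow> 'k) \<Rightarrow> 'w) \<Rightarrow> 'w set" where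
  "C1 g r sW \<iota>W =
     (let d = dual_lie g r; D = der_extension d sW \<iota>W (dual_D g r) in
      {u. copoisson g r sW \<iota>W u - lift_alg sW (\<lambda>a b. tens_alg sW a (D b)) (coproduct d sW \<iota>W u) = 0})"

section \<open>Associated graded and invariants\<close>

text \<open>\<open>degree_below V s \<iota> n\<close> is the \<open>(n - 1)\<close>-st step of the degree filtration, and \<open>0\<close> for \<open>n = 0\<close>.\<close>

definition degree_below ::
  "'v set \<Rightarrow> ('k::field \<Rightarrow> 'u::ring_1 \<Rightarrow> 'u) \<Rightarrow> ('v \<Rightarrow> 'u) \<Rightarrow> nat \<Rightarrow> 'u set" where
  "degree_below V s \<iota> n = module.span s {prod_list (map \<iota> w) | w. set w \<subseteq> V \<and> length w < n}"

text \<open>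
  \<open>has_symbol V s \<iota> sS \<iota>S n u x\<close>: \<open>u\<close> has filtration degree at most \<open>n\<close>, and its class in degree
  \<open>n\<close> of the associated graded of the enveloping algebra corresponds to \<open>x\<close> in \<open>S\<^sup>n\<close> under the
  Poincare-Birkhoff-Witt isomorphism \<open>x\<^sub>1 \<cdots> x\<^sub>n \<mapsto> [x\<^sub>1 \<cdots> x\<^sub>n]\<close>.
\<close>

definition has_symbol ::
  "'v set \<Rightarrow> ('k::field \<Rightarrow> 'u::ring_1 \<Rightarrow> 'u) \<Rightarrow> ('v \<Rightarrow> 'u) \<Rightarrow>
   ('k \<Rightarrow> 's::comm_ring_1 \<Rightarrow> 's) \<Rightarrow> ('v \<Rightarrow> 's) \<Rightarrow> nat \<Rightarrow> 'u \<Rightarrow> 's \<Rightarrow> bool" where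
  "has_symbol V s \<iota> sS \<iota>S n u x \<longleftrightarrow>
     (\<exists>p\<in>word_combs V. (\<forall>w\<in>Poly_Mapping.keys p. length w = n) \<and>
        word_eval sS \<iota>S p = x \<and> u - word_eval s \<iota> p \<in> degree_below V s \<iota> n)"

text \<open>
  The associated graded of a subspace \<open>C\<close> for the induced filtration, as a subspace of the symmetric
  algebra.
\<close>

definition assoc_graded ::
  "'v set \<Rightarrow> ('k::field \<Rightarrow> 'u::ring_1 \<Rightarrow> 'u) \<Rightarrow> ('v \<Rightarrow> 'u) \<Rightarrow>
   ('k \<Rightarrow> 's::comm_ring_1 \<Rightarrow> 's) \<Rightarrow> ('v \<Rightarrow> 's) \<Rightarrow> 'u set \<Rightarrow> 's set" where
  "assoc_graded V s \<iota> sS \<iota>S C = module.span sS {x. \<exists>n. \<exists>u\<in>C. has_symbol V s \<iota> sS \<iota>S n u x}"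

definition coad :: "('k::field, 'g::ab_group_add) lie \<Rightarrow> 'g \<Rightarrow> ('g \<Rightarrow> 'k) \<Rightarrow> ('g \<Rightarrow> 'k)" where
  "coad g x \<xi> = (\<lambda>y. - \<xi> (brk g x y))"

definition sym_invariants ::
  "('k::field_char_0, 'g::ab_group_add) lie \<Rightarrow> ('k, 'g, 'g) tens \<Rightarrow>
   ('k \<Rightarrow> 's::comm_ring_1 \<Rightarrow> 's) \<Rightarrow> (('g \<Rightarrow> 'k) \<Rightarrow> 's) \<Rightarrow> 's set" where
  "sym_invariants g r sS \<iota>S =
     {f. \<forall>x\<in>carr g. der_extension (dual_lie g r) sS \<iota>S (coad g x) f = 0}"

end

theory Submission
  imports Defs "HOL-Library.Product_Plus"
begin

text \<open>Write \<open>U = U(g)\<close>, \<open>W = U(g\<^sup>*)\<close>, and let \<open>\<tau> = L - R : g\<^sup>* \<rightarrow> g\<close> be the isomorphism given by \<open>t\<close>. The map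
  \<open>\<alpha> : W \<rightarrow> U\<close> is characterised by \<open>\<alpha> 1 = 1\<close> and \<open>\<alpha> (\<xi> w) = L \<xi> \<cdot> \<alpha> w - \<alpha> w \<cdot> R \<xi>\<close>.

  Why \<open>Im \<Theta> = C\<^sub>1\<close>. An element \<open>w\<close> lies in \<open>Im \<Theta>\<close> iff \<open>\<alpha> w\<close> is central, that is, iff \<open>w\<close> is killed by
  all the operators \<open>X\<^sub>x = \<alpha>\<^sup>-\<^sup>1 \<circ> ad x \<circ> \<alpha>\<close> (called \<open>ad_W\<close> below). The recursion for \<open>\<alpha>\<close> turns into
  \<open>X\<^sub>x (\<xi> w) = (ad\<^sup>*\<^sub>x \<xi>) w + X\<^sub>x\<^sub>' w + \<xi> X\<^sub>x w\<close>, where \<open>x' \<in> g\<close> is the component in \<open>g\<close> of the bracket of \<open>x\<close>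
  and \<open>\<xi>\<close> in the Drinfeld double, so that \<open>\<eta>(x') = [\<xi>, \<eta>](x)\<close>. For dual bases \<open>e\<^sub>i\<close>, \<open>e\<^sup>i\<close> this gives the
  key identity
  \<open>\<delta> w - (id \<otimes> D) (\<Delta>\<^sub>0 w) = \<Sum>\<^sub>i (1 \<otimes> e\<^sup>i) \<cdot> \<Delta>\<^sub>0 (X\<^sub>i w)\<close>, where \<open>X\<^sub>i\<close> belongs to \<open>e\<^sub>i\<close>,
  because both sides vanish at \<open>1\<close> and satisfy the same recursion for left multiplication by \<open>\<xi>\<close>
  (\<open>defect_mult\<close>, \<open>copoisson_eq\<close>). A comparison of leading terms shows that the right-hand side
  determines every \<open>X\<^sub>i w\<close> (\<open>canonical_coproduct_injective\<close>); so \<open>w \<in> C\<^sub>1\<close> iff all \<open>X\<^sub>x\<close> kill \<open>w\<close>. The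
  identity also proves that the co-Poisson map exists, and the derivation \<open>D\<close> itself is \<open>X\<^sub>x\<close> for
  \<open>x = 1/2 \<Sum> [a\<^sub>j, b\<^sub>j]\<close> with \<open>r = \<Sum> a\<^sub>j \<otimes> b\<^sub>j\<close>, since by the classical Yang-Baxter equation that element
  leaves \<open>r\<close> invariant (\<open>L_equivariant_h\<^sub>r\<close>, \<open>D_eq\<close>).

  Why \<open>\<alpha>\<close> is bijective, and what \<open>gr C\<^sub>1\<close> is. The Poincare-Birkhoff-Witt theorem for \<open>U\<close> is used in the
  form of symbol maps \<open>\<pi>\<^sub>n : U \<rightarrow> S(g\<^sup>*)\<close> which kill everything of degree less than \<open>n\<close> and are
  multiplicative on leading terms of degree \<open>n\<close> (\<open>enveloping_symbol_maps\<close>). In the other direction, the polarisation maps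
  \<open>\<sigma>\<^sub>n : S(g\<^sup>*) \<rightarrow> U\<close> (or \<open>W\<close>), given by \<open>\<sigma>\<^sub>n\<^sub>+\<^sub>1 f = \<Sum> e\<^sup>i \<sigma>\<^sub>n (\<partial>\<^sub>i f)\<close>, are \<open>n!\<close> times symmetrisation on \<open>S\<^sup>n\<close> and
  zero on the other degrees. Since \<open>\<sigma>\<^sub>n (\<pi>\<^sub>n (\<alpha> w)) = n! w\<close> modulo degree less than \<open>n\<close>, the map \<open>\<alpha>\<close> is
  injective, and it is onto in each degree. The symbol of \<open>w\<close> is \<open>\<pi>\<^sub>n (\<alpha> w)\<close>, and \<open>\<pi>\<^sub>n\<close> commutes with \<open>g\<close>;
  hence the symbols of elements of \<open>C\<^sub>1\<close> are invariant. Conversely, \<open>\<sigma>\<^sub>n\<close> commutes with \<open>g\<close> too, so for an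
  invariant \<open>f\<close> the elements \<open>\<sigma>\<^sub>n f\<close> are central, their preimages under \<open>\<alpha>\<close> are in \<open>C\<^sub>1\<close>, and the symbols
  of these preimages, divided by \<open>n!\<close>, add up to \<open>f\<close>.

  All structure maps (\<open>L\<close>, \<open>R\<close>, antipode, coproduct, derivations, \<open>\<alpha>\<close>, and the module behind the
  symbol maps) come from a single universal property: \<open>U(h)\<close> is the free \<open>h\<close>-module on one generator
  (\<open>module_extension\<close>).\<close>

section \<open>Linear maps on finite combinations of words\<close>

lemma linearI:
  assumes "vector_space s1" "vector_space s2" "\<And>x y. f (x + y) = f x + f y"
    "\<And>c x. f (s1 c x) = s2 c (f x)"
  shows "Vector_Spaces.linear s1 s2 f"
  using assms by (simp add: Vector_Spaces.linear_iff)

lemmas lin_add = module_hom.add[OF module_hom_iff_linear[THEN iffD2]]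
lemmas lin_scale = module_hom.scale[OF module_hom_iff_linear[THEN iffD2]]
lemmas lin_zero = module_hom.zero[OF module_hom_iff_linear[THEN iffD2]]
lemmas lin_diff = module_hom.diff[OF module_hom_iff_linear[THEN iffD2]]
lemmas lin_neg = module_hom.neg[OF module_hom_iff_linear[THEN iffD2]]
lemmas lin_sum = module_hom.sum[OF module_hom_iff_linear[THEN iffD2]]

abbreviation (input) "single \<equiv> Poly_Mapping.single"
abbreviation (input) "keys \<equiv> Poly_Mapping.keys"
abbreviation (input) "lookup \<equiv> Poly_Mapping.lookup"

definition linext :: "('k::field \<Rightarrow> 'a::ab_group_add \<Rightarrow> 'a) \<Rightarrow> ('w \<Rightarrow> 'a) \<Rightarrow> ('w \<Rightarrow>\<^sub>0 'k) \<Rightarrow> 'a" where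
  "linext s F p = (\<Sum>w\<in>keys p. s (lookup p w) (F w))"

abbreviation pscale :: "'k::field \<Rightarrow> ('w \<Rightarrow>\<^sub>0 'k) \<Rightarrow> ('w \<Rightarrow>\<^sub>0 'k)" where
  "pscale c \<equiv> Poly_Mapping.map ((*) c)"

lemma lookup_pscale [simp]: "lookup (pscale c p) w = c * lookup p w"
  by (simp add: map.rep_eq when_def)

lemma vector_space_pscale: "vector_space (pscale :: 'k::field \<Rightarrow> ('w \<Rightarrow>\<^sub>0 'k) \<Rightarrow> _)"
  by unfold_locales
    (auto intro!: poly_mapping_eqI simp: lookup_add algebra_simps)

lemma linext_superset:
  assumes "vector_space s" "finite S" "keys p \<subseteq> S"
  shows "linext s F p = (\<Sum>w\<in>S. s (lookup p w) (F w))"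
proof -
  interpret vector_space s by fact
  show ?thesis unfolding linext_def
    by (rule sum.mono_neutral_left) (use assms in \<open>auto simp: in_keys_iff\<close>)
qed

lemma linext_add:
  assumes "vector_space s"
  shows "linext s F (p + q) = linext s F p + linext s F q"
proof -
  interpret vector_space s by fact
  let ?S = "keys p \<union> keys q"
  have "keys (p + q) \<subseteq> ?S" by (rule Poly_Mapping.keys_add)
  then show ?thesis
    by (simp add: linext_superset[OF assms, of ?S] lookup_add scale_left_distrib sum.distrib)
qed

lemma linext_pscale:
  assumes "vector_space s"
  shows "linext s F (pscale c p) = s c (linext s F p)"
proof -
  interpret vector_space s by fact
  have "keys (pscale c p) \<subseteq> keys p" by (auto simp: in_keys_iff)
  then show ?thesis
    by (simp add: linext_superset[OF assms, of "keys p"] scale_sum_right)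
qed

lemma linear_linext: "vector_space s \<Longrightarrow> Vector_Spaces.linear pscale s (linext s F)"
  by (intro linearI vector_space_pscale linext_add linext_pscale)

lemma linext_single [simp]:
  assumes "vector_space s"
  shows "linext s F (single w c) = s c (F w)"
proof -
  interpret vector_space s by fact
  show ?thesis by (simp add: linext_superset[OF assms, of "{w}"])
qed

lemma linext_zero [simp]: "linext s F 0 = 0"
  by (simp add: linext_def)

lemma word_eval_linext: "word_eval s \<iota> = linext s (\<lambda>w. prod_list (map \<iota> w))"
  by (simp add: word_eval_def linext_def fun_eq_iff)

lemma poly_mapping_keys_induct [consumes 1, case_names zero add]:
  fixes p :: "'w \<Rightarrow>\<^sub>0 'k::field"
  assumes "\<forall>w\<in>keys p. Q w" "P 0"
    and "\<And>p w c. P p \<Longrightarrow> \<forall>w\<in>keys p. Q w \<Longrightarrow> Q w \<Longrightarrow> P (p + single w c)"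
  shows "P p"
proof -
  have "P (\<Sum>w\<in>S. single w (lookup p w)) \<and> (\<forall>w\<in>keys (\<Sum>w\<in>S. single w (lookup p w)). Q w)"
    if "S \<subseteq> keys p" for S
    using finite_subset[OF that finite_keys] that
  proof (induction S rule: finite_induct)
    case (insert w S)
    let ?s = "(\<Sum>w\<in>S. single w (lookup p w))"
    let ?t = "single w (lookup p w)"
    have "Q w" using insert assms by auto
    moreover have "keys (?s + ?t) \<subseteq> keys ?s \<union> {w}"
      using Poly_Mapping.keys_add[of ?s ?t] by (auto split: if_splits)
    ultimately have "P (?s + ?t) \<and> (\<forall>w\<in>keys (?s + ?t). Q w)"
      using insert assms(3)[of ?s w] by blast
    then show ?case using insert by (simp add: add.commute)
  qed (use assms in auto)
  moreover have "(\<Sum>w\<in>keys p. single w (lookup p w)) = p"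
    by (rule poly_mapping_eqI) (simp add: lookup_sum lookup_single when_def in_keys_iff)
  ultimately show ?thesis by (metis order_refl)
qed

section \<open>Enveloping algebras as free modules on one generator\<close>

locale env_alg =
  fixes h :: "('k::field, 'v::ab_group_add) lie" and s :: "'k \<Rightarrow> 'u::ring_1 \<Rightarrow> 'u" and \<iota> :: "'v \<Rightarrow> 'u"
  assumes enveloping: "enveloping_algebra h s \<iota>"
begin

lemma vs: "vector_space s"
  using enveloping by (simp add: enveloping_algebra_def is_algebra_def)

sublocale V: vector_space s by (rule vs)

lemma scale_mult: "s c x * y = s c (x * y)" "x * s c y = s c (x * y)"
  using enveloping by (metis enveloping_algebra_def is_algebra_def)+

lemma ideal_eval: "p \<in> enveloping_ideal h \<Longrightarrow> word_eval s \<iota> p = 0"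
  using enveloping by (auto simp: enveloping_algebra_def)

lemma ideal_gens:
  "set u \<subseteq> carr h \<Longrightarrow> x \<in> carr h \<Longrightarrow> y \<in> carr h \<Longrightarrow> set v \<subseteq> carr h \<Longrightarrow>
    single (u @ [x + y] @ v) 1 - single (u @ [x] @ v) 1
         - single (u @ [y] @ v) 1 \<in> enveloping_ideal h"
  "set u \<subseteq> carr h \<Longrightarrow> x \<in> carr h \<Longrightarrow> set v \<subseteq> carr h \<Longrightarrow>
    single (u @ [scl h c x] @ v) 1 - single (u @ [x] @ v) c \<in> enveloping_ideal h"
  "set u \<subseteq> carr h \<Longrightarrow> x \<in> carr h \<Longrightarrow> y \<in> carr h \<Longrightarrow> set v \<subseteq> carr h \<Longrightarrow>
    single (u @ [x, y] @ v) 1 - single (u @ [y, x] @ v) 1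
         - single (u @ [brk h x y] @ v) 1 \<in> enveloping_ideal h"
  unfolding enveloping_ideal_def
  by (rule module.span_base[OF module_iff_vector_space[THEN iffD2, OF vector_space_pscale]]; blast)+

lemma \<iota>_add: "x \<in> carr h \<Longrightarrow> y \<in> carr h \<Longrightarrow> \<iota> (x + y) = \<iota> x + \<iota> y"
  and \<iota>_scale: "x \<in> carr h \<Longrightarrow> \<iota> (scl h c x) = s c (\<iota> x)"
  and \<iota>_brk: "x \<in> carr h \<Longrightarrow> y \<in> carr h \<Longrightarrow> \<iota> (brk h x y) = \<iota> x * \<iota> y - \<iota> y * \<iota> x"
  using ideal_eval[OF ideal_gens(1)[of "[]" x y "[]"]] ideal_eval[OF ideal_gens(2)[of "[]" x "[]" c]]
    ideal_eval[OF ideal_gens(3)[of "[]" x y "[]"]]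
  by (simp_all add: word_eval_linext lin_diff[OF linear_linext[OF vs]] linext_add vs algebra_simps)

lemma word_eval_onto: obtains p where "p \<in> word_combs (carr h)" "word_eval s \<iota> p = u"
  using enveloping by (force simp: enveloping_algebra_def)

text \<open>Every element is a combination of words, so a linear property propagates along left multiplication
  by generators. Together with \<open>module_extension\<close> this replaces all calculations with words.\<close>

lemma env_induct [case_names add scale one mult]:
  assumes "\<And>u v. P u \<Longrightarrow> P v \<Longrightarrow> P (u + v)" "\<And>c u. P u \<Longrightarrow> P (s c u)"
    and "P 1" "\<And>x u. x \<in> carr h \<Longrightarrow> P u \<Longrightarrow> P (\<iota> x * u)"
  shows "P u"
proof -
  have mon: "P (prod_list (map \<iota> w))" if "set w \<subseteq> carr h" for w
    using that by (induction w) (auto intro: assms)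
  have z: "P 0" using assms(2)[OF assms(3), of 0] by simp
  obtain p where p: "p \<in> word_combs (carr h)" "word_eval s \<iota> p = u" by (rule word_eval_onto)
  have "\<forall>w\<in>keys p. set w \<subseteq> carr h" using p by (simp add: word_combs_def)
  then have "P (word_eval s \<iota> p)"
    by (induction rule: poly_mapping_keys_induct)
      (auto simp: word_eval_linext linext_add vs z intro!: assms(1,2) mon)
  with p show ?thesis by simp
qed

text \<open>The operators \<open>A x\<close> act on words by composition, and the relations required of \<open>A\<close> say precisely that
  the generators of the defining ideal act as zero. The module is a subspace \<open>M\<close> of an ambient type
  because the tensor square of \<open>U\<close> is such a subspace; by varying \<open>M\<close> one obtains
  algebra morphisms, antiautomorphisms, coproducts and derivations alike.\<close>

lemma module_extension:
  fixes sM :: "'k \<Rightarrow> 'm::ab_group_add \<Rightarrow> 'm"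
  assumes vsM: "vector_space sM" and sub: "module.subspace sM M" and z: "z \<in> M"
    and A_M: "\<And>x m. x \<in> carr h \<Longrightarrow> m \<in> M \<Longrightarrow> A x m \<in> M"
    and A_add: "\<And>x m n. x \<in> carr h \<Longrightarrow> m \<in> M \<Longrightarrow> n \<in> M \<Longrightarrow> A x (m + n) = A x m + A x n"
    and A_scale: "\<And>x m c. x \<in> carr h \<Longrightarrow> m \<in> M \<Longrightarrow> A x (sM c m) = sM c (A x m)"
    and add_A: "\<And>x y m. x \<in> carr h \<Longrightarrow> y \<in> carr h \<Longrightarrow> m \<in> M \<Longrightarrow> A (x + y) m = A x m + A y m"
    and scale_A: "\<And>x m c. x \<in> carr h \<Longrightarrow> m \<in> M \<Longrightarrow> A (scl h c x) m = sM c (A x m)"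
    and A_brk: "\<And>x y m. x \<in> carr h \<Longrightarrow> y \<in> carr h \<Longrightarrow> m \<in> M \<Longrightarrow>
      A (brk h x y) m = A x (A y m) - A y (A x m)"
  obtains \<phi> where "Vector_Spaces.linear s sM \<phi>" "\<phi> 1 = z" "\<And>u. \<phi> u \<in> M"
    "\<And>x u. x \<in> carr h \<Longrightarrow> \<phi> (\<iota> x * u) = A x (\<phi> u)"
proof -
  interpret M: vector_space sM by (rule vsM)
  interpret P: vector_space "pscale :: 'k \<Rightarrow> ('v list \<Rightarrow>\<^sub>0 'k) \<Rightarrow> _" by (rule vector_space_pscale)
  define F where "F w = foldr A w z" for w
  let ?e = "word_eval s \<iota>" and ?F = "linext sM F"
  have fold_M: "set w \<subseteq> carr h \<Longrightarrow> m \<in> M \<Longrightarrow> foldr A w m \<in> M" for w m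
    by (induction w) (auto intro: A_M)
  have fold_add: "set w \<subseteq> carr h \<Longrightarrow> m \<in> M \<Longrightarrow> n \<in> M \<Longrightarrow> foldr A w (m + n) = foldr A w m + foldr A w n" for w m n
    by (induction w) (auto simp: A_add fold_M)
  have fold_scale: "set w \<subseteq> carr h \<Longrightarrow> m \<in> M \<Longrightarrow> foldr A w (sM c m) = sM c (foldr A w m)" for w m c
    by (induction w) (auto simp: A_scale fold_M)
  have fold_diff: "set w \<subseteq> carr h \<Longrightarrow> m \<in> M \<Longrightarrow> n \<in> M \<Longrightarrow> foldr A w (m - n) = foldr A w m - foldr A w n" for w m n
    using fold_add[of w "m - n" n] M.subspace_diff[OF sub] by (simp add: algebra_simps)
  have lin: "Vector_Spaces.linear pscale sM ?F" by (rule linear_linext[OF vsM])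
  have ideal: "?F p = 0" if "p \<in> enveloping_ideal h" for p
    using that unfolding enveloping_ideal_def
  proof (rule P.span_induct)
    show "P.subspace {p. ?F p = 0}"
      by (rule P.subspaceI) (auto simp: linext_add linext_pscale vsM)
  next
    fix q assume "q \<in> {single (u @ [x + y] @ v) 1 - single (u @ [x] @ v) 1
         - single (u @ [y] @ v) 1 |
         u x y v. set u \<subseteq> carr h \<and> x \<in> carr h \<and> y \<in> carr h \<and> set v \<subseteq> carr h} \<union>
      {single (u @ [scl h c x] @ v) 1 - single (u @ [x] @ v) c |
         u c x v. set u \<subseteq> carr h \<and> x \<in> carr h \<and> set v \<subseteq> carr h} \<union>
      {single (u @ [x, y] @ v) 1 - single (u @ [y, x] @ v) 1
         - single (u @ [brk h x y] @ v) 1 |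
         u x y v. set u \<subseteq> carr h \<and> x \<in> carr h \<and> y \<in> carr h \<and> set v \<subseteq> carr h}"
    then show "?F q = 0"
    proof (elim UnE CollectE exE conjE)
      fix u x y v assume q: "q = single (u @ [x + y] @ v) 1 - single (u @ [x] @ v) 1
         - single (u @ [y] @ v) 1" and c: "set u \<subseteq> carr h" "x \<in> carr h" "y \<in> carr h" "set v \<subseteq> carr h"
      have "F v \<in> M" using c z by (simp add: F_def fold_M)
      then show ?thesis using c
        by (simp add: q lin_diff[OF lin] vsM F_def add_A fold_add A_M)
    next
      fix u c x v assume q: "q = single (u @ [scl h c x] @ v) 1 - single (u @ [x] @ v) c"
        and c: "set u \<subseteq> carr h" "x \<in> carr h" "set v \<subseteq> carr h"
      have "F v \<in> M" using c z by (simp add: F_def fold_M)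
      then show ?thesis using c
        by (simp add: q lin_diff[OF lin] vsM F_def scale_A fold_scale A_M)
    next
      fix u x y v assume q: "q = single (u @ [x, y] @ v) 1 - single (u @ [y, x] @ v) 1
         - single (u @ [brk h x y] @ v) 1"
        and c: "set u \<subseteq> carr h" "x \<in> carr h" "y \<in> carr h" "set v \<subseteq> carr h"
      have "F v \<in> M" using c z by (simp add: F_def fold_M)
      then show ?thesis using c
        by (simp add: q lin_diff[OF lin] vsM F_def A_brk fold_diff A_M)
    qed
  qed
  define \<phi> where "\<phi> u = ?F (SOME p. p \<in> word_combs (carr h) \<and> ?e p = u)" for u
  have wc_diff: "p - q \<in> word_combs V" if "p \<in> word_combs V" "q \<in> word_combs V" for p q :: "'v list \<Rightarrow>\<^sub>0 'k" and V
  proof -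
    have "w \<in> keys p \<or> w \<in> keys q" if "w \<in> keys (p - q)" for w
      using that by (auto simp: in_keys_iff lookup_minus)
    then show ?thesis using that unfolding word_combs_def by blast
  qed
  have wc_add: "p + q \<in> word_combs V" if "p \<in> word_combs V" "q \<in> word_combs V" for p q :: "'v list \<Rightarrow>\<^sub>0 'k" and V
    using that Poly_Mapping.keys_add[of p q] unfolding word_combs_def by blast
  have \<phi>: "\<phi> (?e p) = ?F p" if p: "p \<in> word_combs (carr h)" for p
  proof -
    let ?q = "SOME q. q \<in> word_combs (carr h) \<and> ?e q = ?e p"
    have q: "?q \<in> word_combs (carr h) \<and> ?e ?q = ?e p" by (rule someI[of _ p]) (simp add: p)
    then have "?q - p \<in> word_combs (carr h)" using p by (auto intro: wc_diff)
    moreover have "?e (?q - p) = 0"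
      using q by (simp add: word_eval_linext lin_diff[OF linear_linext[OF vs]])
    ultimately have "?q - p \<in> enveloping_ideal h" using enveloping by (auto simp: enveloping_algebra_def)
    then have "?F (?q - p) = 0" by (rule ideal)
    then show ?thesis by (simp add: \<phi>_def lin_diff[OF lin])
  qed
  have lin\<phi>: "Vector_Spaces.linear s sM \<phi>"
  proof (rule linearI[OF vs vsM])
    fix u v c
    obtain p where p: "p \<in> word_combs (carr h)" "?e p = u" by (rule word_eval_onto)
    obtain q where q: "q \<in> word_combs (carr h)" "?e q = v" by (rule word_eval_onto)
    have "\<phi> (?e (p + q)) = ?F p + ?F q" using p q by (simp add: \<phi> wc_add linext_add vsM)
    then show "\<phi> (u + v) = \<phi> u + \<phi> v" using \<phi>[OF p(1)] \<phi>[OF q(1)] p q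
      by (simp add: word_eval_linext linext_add vs)
    have "pscale c p \<in> word_combs (carr h)" using p by (auto simp: word_combs_def in_keys_iff)
    from \<phi>[OF this] show "\<phi> (s c u) = sM c (\<phi> u)" using p \<phi>[OF p(1)]
      by (simp add: word_eval_linext linext_pscale vs vsM)
  qed
  have one: "\<phi> 1 = z"
    using \<phi>[of "single [] 1"] by (simp add: word_combs_def word_eval_linext vs vsM F_def)
  have main: "\<phi> (?e p) \<in> M \<and> \<phi> (\<iota> x * ?e p) = A x (\<phi> (?e p))" if "p \<in> word_combs (carr h)" and x: "x \<in> carr h" for p x
  proof -
    have "\<forall>w\<in>keys p. set w \<subseteq> carr h" using that by (simp add: word_combs_def)
    then show ?thesis
    proof (induction rule: poly_mapping_keys_induct)
      case zero
      have "A x 0 = 0" using A_scale[OF x z, of 0] by simp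
      then show ?case using lin_zero[OF lin\<phi>] M.subspace_0[OF sub] by (simp add: word_eval_linext)
    next
      case (add p w c)
      let ?m = "prod_list (map \<iota> w)"
      have 1: "\<phi> (prod_list (map \<iota> w')) = F w'" if "set w' \<subseteq> carr h" for w'
        using \<phi>[of "single w' 1"] that by (simp add: word_combs_def word_eval_linext vs vsM)
      have "\<phi> (\<iota> x * ?m) = A x (F w)" using 1[of "x # w"] add x by (simp add: F_def)
      moreover have "F w \<in> M" using add z by (simp add: F_def fold_M)
      moreover have "sM c (F w) \<in> M" using calculation M.subspace_scale[OF sub] by blast
      moreover have "?e (p + single w c) = ?e p + s c ?m"
        by (simp add: word_eval_linext linext_add vs)
      moreover have "\<phi> ?m = F w" using 1 add by blast
      ultimately show ?case using add x M.subspace_add[OF sub]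
        by (simp add: ring_distribs scale_mult lin_add[OF lin\<phi>] lin_scale[OF lin\<phi>] A_add A_scale)
    qed
  qed
  show thesis
  proof (rule that[OF lin\<phi> one])
    fix u obtain p where p: "p \<in> word_combs (carr h)" "?e p = u" by (rule word_eval_onto)
    show "\<phi> u \<in> M"
    \<comment> \<open>Without generators \<open>main\<close> is void; then all words are empty.\<close>
    proof (cases "carr h = {}")
      case False
      then show ?thesis using main[OF p(1)] p(2) by blast
    next
      case True
      have "\<forall>w\<in>keys p. set w \<subseteq> carr h" using p by (simp add: word_combs_def)
      then have "\<phi> (?e p) \<in> M"
        by (induction rule: poly_mapping_keys_induct)
          (auto simp: word_eval_linext True linext_add vs lin_zero[OF lin\<phi>] lin_add[OF lin\<phi>] lin_scale[OF lin\<phi>] one z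
            intro!: M.subspace_0[OF sub] M.subspace_add[OF sub] M.subspace_scale[OF sub])
      with p show ?thesis by simp
    qed
    show "x \<in> carr h \<Longrightarrow> \<phi> (\<iota> x * u) = A x (\<phi> u)" for x
      using main[OF p(1)] p(2) by blast
  qed
qed

lemma linear_eqI:
  assumes "Vector_Spaces.linear s sM \<phi>" "Vector_Spaces.linear s sM \<psi>" "\<phi> 1 = \<psi> 1"
    and "\<And>x u. x \<in> carr h \<Longrightarrow> \<phi> u = \<psi> u \<Longrightarrow> \<phi> (\<iota> x * u) = \<psi> (\<iota> x * u)"
  shows "\<phi> = \<psi>"
proof
  fix u show "\<phi> u = \<psi> u"
    by (induction u rule: env_induct)
      (use assms in \<open>auto simp: lin_add[OF assms(1)] lin_add[OF assms(2)] lin_scale[OF assms(1)] lin_scale[OF assms(2)]\<close>)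
qed

abbreviation filt :: "nat \<Rightarrow> 'u set" where
  "filt \<equiv> degree_below (carr h) s \<iota>"

lemma filt_subspace: "V.subspace (filt n)"
  by (simp add: degree_below_def)

lemmas filt_add = V.subspace_add[OF filt_subspace]
  and filt_scale = V.subspace_scale[OF filt_subspace]
  and filt_diff = V.subspace_diff[OF filt_subspace]
  and filt_zero = V.subspace_0[OF filt_subspace]
  and filt_sum = V.subspace_sum[OF filt_subspace]

lemma filt_0 [simp]: "filt 0 = {0}"
  by (simp add: degree_below_def)

lemma filt_mono: "m \<le> n \<Longrightarrow> filt m \<subseteq> filt n"
  unfolding degree_below_def by (rule V.span_mono) auto

lemma filt_Suc: "u \<in> filt n \<Longrightarrow> u \<in> filt (Suc n)"
  using filt_mono[of n "Suc n"] by auto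

lemma filt_monomial: "set w \<subseteq> carr h \<Longrightarrow> length w < n \<Longrightarrow> prod_list (map \<iota> w) \<in> filt n"
  unfolding degree_below_def by (rule V.span_base) blast

lemma filt_one: "1 \<in> filt (Suc n)"
  using filt_monomial[of "[]"] by simp

text \<open>Elements of degree at most \<open>n\<close> are combinations of \<open>1\<close> and of products of a generator with an element
  of degree less than \<open>n\<close>; this is the form in which the degree filtration enters all inductions below.\<close>

lemma filt_Suc_induct [consumes 1, case_names add scale one mult]:
  assumes "u \<in> filt (Suc n)" "\<And>u v. P u \<Longrightarrow> P v \<Longrightarrow> P (u + v)" "\<And>c u. P u \<Longrightarrow> P (s c u)"
    and "P 1" "\<And>x u. x \<in> carr h \<Longrightarrow> u \<in> filt n \<Longrightarrow> P (\<iota> x * u)"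
  shows "P u"
proof -
  have "u \<in> V.span {prod_list (map \<iota> w) |w. set w \<subseteq> carr h \<and> length w < Suc n}"
    using assms(1) by (simp add: degree_below_def)
  then show "P u"
  proof (rule V.span_induct)
    show "V.subspace (Collect P)"
      using assms(2,3) assms(3)[OF assms(4), of 0] by (intro V.subspaceI) auto
  next
    fix v assume "v \<in> {prod_list (map \<iota> w) |w. set w \<subseteq> carr h \<and> length w < Suc n}"
    then obtain w where w: "v = prod_list (map \<iota> w)" "set w \<subseteq> carr h" "length w < Suc n" by blast
    show "P v"
    proof (cases w)
      case (Cons x w')
      then show ?thesis using w assms(5)[OF _ filt_monomial[of w']] by auto
    qed (use w assms(4) in auto)
  qed
qed

lemma filt_mult: "x \<in> carr h \<Longrightarrow> u \<in> filt n \<Longrightarrow> \<iota> x * u \<in> filt (Suc n)"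
proof (induction n arbitrary: u)
  case 0
  then show ?case using filt_zero by simp
next
  case (Suc n)
  from Suc.prems(2) show ?case
    unfolding degree_below_def[of _ _ _ "Suc n"]
  proof (rule V.span_induct)
    show "V.subspace {a. \<iota> x * a \<in> filt (Suc (Suc n))}"
      by (rule V.subspaceI) (auto simp: filt_zero ring_distribs scale_mult intro: filt_add filt_scale)
  next
    fix v assume "v \<in> {prod_list (map \<iota> w) |w. set w \<subseteq> carr h \<and> length w < Suc n}"
    then obtain w where "v = prod_list (map \<iota> w)" "set w \<subseteq> carr h" "length w < Suc n" by blast
    then show "\<iota> x * v \<in> filt (Suc (Suc n))"
      using filt_monomial[of "x # w" "Suc (Suc n)"] Suc.prems(1) by simp
  qed
qed

lemma filt_exhaust: "\<exists>n. u \<in> filt n"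
proof (induction u rule: env_induct)
  case (add u v)
  then obtain m n where "u \<in> filt m" "v \<in> filt n" by blast
  then have "u + v \<in> filt (max m n)"
    using filt_mono[of m "max m n"] filt_mono[of n "max m n"] by (auto intro: filt_add)
  then show ?case by blast
qed (use filt_scale filt_one filt_mult in blast)+

end

text \<open>Commutators with generators do not raise the degree as soon as the bracket stays in the carrier.\<close>

locale env_lie = env_alg +
  assumes brk_closed: "x \<in> carr h \<Longrightarrow> y \<in> carr h \<Longrightarrow> brk h x y \<in> carr h"
begin

lemma filt_commute: "x \<in> carr h \<Longrightarrow> u \<in> filt n \<Longrightarrow> \<iota> x * u - u * \<iota> x \<in> filt n"
proof (induction n arbitrary: u)
  case (Suc n)
  from Suc.prems(2) show ?case
  proof (induction rule: filt_Suc_induct)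
    case (add u v)
    then have "(\<iota> x * u - u * \<iota> x) + (\<iota> x * v - v * \<iota> x) \<in> filt (Suc n)" by (rule filt_add)
    then show ?case by (simp add: algebra_simps)
  next
    case (scale c u)
    then have "s c (\<iota> x * u - u * \<iota> x) \<in> filt (Suc n)" by (rule filt_scale)
    then show ?case by (simp add: scale_mult V.scale_right_diff_distrib)
  next
    case one
    show ?case by (simp add: filt_zero)
  next
    case (mult y u)
    have "\<iota> x * (\<iota> y * u) - \<iota> y * u * \<iota> x = \<iota> (brk h x y) * u + \<iota> y * (\<iota> x * u - u * \<iota> x)"
      using mult Suc.prems by (simp add: \<iota>_brk algebra_simps)
    then show ?case using mult Suc brk_closed by (auto intro!: filt_add filt_mult)
  qed
qed simp

lemma filt_mult_right: "x \<in> carr h \<Longrightarrow> u \<in> filt n \<Longrightarrow> u * \<iota> x \<in> filt (Suc n)"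
  using filt_diff[OF filt_mult filt_Suc[OF filt_commute], of x u n x u] by (simp add: algebra_simps)

end

section \<open>Symbol maps: the Poincare-Birkhoff-Witt theorem\<close>

lemma linext_cong:
  "(\<And>w. w \<in> keys p \<Longrightarrow> F w = G w) \<Longrightarrow> linext s F p = linext s G p"
  by (simp add: linext_def)

lemma linext_sum_scale:
  assumes "vector_space s"
  shows "linext s (\<lambda>w. \<Sum>i\<in>I. s (c i) (F i w)) p = (\<Sum>i\<in>I. s (c i) (linext s (F i) p))"
proof -
  interpret vector_space s by fact
  show ?thesis
    by (simp add: linext_def scale_sum_right sum.swap[of _ "keys p"] mult.commute)
qed

text \<open>A Lie algebra with basis \<open>e 0, \<dots>, e (N - 1)\<close> and dual basis \<open>co\<close>. The aim of this section is an action of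
  the Lie algebra on polynomials, i.e. on combinations of sorted lists of indices, in which \<open>x\<close> acts as
  multiplication by \<open>x\<close> up to terms of lower degree.\<close>

locale lie_coord =
  fixes g :: "('k::field, 'g::ab_group_add) lie" and N :: nat and e :: "nat \<Rightarrow> 'g"
    and co :: "nat \<Rightarrow> 'g \<Rightarrow> 'k"
  assumes lie: "lie_algebra g" and univ: "carr g = UNIV"
    and co_linear: "Vector_Spaces.linear (scl g) (*) (co i)"
    and co_expand: "(\<Sum>i<N. scl g (co i x) (e i)) = x"
    and co_e: "i < N \<Longrightarrow> j < N \<Longrightarrow> co i (e j) = (if i = j then 1 else 0)"
begin

lemma vs_g: "vector_space (scl g)"
  using lie by (simp add: lie_algebra_def is_vspace_def)

sublocale G: vector_space "scl g" by (rule vs_g)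

lemma brk_add: "brk g (x + y) z = brk g x z + brk g y z" "brk g x (y + z) = brk g x y + brk g x z"
  and brk_scale: "brk g (scl g c x) y = scl g c (brk g x y)" "brk g x (scl g c y) = scl g c (brk g x y)"
  and brk_self [simp]: "brk g x x = 0"
  and jacobi: "brk g x (brk g y z) + brk g y (brk g z x) + brk g z (brk g x y) = 0"
  using lie by (simp_all add: lie_algebra_def bilinear_on_def univ)

lemma brk_anti: "brk g x y = - brk g y x"
  using brk_self[of "x + y"] by (simp only: brk_add) (simp add: eq_neg_iff_add_eq_0 add.commute)

lemma brk_zero [simp]: "brk g 0 x = 0" "brk g x 0 = 0"
  using brk_add(1)[of 0 0 x] brk_add(2)[of x 0 0] by simp_all

lemma brk_neg: "brk g (- x) y = - brk g x y" "brk g x (- y) = - brk g x y"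
  using brk_add(1)[of x "- x" y] brk_add(2)[of x y "- y"] by (simp_all add: eq_neg_iff_add_eq_0 add.commute)

lemma brk_diff: "brk g (x - y) z = brk g x z - brk g y z" "brk g x (y - z) = brk g x y - brk g x z"
  using brk_add(1)[of "x - y" y z] brk_add(2)[of x "y - z" z] by (simp_all add: algebra_simps)

lemma brk_sum: "brk g (\<Sum>i\<in>I. f i) y = (\<Sum>i\<in>I. brk g (f i) y)" "brk g y (\<Sum>i\<in>I. f i) = (\<Sum>i\<in>I. brk g y (f i))"
  by (induction I rule: infinite_finite_induct) (auto simp: brk_add)

lemmas co_add = lin_add[OF co_linear] and co_scale = lin_scale[OF co_linear]

lemma linear_expand:
  assumes "Vector_Spaces.linear (scl g) s f"
  shows "(\<Sum>i<N. s (co i x) (f (e i))) = f x"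
proof -
  have "f (\<Sum>i<N. scl g (co i x) (e i)) = (\<Sum>i<N. s (co i x) (f (e i)))"
    by (simp add: lin_sum[OF assms] lin_scale[OF assms])
  then show ?thesis by (simp add: co_expand)
qed

type_synonym 'a mons = "nat list \<Rightarrow>\<^sub>0 'a"

text \<open>On a sorted list \<open>m\<close> the generator \<open>e i\<close> is to act by \<open>insort i m\<close> plus \<open>lower_terms (length m) i m\<close>. The
  recursion is forced: if \<open>j < i\<close>, then the module axiom gives \<open>e\<^sub>i e\<^sub>j m' = e\<^sub>j e\<^sub>i m' + [e\<^sub>i, e\<^sub>j] m'\<close>. The leading
  term of \<open>e\<^sub>i m'\<close> becomes \<open>j # insort i m'\<close> under \<open>e\<^sub>j\<close>, and all other terms have length at most
  \<open>length m'\<close>. The first argument bounds the length of the lists on which the values are meaningful; it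
  makes the definition primitive recursive although the lists to which it recurs are computed.\<close>

primrec lower_terms :: "nat \<Rightarrow> nat \<Rightarrow> nat list \<Rightarrow> 'k mons" where
  "lower_terms 0 i m = 0"
| "lower_terms (Suc n) i m = (case m of [] \<Rightarrow> 0 | j # m' \<Rightarrow> if i \<le> j then 0 else
     linext pscale (\<lambda>w. single (insort j w) 1 + lower_terms n j w) (lower_terms n i m') +
     (\<Sum>k<N. pscale (co k (brk g (e i) (e j))) (single (insort k m') 1 + lower_terms n k m')))"

definition mons_below :: "nat \<Rightarrow> 'k mons set" where
  "mons_below n = {p. \<forall>w\<in>keys p. sorted w \<and> length w < n}"

lemma vs_M: "vector_space (pscale :: 'k \<Rightarrow> 'k mons \<Rightarrow> 'k mons)"
  by (rule vector_space_pscale)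

interpretation M: vector_space "pscale :: 'k \<Rightarrow> 'k mons \<Rightarrow> 'k mons" by (rule vs_M)

lemma mons_below_subspace: "M.subspace (mons_below n)"
proof (rule M.subspaceI)
  fix p q :: "'k mons" assume "p \<in> mons_below n" "q \<in> mons_below n"
  then show "p + q \<in> mons_below n"
    using Poly_Mapping.keys_add[of p q] unfolding mons_below_def by blast
qed (auto simp: mons_below_def in_keys_iff)

lemmas mons_add = M.subspace_add[OF mons_below_subspace]
  and mons_scale = M.subspace_scale[OF mons_below_subspace]
  and mons_zero = M.subspace_0[OF mons_below_subspace]
  and mons_sum = M.subspace_sum[OF mons_below_subspace]

lemma mons_single: "sorted w \<Longrightarrow> length w < n \<Longrightarrow> single w c \<in> mons_below n"
  by (simp add: mons_below_def)

lemma mons_insort: "sorted w \<Longrightarrow> length w < n \<Longrightarrow> single (insort i w) c \<in> mons_below (Suc n)"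
  by (simp add: mons_below_def sorted_insort)

lemma mons_mono: "p \<in> mons_below m \<Longrightarrow> m \<le> n \<Longrightarrow> p \<in> mons_below n"
  by (force simp: mons_below_def)

lemma mons_linext:
  assumes "p \<in> mons_below m" "\<And>w. sorted w \<Longrightarrow> length w < m \<Longrightarrow> F w \<in> mons_below n"
  shows "linext pscale F p \<in> mons_below n"
  unfolding linext_def
proof (intro mons_sum mons_scale)
  fix w assume "w \<in> keys p"
  then have "sorted w" "length w < m" using assms(1) by (auto simp: mons_below_def)
  then show "F w \<in> mons_below n" by (rule assms(2))
qed

lemma mons_induct [consumes 1, case_names zero add]:
  assumes "p \<in> mons_below n" "P 0"
    and "\<And>p w c. P p \<Longrightarrow> sorted w \<Longrightarrow> length w < n \<Longrightarrow> P (p + single w c)"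
  shows "P p"
proof -
  have "\<forall>w\<in>keys p. sorted w \<and> length w < n" using assms(1) by (simp add: mons_below_def)
  then show ?thesis by (induction rule: poly_mapping_keys_induct) (auto intro: assms(2,3))
qed

lemma lower_terms_mons: "sorted m \<Longrightarrow> lower_terms n i m \<in> mons_below (Suc (length m))"
proof (induction n arbitrary: i m)
  case (Suc n)
  show ?case
  proof (cases m)
    case (Cons j m')
    have ops: "single (insort k w) 1 + lower_terms n k w \<in> mons_below (Suc (length m))"
      if "sorted w" "length w < length m" for k w
      using that by (intro mons_add mons_insort mons_mono[OF Suc.IH]) auto
    have "lower_terms n i m' \<in> mons_below (length m)" using Suc Cons by simp
    then have "linext pscale (\<lambda>w. single (insort j w) 1 + lower_terms n j w) (lower_terms n i m')
        \<in> mons_below (Suc (length m))"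
      using ops by (rule mons_linext)
    moreover have "(\<Sum>k<N. pscale (co k (brk g (e i) (e j))) (single (insort k m') 1 + lower_terms n k m'))
        \<in> mons_below (Suc (length m))"
      by (intro mons_sum mons_scale ops) (use Suc.prems Cons in auto)
    ultimately show ?thesis by (simp add: Cons mons_add mons_zero)
  qed (simp add: mons_zero)
qed (simp add: mons_zero)

lemma lower_terms_stable_Suc: "sorted m \<Longrightarrow> length m \<le> n \<Longrightarrow> lower_terms (Suc n) i m = lower_terms n i m"
proof (induction n arbitrary: i m)
  case (Suc n)
  show ?case
  proof (cases m)
    case (Cons j m')
    have m': "sorted m'" "length m' \<le> n" using Suc.prems Cons by simp_all
    have "linext pscale (\<lambda>w. single (insort j w) 1 + lower_terms (Suc n) j w) (lower_terms n i m') =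
          linext pscale (\<lambda>w. single (insort j w) 1 + lower_terms n j w) (lower_terms n i m')"
    proof (rule linext_cong)
      fix w assume "w \<in> keys (lower_terms n i m')"
      then have "sorted w" "length w \<le> n"
        using lower_terms_mons[OF m'(1), of n i] m'(2) by (auto simp: mons_below_def)
      then show "single (insort j w) 1 + lower_terms (Suc n) j w = single (insort j w) 1 + lower_terms n j w"
        using Suc.IH by metis
    qed
    then show ?thesis
      unfolding lower_terms.simps(2)[of "Suc n"] lower_terms.simps(2)[of n i m] Cons list.case Suc.IH[OF m'] by simp
  qed simp
qed simp

lemma lower_terms_stable: "sorted m \<Longrightarrow> length m \<le> n \<Longrightarrow> lower_terms n i m = lower_terms (length m) i m"
  by (induction n rule: nat_induct) (use lower_terms_stable_Suc le_Suc_eq in \<open>auto simp del: lower_terms.simps(2)\<close>)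

definition act :: "nat \<Rightarrow> nat list \<Rightarrow> 'k mons" where
  "act i m = single (insort i m) 1 + lower_terms (length m) i m"

definition Act :: "'g \<Rightarrow> 'k mons \<Rightarrow> 'k mons" where
  "Act x = linext pscale (\<lambda>m. \<Sum>i<N. pscale (co i x) (act i m))"

lemma Act_linear: "Vector_Spaces.linear pscale pscale (Act x)"
  unfolding Act_def by (rule linear_linext[OF vs_M])

lemmas Act_lin = lin_add[OF Act_linear] lin_diff[OF Act_linear] lin_scale[OF Act_linear] lin_zero[OF Act_linear]

lemma Act_sum: "Act x p = (\<Sum>i<N. pscale (co i x) (linext pscale (act i) p))"
  unfolding Act_def by (rule linext_sum_scale[OF vs_M])

lemma Act_add_left: "Act (x + y) p = Act x p + Act y p"
  by (simp add: Act_sum co_add M.scale_left_distrib sum.distrib)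

lemma Act_scale_left: "Act (scl g c x) p = pscale c (Act x p)"
  by (simp only: Act_sum co_scale M.scale_sum_right M.scale_scale)

lemma Act_neg_left: "Act (- x) p = - Act x p"
  using Act_scale_left[of "-1" x p] by simp

lemma Act_e: "i < N \<Longrightarrow> Act (e i) p = linext pscale (act i) p"
proof -
  assume i: "i < N"
  have "Act (e i) p = (\<Sum>j<N. if j = i then linext pscale (act i) p else 0)"
    unfolding Act_sum by (rule sum.cong) (use i in \<open>auto simp: co_e\<close>)
  then show ?thesis using i by simp
qed

lemma Act_mons: "p \<in> mons_below n \<Longrightarrow> Act x p \<in> mons_below (Suc n)"
  unfolding Act_def
  by (rule mons_linext)
    (auto simp: act_def intro!: mons_sum mons_scale mons_add mons_insort mons_mono[OF lower_terms_mons])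

lemma Act_le: 
  assumes "i < N" "sorted m" "\<And>j. j \<in> set m \<Longrightarrow> i \<le> j"
  shows "Act (e i) (single m 1) = single (i # m) 1"
proof -
  have "insort i m = i # m" using assms by (intro insort_is_Cons) auto
  moreover have "lower_terms (length m) i m = 0" using assms by (cases m) auto
  ultimately show ?thesis using assms by (simp add: Act_e act_def vs_M)
qed

text \<open>The module axiom for a basis vector meeting a list that starts with a smaller index: this is how
  \<open>lower_terms\<close> was set up.\<close>

lemma Act_gt:
  assumes "i < N" "j < i" "sorted (j # m)"
  shows "Act (e i) (single (j # m) 1) =
     Act (e j) (Act (e i) (single m 1)) + Act (brk g (e i) (e j)) (single m 1)"
proof -
  let ?l = "length m"
  have sm: "sorted m" and jm: "\<And>k. k \<in> set m \<Longrightarrow> j \<le> k" using assms by auto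
  have 1: "linext pscale (\<lambda>w. single (insort j w) 1 + lower_terms ?l j w) (lower_terms ?l i m) = 
        linext pscale (act j) (lower_terms ?l i m)"
  proof (rule linext_cong)
    fix w assume "w \<in> keys (lower_terms ?l i m)"
    then have "sorted w" "length w \<le> ?l" using lower_terms_mons[OF sm, of ?l i] by (auto simp: mons_below_def)
    then show "single (insort j w) 1 + lower_terms ?l j w = act j w"
      by (simp add: act_def lower_terms_stable[of w ?l])
  qed
  have 2: "Act (e j) (single (insort i m) 1) = single (j # insort i m) 1"
    using assms jm by (intro Act_le) (auto simp: set_insort_key sorted_insort)
  have 3: "Act (brk g (e i) (e j)) (single m 1) =
     (\<Sum>k<N. pscale (co k (brk g (e i) (e j))) (single (insort k m) 1 + lower_terms ?l k m))"
    by (simp add: Act_sum vs_M act_def)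
  have "Act (e i) (single (j # m) 1) = single (j # insort i m) 1 +
      (Act (e j) (lower_terms ?l i m) + Act (brk g (e i) (e j)) (single m 1))"
    using assms by (simp add: Act_e act_def vs_M 3 1)
  moreover have "Act (e i) (single m 1) = single (insort i m) 1 + lower_terms ?l i m"
    using assms by (simp add: Act_e act_def vs_M)
  ultimately show ?thesis by (simp add: Act_lin 2 add.assoc)
qed

definition rel :: "'g \<Rightarrow> 'g \<Rightarrow> 'k mons \<Rightarrow> bool" where
  "rel x y p \<longleftrightarrow> Act x (Act y p) - Act y (Act x p) = Act (brk g x y) p"

lemma rel_sym: "rel x y p \<longleftrightarrow> rel y x p"
proof -
  have "Act (brk g y x) p = - Act (brk g x y) p" using Act_neg_left[of "brk g x y" p] brk_anti[of y x] by simp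
  then show ?thesis unfolding rel_def by (metis minus_diff_eq minus_minus)
qed

lemma rel_add: "rel x y p \<Longrightarrow> rel x y q \<Longrightarrow> rel x y (p + q)"
  by (simp add: rel_def Act_lin algebra_simps)

lemma rel_scale: "rel x y p \<Longrightarrow> rel x y (pscale c p)"
  by (simp add: rel_def Act_lin flip: M.scale_right_diff_distrib)

lemma rel_zero: "rel x y 0"
  by (simp add: rel_def Act_lin)

lemma rel_mons:
  assumes "\<And>w. sorted w \<Longrightarrow> length w < n \<Longrightarrow> rel x y (single w 1)" "p \<in> mons_below n"
  shows "rel x y p"
  using assms(2)
proof (induction rule: mons_induct)
  case (add p w c)
  have "rel x y (pscale c (single w 1))" using assms(1) add by (intro rel_scale)
  then show ?case using add by (intro rel_add) simp_all
qed (rule rel_zero)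

lemma rel_basis:
  assumes "\<And>i j. i < N \<Longrightarrow> j < N \<Longrightarrow> rel (e i) (e j) p"
  shows "rel x y p"
proof -
  have 1: "rel (a + b) y p" if "rel a y p" "rel b y p" for a b y
    using that by (simp add: rel_def Act_add_left Act_lin brk_add algebra_simps)
  have 2: "rel (scl g c a) y p" if "rel a y p" for c a y
    using that by (simp add: rel_def Act_scale_left Act_lin brk_scale flip: M.scale_right_diff_distrib)
  have 0: "rel 0 y p" for y using 2 [of 0 0] by (simp add: rel_def Act_scale_left[of 0 0, simplified] Act_lin)
  have 3: "rel (\<Sum>i\<in>I. scl g (c i) (a i)) y p" if "\<And>i. i \<in> I \<Longrightarrow> rel (a i) y p" for I c a y
    using that by (induction I rule: infinite_finite_induct) (auto intro: 0 1 2)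
  have 4: "rel x (e j) p" if "j < N" for x j
    using 3[of "{..<N}" e "e j" "\<lambda>i. co i x"] assms that by (simp add: co_expand)
  have "rel y x p" for y
    using 3[of "{..<N}" e x "\<lambda>i. co i y"] 4 rel_sym by (simp add: co_expand)
  then show ?thesis using rel_sym by blast
qed

lemma rel_immediate:
  assumes "i < N" "j < i" "sorted (j # m)"
  shows "rel (e i) (e j) (single m 1)"
  using assms Act_gt[OF assms] Act_le[of j m] by (simp add: rel_def)

text \<open>By induction on the length of \<open>m\<close>. If \<open>m = k # m'\<close> with \<open>k < j < i\<close>, then \<open>m = e\<^sub>k m'\<close>, and \<open>e\<^sub>k\<close> can be moved to
  the front of \<open>e\<^sub>i e\<^sub>j e\<^sub>k m'\<close> and of \<open>e\<^sub>j e\<^sub>i e\<^sub>k m'\<close> at the cost of brackets: past \<open>e\<^sub>i\<close> because the relation is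
  immediate on the leading term of \<open>e\<^sub>j m'\<close>, which is a sorted list starting at \<open>k\<close> or later, and holds on the
  rest by induction. Everything then takes place on \<open>m'\<close>, where the relation is known, and the brackets
  cancel by the Jacobi identity.\<close>

lemma rel_single: "sorted m \<Longrightarrow> rel x y (single m 1)"
proof (induction "length m" arbitrary: m x y rule: less_induct)
  case less
  have IH: "rel x y p" if "p \<in> mons_below (length m)" for x y p
    by (rule rel_mons[OF less.hyps that]) auto
  have desc: "rel (e i) (e j) (single m 1)" if ij: "i < N" "j < i" for i j
  proof (cases "sorted (j # m)")
    case True
    then show ?thesis using rel_immediate ij by blast
  next
    case False
    then obtain k m' where m: "m = k # m'" using less.prems by (cases m) auto
    have kj: "k < j" using False less.prems unfolding m by force
    have sm': "sorted m'" and km': "\<And>l. l \<in> set m' \<Longrightarrow> k \<le> l" using less.prems m by auto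
    define p where "p = single m' (1::'k)"
    have pm: "p \<in> mons_below (length m)" using sm' by (simp add: p_def m mons_single)
    have sing: "single m 1 = Act (e k) p"
      unfolding p_def m using kj ij sm' km' by (intro Act_le[symmetric]) auto
    have step: "Act (e a) (Act (e b) (single m 1)) =
        Act (e k) (Act (e a) (Act (e b) p)) + Act (brk g (e a) (e k)) (Act (e b) p)
        + Act (brk g (e b) (e k)) (Act (e a) p) + Act (brk g (e a) (brk g (e b) (e k))) p"
      if ab: "a < N" "b < N" "k < a" "k < b" for a b
    proof -
      have "Act (e b) (single m 1) = Act (e k) (Act (e b) p) + Act (brk g (e b) (e k)) p"
        unfolding m p_def using ab less.prems m by (intro Act_gt) auto
      moreover have "rel (e a) (e k) (Act (e b) p)"
      proof -
        have "Act (e b) p = single (insort b m') 1 + lower_terms (length m') b m'"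
          using ab by (simp add: Act_e act_def p_def vs_M)
        moreover have "rel (e a) (e k) (single (insort b m') 1)"
          using ab sm' km' by (intro rel_immediate) (auto simp: set_insort_key sorted_insort)
        moreover have "rel (e a) (e k) (lower_terms (length m') b m')"
          using IH lower_terms_mons[OF sm'] m by simp
        ultimately show ?thesis by (simp add: rel_add)
      qed
      moreover have "rel (e a) (brk g (e b) (e k)) p" using IH pm by blast
      ultimately show ?thesis by (simp add: rel_def Act_lin algebra_simps)
    qed
    have "rel (e k) (brk g (e i) (e j)) p" "rel (e i) (e j) p" using IH pm by blast+
    then have "Act (e k) (Act (e i) (Act (e j) p)) - Act (e k) (Act (e j) (Act (e i) p)) =
       Act (brk g (e i) (e j)) (Act (e k) p) + Act (brk g (e k) (brk g (e i) (e j))) p"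
      by (simp add: rel_def algebra_simps flip: Act_lin(2))
    moreover have "Act (brk g (e k) (brk g (e i) (e j))) p + Act (brk g (e i) (brk g (e j) (e k))) p
      = Act (brk g (e j) (brk g (e i) (e k))) p"
    proof -
      have "brk g (e k) (brk g (e i) (e j)) + brk g (e i) (brk g (e j) (e k)) = brk g (e j) (brk g (e i) (e k))"
        using jacobi[of "e i" "e j" "e k"] brk_anti[of "e k" "e i"] 
        by (simp add: brk_neg algebra_simps)
      then show ?thesis by (simp flip: Act_add_left)
    qed
    moreover have "k < i" "j < N" using kj ij by simp_all
    ultimately show ?thesis
      using step[of i j] step[of j i] ij kj unfolding rel_def sing[symmetric]
      by (simp add: sing[symmetric] algebra_simps)
  qed
  show ?case
  proof (rule rel_basis)
    fix i j assume "i < N" "j < N"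
    moreover have "rel (e i) (e i) (single m 1)"
      using Act_scale_left[of 0 0] by (simp add: rel_def)
    ultimately show "rel (e i) (e j) (single m 1)"
      using desc rel_sym by (metis linorder_neqE_nat)
  qed
qed

lemma Act_brk: "p \<in> mons_below n \<Longrightarrow> Act (brk g x y) p = Act x (Act y p) - Act y (Act x p)"
  using rel_mons[OF rel_single] by (force simp: rel_def)

text \<open>Apply \<open>u\<close> to the empty list and take the part of length \<open>n\<close>, replacing an index \<open>i\<close> by \<open>f (e i)\<close>. For the
  target \<open>S(g)\<close> this inverts the map from \<open>S\<^sup>n\<close> to the associated graded of \<open>U\<close>; allowing any commutative
  target lets \<open>f\<close> absorb the identification of \<open>g\<close> with its dual.\<close>

lemma enveloping_symbol_maps:
  fixes sU :: "'k \<Rightarrow> 'u::ring_1 \<Rightarrow> 'u" and sS :: "'k \<Rightarrow> 's::comm_ring_1 \<Rightarrow> 's"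
  assumes env: "enveloping_algebra g sU \<iota>U" and algS: "is_algebra sS"
    and f: "Vector_Spaces.linear (scl g) sS f"
  obtains \<pi> :: "nat \<Rightarrow> 'u \<Rightarrow> 's" where
    "\<And>n. Vector_Spaces.linear sU sS (\<pi> n)" "\<pi> 0 1 = 1"
    "\<And>n u. u \<in> degree_below UNIV sU \<iota>U n \<Longrightarrow> \<pi> n u = 0"
    "\<And>n x u. u \<in> degree_below UNIV sU \<iota>U (Suc n) \<Longrightarrow> \<pi> (Suc n) (\<iota>U x * u) = f x * \<pi> n u"
proof -
  interpret U: env_alg g sU \<iota>U by unfold_locales (rule env)
  have vsS: "vector_space sS" using algS by (simp add: is_algebra_def)
  interpret S: vector_space sS by (rule vsS)
  have smult: "sS c x * y = sS c (x * y)" for c x y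
    using algS by (simp add: is_algebra_def)
  have smult2: "x * sS c y = sS c (x * y)" for c x y
    using algS by (metis is_algebra_def)
  define all where "all = (\<Union>n. mons_below n)"
  have all_ex: "\<exists>n. p \<in> mons_below n \<and> q \<in> mons_below n" if "p \<in> all" "q \<in> all" for p q
    using that unfolding all_def by (metis UN_E max.cobounded1 max.cobounded2 mons_mono)
  have sub: "M.subspace all"
  proof (rule M.subspaceI)
    show "0 \<in> all" by (auto simp: all_def mons_zero)
    show "p + q \<in> all" if "p \<in> all" "q \<in> all" for p q
      using all_ex[OF that] mons_add unfolding all_def by blast
    show "pscale c p \<in> all" if "p \<in> all" for c p
      using that mons_scale unfolding all_def by blast
  qed
  have z: "single [] 1 \<in> all"
    using mons_single[of "[]" 1 "1::'k"] unfolding all_def by auto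
  obtain \<phi> where \<phi>: "Vector_Spaces.linear sU pscale \<phi>" "\<phi> 1 = single [] 1" "\<And>u. \<phi> u \<in> all"
    "\<And>x u. x \<in> carr g \<Longrightarrow> \<phi> (\<iota>U x * u) = Act x (\<phi> u)"
  proof (rule U.module_extension[OF vs_M sub z, where A = Act])
    show "\<And>x m. x \<in> carr g \<Longrightarrow> m \<in> all \<Longrightarrow> Act x m \<in> all"
      using Act_mons unfolding all_def by blast
    show "\<And>x y m. x \<in> carr g \<Longrightarrow> y \<in> carr g \<Longrightarrow> m \<in> all \<Longrightarrow> Act (brk g x y) m = Act x (Act y m) - Act y (Act x m)"
      using Act_brk unfolding all_def by blast
  qed (auto simp: Act_lin Act_add_left Act_scale_left)
  have \<phi>_filt: "u \<in> U.filt n \<Longrightarrow> \<phi> u \<in> mons_below n" for u n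
  proof (induction n arbitrary: u)
    case 0
    then show ?case by (simp add: lin_zero[OF \<phi>(1)] mons_zero)
  next
    case (Suc n)
    from Suc.prems show ?case
      by (induction rule: U.filt_Suc_induct)
        (auto simp: lin_add[OF \<phi>(1)] lin_scale[OF \<phi>(1)] \<phi>(2,4)
          intro: mons_add mons_scale mons_single Act_mons Suc.IH)
  qed
  define top where "top n = linext sS (\<lambda>m. if length m = n then prod_list (map (\<lambda>i. f (e i)) m) else 0)" for n :: nat
  have top_lin: "Vector_Spaces.linear pscale sS (top n)" for n
    unfolding top_def by (rule linear_linext[OF vsS])
  have top_low: "top n p = 0" if "p \<in> mons_below n" for n p
    using that by (auto simp: top_def linext_def mons_below_def intro!: sum.neutral)
  have prod_insort: "prod_list (map h (insort i m)) = h i * prod_list (map h m)" for h :: "nat \<Rightarrow> 's" and i m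
    by (induction m) (auto simp: mult.left_commute)
  have top_single: "top n (single m 1) = (if length m = n then prod_list (map (\<lambda>i. f (e i)) m) else 0)" for n m
    by (simp add: top_def vsS)
  have top_Act: "top (Suc n) (Act x p) = f x * top n p" if "p \<in> mons_below (Suc n)" for n x p
    using that
  proof (induction rule: mons_induct)
    case zero
    then show ?case by (simp add: Act_lin lin_zero[OF top_lin])
  next
    case (add p w c)
    let ?p = "prod_list (map (\<lambda>i. f (e i)) w)"
    have "lower_terms (length w) i w \<in> mons_below (Suc n)" for i
      by (rule mons_mono[OF lower_terms_mons]) (use add in auto)
    then have 1: "top (Suc n) (act i w) = (if length w = n then f (e i) * ?p else 0)" for i
      by (simp add: act_def lin_add[OF top_lin] top_low top_single prod_insort)
    have "top (Suc n) (Act x (single w 1)) = (\<Sum>i<N. sS (co i x) (if length w = n then f (e i) * ?p else 0))"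
      by (simp add: Act_sum vs_M lin_sum[OF top_lin] lin_scale[OF top_lin] 1)
    also have "\<dots> = (if length w = n then (\<Sum>i<N. sS (co i x) (f (e i))) * ?p else 0)"
      by (simp add: smult sum_distrib_right)
    finally have 2: "top (Suc n) (Act x (single w 1)) = f x * top n (single w 1)"
      by (simp add: linear_expand[OF f] top_single)
    have 3: "single w c = pscale c (single w 1)" by simp
    show ?case unfolding 3
      by (simp only: Act_lin lin_add[OF top_lin] lin_scale[OF top_lin] 2 add.IH ring_distribs smult2)
  qed
  show thesis
  proof
    fix n
    show "Vector_Spaces.linear sU sS (\<lambda>u. top n (\<phi> u))"
      by (intro linearI U.vs vsS) (auto simp: lin_add[OF \<phi>(1)] lin_scale[OF \<phi>(1)] lin_add[OF top_lin] lin_scale[OF top_lin])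
    show "u \<in> degree_below UNIV sU \<iota>U n \<Longrightarrow> top n (\<phi> u) = 0" for u
      using \<phi>_filt[of u n] by (simp add: univ top_low)
    show "u \<in> degree_below UNIV sU \<iota>U (Suc n) \<Longrightarrow> top (Suc n) (\<phi> (\<iota>U x * u)) = f x * top n (\<phi> u)" for u x
      using \<phi>_filt[of u "Suc n"] by (simp add: univ \<phi> top_Act)
  next
    show "top 0 (\<phi> 1) = 1" by (simp add: \<phi> top_single)
  qed
qed

end

lemma ex_lie_coord:
  fixes g :: "('k::field, 'g::ab_group_add) lie"
  assumes lie: "lie_algebra g" and univ: "carr g = UNIV" and B: "finite B" "module.span (scl g) B = carr g"
  obtains N e co where "lie_coord g N e co"
proof -
  interpret G: vector_space "scl g" using lie by (simp add: lie_algebra_def is_vspace_def)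
  obtain C where C: "C \<subseteq> B" "G.independent C" "B \<subseteq> G.span C"
    by (rule G.maximal_independent_subset)
  have fin: "finite C" using C B finite_subset by blast
  have span: "G.span C = UNIV" using C B univ by (metis G.span_mono G.span_span top.extremum_uniqueI)
  obtain e where e: "bij_betw e {..<card C} C"
    using ex_bij_betw_nat_finite[OF fin] by (auto simp: atLeast0LessThan)
  define co where "co i x = (G.representation C x (e i) :: 'k)" for i :: nat and x
  have "lie_coord g (card C) e co"
  proof (rule lie_coord.intro, goal_cases)
    case (3 i)
    show ?case unfolding co_def
      by (intro linearI G.vector_space_axioms vector_space_field)
        (simp_all add: G.representation_add G.representation_scale C span)
  next
    case (4 x)
    have "(\<Sum>i<card C. scl g (co i x) (e i)) = (\<Sum>b\<in>C. scl g (G.representation C x b) b)"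
      unfolding co_def by (rule sum.reindex_bij_betw[OF e])
    then show ?case using G.sum_representation_eq[OF C(2) _ fin order_refl, of x] span by simp
  next
    case (5 i j)
    then have "e j \<in> C" using e by (auto simp: bij_betw_def)
    moreover have "e i = e j \<longleftrightarrow> i = j" using e 5 by (auto simp: bij_betw_def inj_on_def)
    ultimately show ?case using G.representation_basis[OF C(2)] by (auto simp: co_def)
  qed (fact lie univ)+
  then show thesis by (rule that)
qed

section \<open>Tensor products and the algebra \<open>U \<otimes> U\<close>\<close>

lemma bilinear_onI:
  assumes "\<And>x x' y. x \<in> carr M \<Longrightarrow> x' \<in> carr M \<Longrightarrow> y \<in> carr N \<Longrightarrow> \<beta> (x + x') y = \<beta> x y + \<beta> x' y"
    and "\<And>x y y'. x \<in> carr M \<Longrightarrow> y \<in> carr N \<Longrightarrow> y' \<in> carr N \<Longrightarrow> \<beta> x (y + y') = \<beta> x y + \<beta> x y'"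
    and "\<And>c x y. x \<in> carr M \<Longrightarrow> y \<in> carr N \<Longrightarrow> \<beta> (scl M c x) y = s c (\<beta> x y)"
    and "\<And>c x y. x \<in> carr M \<Longrightarrow> y \<in> carr N \<Longrightarrow> \<beta> x (scl N c y) = s c (\<beta> x y)"
  shows "bilinear_on M N s \<beta>"
  using assms by (simp add: bilinear_on_def)

text \<open>Tensors are functions on bilinear forms. They are to be treated as abstract vectors, so their pointwise
  sums must not be unfolded.\<close>

declare plus_fun_apply [simp del] zero_fun_apply [simp del] minus_apply [simp del] uminus_apply [simp del]

lemma scl_tensor: "scl (tensor M N) c T \<beta> = c * T \<beta>"
  by (simp add: tensor_def)

lemma vs_tensor: "vector_space (scl (tensor M N))"
  by unfold_locales (auto simp: tensor_def algebra_simps fun_eq_iff plus_fun_apply)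

locale tensor_pair =
  fixes M :: "('k::field, 'v::ab_group_add, 'm) vspace_scheme"
    and N :: "('k::field, 'w::ab_group_add, 'n) vspace_scheme"
  assumes M: "is_vspace M" and N: "is_vspace N"
begin

sublocale M: vector_space "scl M" using M by (simp add: is_vspace_def)
sublocale N: vector_space "scl N" using N by (simp add: is_vspace_def)
sublocale T: vector_space "scl (tensor M N)" by (rule vs_tensor)

lemma M_sub: "M.subspace (carr M)" and N_sub: "N.subspace (carr N)"
  using M N by (auto simp: is_vspace_def)

lemma tens_add_left: "x \<in> carr M \<Longrightarrow> x' \<in> carr M \<Longrightarrow> y \<in> carr N \<Longrightarrow> tens M N (x + x') y = tens M N x y + tens M N x' y"
  and tens_add_right: "x \<in> carr M \<Longrightarrow> y \<in> carr N \<Longrightarrow> y' \<in> carr N \<Longrightarrow> tens M N x (y + y') = tens M N x y + tens M N x y'"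
  and tens_scale_left: "x \<in> carr M \<Longrightarrow> y \<in> carr N \<Longrightarrow> tens M N (scl M c x) y = scl (tensor M N) c (tens M N x y)"
  and tens_scale_right: "x \<in> carr M \<Longrightarrow> y \<in> carr N \<Longrightarrow> tens M N x (scl N c y) = scl (tensor M N) c (tens M N x y)"
  by (auto simp: tens_def bilinear_on_def fun_eq_iff plus_fun_apply scl_tensor)

lemma tens_T: "x \<in> carr M \<Longrightarrow> y \<in> carr N \<Longrightarrow> tens M N x y \<in> carr (tensor M N)"
  unfolding tensor_def by (auto intro!: exI[of _ "[(x, y)]"])

lemma T_induct [consumes 1, case_names zero add]:
  assumes "T \<in> carr (tensor M N)" "P 0"
    and "\<And>x y T. x \<in> carr M \<Longrightarrow> y \<in> carr N \<Longrightarrow> T \<in> carr (tensor M N) \<Longrightarrow> P T \<Longrightarrow> P (tens M N x y + T)"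
  shows "P T"
proof -
  have carr: "carr (tensor M N) = {\<Sum>(v, w)\<leftarrow>ps. tens M N v w | ps. set ps \<subseteq> carr M \<times> carr N}"
    by (simp add: tensor_def)
  obtain ps where ps: "set ps \<subseteq> carr M \<times> carr N" "T = (\<Sum>(v, w)\<leftarrow>ps. tens M N v w)"
    using assms(1) unfolding carr by auto
  have "P (\<Sum>(v, w)\<leftarrow>ps. tens M N v w)" using ps(1)
    by (induction ps) (auto intro!: assms(2,3) simp: carr)
  with ps show ?thesis by simp
qed

lemma T_sub: "T.subspace (carr (tensor M N))"
proof (rule T.subspaceI)
  show 0: "0 \<in> carr (tensor M N)"
    unfolding tensor_def by (auto intro!: exI[of _ "[]"])
  have 1: "tens M N x y + T \<in> carr (tensor M N)" if xyT: "x \<in> carr M" "y \<in> carr N" "T \<in> carr (tensor M N)" for x y T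
  proof -
    obtain ps where "set ps \<subseteq> carr M \<times> carr N" "T = (\<Sum>(v, w)\<leftarrow>ps. tens M N v w)"
      using xyT(3) unfolding tensor_def by auto
    then show ?thesis unfolding tensor_def using xyT(1,2) by (auto intro!: exI[of _ "(x, y) # ps"])
  qed
  show "S + T \<in> carr (tensor M N)" if "S \<in> carr (tensor M N)" "T \<in> carr (tensor M N)" for S T
    using that by (induction S rule: T_induct) (auto simp: add.assoc intro: 1)
  show "scl (tensor M N) c T \<in> carr (tensor M N)" if "T \<in> carr (tensor M N)" for c T
    using that
  proof (induction T rule: T_induct)
    case (add x y T)
    have "tens M N (scl M c x) y + scl (tensor M N) c T \<in> carr (tensor M N)"
      using add by (intro 1 M.subspace_scale[OF M_sub])
    then show ?case using add by (simp add: tens_scale_left T.scale_right_distrib)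
  qed (use 0 T.scale_zero_right in simp)
qed

lemmas T_add = T.subspace_add[OF T_sub]
  and T_scale = T.subspace_scale[OF T_sub]
  and T_diff = T.subspace_diff[OF T_sub]
  and T_zero = T.subspace_0[OF T_sub]
  and T_sum = T.subspace_sum[OF T_sub]

lemma tens_zero [simp]: "y \<in> carr N \<Longrightarrow> tens M N 0 y = 0" "x \<in> carr M \<Longrightarrow> tens M N x 0 = 0"
  using tens_scale_left[of 0 y 0] tens_scale_right[of x 0 0] M.subspace_0[OF M_sub] N.subspace_0[OF N_sub]
  by simp_all

lemma T_representation:
  assumes "T \<in> carr (tensor M N)"
  obtains n :: nat and a b where "\<And>i. i < n \<Longrightarrow> a i \<in> carr M" "\<And>i. i < n \<Longrightarrow> b i \<in> carr N"
    "T = (\<Sum>i<n. tens M N (a i) (b i))"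
proof -
  obtain ps where ps: "set ps \<subseteq> carr M \<times> carr N" "T = (\<Sum>(v, w)\<leftarrow>ps. tens M N v w)"
    using assms unfolding tensor_def by auto
  have m: "ps ! i \<in> carr M \<times> carr N" if "i < length ps" for i
    using ps(1) that nth_mem by blast
  show thesis
  proof (rule that[of "length ps" "\<lambda>i. fst (ps ! i)" "\<lambda>i. snd (ps ! i)"])
    show "T = (\<Sum>i<length ps. tens M N (fst (ps ! i)) (snd (ps ! i)))"
      unfolding ps(2) by (simp add: sum_list_sum_nth atLeast0LessThan case_prod_beta)
  qed (use m in \<open>auto simp: mem_Times_iff\<close>)
qed

lemma lift_tens_add:
  assumes "vector_space s" "bilinear_on M N s \<beta>" "x \<in> carr M" "y \<in> carr N" "T \<in> carr (tensor M N)"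
  shows "lift M N \<beta> (tens M N x y + T) = \<beta> x y + lift M N \<beta> T"
proof -
  obtain ps where ps: "set ps \<subseteq> carr M \<times> carr N" "T = (\<Sum>(v, w)\<leftarrow>ps. tens M N v w)"
    using assms(5) unfolding tensor_def by auto
  show ?thesis
    using lift_sum[OF assms(1,2), of "(x, y) # ps"] lift_sum[OF assms(1,2) ps(1)] assms(3,4) ps by simp
qed

lemma lift_zero [simp]:
  assumes "vector_space s" "bilinear_on M N s \<beta>"
  shows "lift M N \<beta> 0 = 0"
  using lift_sum[OF assms, of "[]"] by simp

lemma lift_tens:
  assumes "vector_space s" "bilinear_on M N s \<beta>" "x \<in> carr M" "y \<in> carr N"
  shows "lift M N \<beta> (tens M N x y) = \<beta> x y"
  using lift_sum[OF assms(1,2), of "[(x, y)]"] assms(3,4) by simp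

lemma lift_add:
  assumes "vector_space s" "bilinear_on M N s \<beta>" "S \<in> carr (tensor M N)" "T \<in> carr (tensor M N)"
  shows "lift M N \<beta> (S + T) = lift M N \<beta> S + lift M N \<beta> T"
  using assms(3)
  by (induction S rule: T_induct)
    (use assms in \<open>auto simp: lift_zero[OF assms(1,2)] lift_tens_add[OF assms(1,2)] add.assoc T_add\<close>)

lemma lift_scale:
  assumes "vector_space s" "bilinear_on M N s \<beta>" "T \<in> carr (tensor M N)"
  shows "lift M N \<beta> (scl (tensor M N) c T) = s c (lift M N \<beta> T)"
proof -
  interpret vector_space s by fact
  show ?thesis using assms(3)
  proof (induction T rule: T_induct)
    case (add x y T)
    have b: "\<beta> (scl M c x) y = s c (\<beta> x y)" using assms(2) add unfolding bilinear_on_def by blast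
    have "lift M N \<beta> (tens M N (scl M c x) y + scl (tensor M N) c T) =
       \<beta> (scl M c x) y + lift M N \<beta> (scl (tensor M N) c T)"
      by (rule lift_tens_add[OF assms(1,2)]) (use add M.subspace_scale[OF M_sub] T_scale in auto)
    then show ?case using add b
      by (simp add: T.scale_right_distrib tens_scale_left lift_tens_add[OF assms(1,2)] scale_right_distrib)
  qed (simp add: lift_zero[OF assms(1,2)])
qed

lemma lift_diff:
  assumes "vector_space s" "bilinear_on M N s \<beta>" "S \<in> carr (tensor M N)" "T \<in> carr (tensor M N)"
  shows "lift M N \<beta> (S - T) = lift M N \<beta> S - lift M N \<beta> T"
  using lift_add[OF assms(1,2) T_diff[OF assms(3,4)] assms(4)] by (simp add: algebra_simps)

lemma lift_sum_scaled:
  assumes "vector_space s" "bilinear_on M N s \<beta>" "\<And>i. i \<in> I \<Longrightarrow> T i \<in> carr (tensor M N)"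
  shows "lift M N \<beta> (\<Sum>i\<in>I. T i) = (\<Sum>i\<in>I. lift M N \<beta> (T i))"
  using assms(3)
  by (induction I rule: infinite_finite_induct)
    (auto simp: lift_zero[OF assms(1,2)] lift_add[OF assms(1,2)] T_sum)

lemma lift_sum_tens:
  assumes "vector_space s" "bilinear_on M N s \<beta>" "\<And>i. i \<in> I \<Longrightarrow> a i \<in> carr M" "\<And>i. i \<in> I \<Longrightarrow> b i \<in> carr N"
  shows "lift M N \<beta> (\<Sum>i\<in>I. tens M N (a i) (b i)) = (\<Sum>i\<in>I. \<beta> (a i) (b i))"
  using assms by (simp add: lift_sum_scaled[OF assms(1,2)] tens_T lift_tens[OF assms(1,2)])

lemma lift_closed:
  assumes "vector_space s" "bilinear_on M N s \<beta>" "module.subspace s V"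
    "\<And>x y. x \<in> carr M \<Longrightarrow> y \<in> carr N \<Longrightarrow> \<beta> x y \<in> V" "T \<in> carr (tensor M N)"
  shows "lift M N \<beta> T \<in> V"
proof -
  interpret vector_space s by fact
  show ?thesis using assms(5)
    by (induction T rule: T_induct)
      (auto simp: lift_zero[OF assms(1,2)] lift_tens_add[OF assms(1,2)] assms(4) subspace_0[OF assms(3)]
        intro!: subspace_add[OF assms(3)])
qed

end

lemma is_vspace_full: "vector_space s \<Longrightarrow> is_vspace (full s)"
  by (simp add: is_vspace_def module.subspace_UNIV vector_space_def module_def)

locale tens_algebra =
  fixes s :: "'k::field \<Rightarrow> 'u::ring_1 \<Rightarrow> 'u"
  assumes alg: "is_algebra s"
begin

lemma vs_s: "vector_space s" using alg by (simp add: is_algebra_def)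
lemma s_mult: "s c x * y = s c (x * y)" "x * s c y = s c (x * y)"
  using alg by (metis is_algebra_def)+

sublocale TP: tensor_pair "full s" "full s"
  by unfold_locales (auto intro: is_vspace_full vs_s)

abbreviation "TT \<equiv> carr (tensor (full s) (full s))"
abbreviation "tsc \<equiv> scl (tensor (full s) (full s))"
abbreviation "ten \<equiv> tens_alg s"

lemma ten_lin: "ten (a + a') b = ten a b + ten a' b" "ten a (b + b') = ten a b + ten a b'"
  "ten (s c a) b = tsc c (ten a b)" "ten a (s c b) = tsc c (ten a b)"
  "ten 0 b = 0" "ten a 0 = 0"
  using TP.tens_add_left TP.tens_add_right TP.tens_scale_left[of a b c] TP.tens_scale_right[of a b c] by simp_all

lemma ten_neg: "ten (- a) b = - ten a b" "ten a (- b) = - ten a b"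
  using ten_lin(1)[of "- a" a b] ten_lin(2)[of a "- b" b] by (simp_all add: ten_lin eq_neg_iff_add_eq_0)

lemma ten_diff: "ten (a - a') b = ten a b - ten a' b" "ten a (b - b') = ten a b - ten a b'"
  using ten_lin(1)[of "a - a'" a' b] ten_lin(2)[of a "b - b'" b'] by (simp_all add: eq_diff_eq)

lemma ten_sum: "ten (\<Sum>i\<in>I. f i) b = (\<Sum>i\<in>I. ten (f i) b)" "ten a (\<Sum>i\<in>I. f i) = (\<Sum>i\<in>I. ten a (f i))"
  by (induction I rule: infinite_finite_induct) (auto simp: ten_lin)

lemma ten_T [simp]: "ten a b \<in> TT"
  using TP.tens_T by simp

lemma bilin_UNIV:
  assumes "\<And>x x' y. \<beta> (x + x') y = \<beta> x y + \<beta> x' y" "\<And>x y y'. \<beta> x (y + y') = \<beta> x y + \<beta> x y'"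
    and "\<And>c x y. \<beta> (s c x) y = sA c (\<beta> x y)" "\<And>c x y. \<beta> x (s c y) = sA c (\<beta> x y)"
  shows "bilinear_on (full s) (full s) sA \<beta>"
  by (rule bilinear_onI) (use assms in auto)

lemma inner_bilin: "bilinear_on (full s) (full s) tsc (\<lambda>c d. ten (a * c) (b * d))"
  by (rule bilin_UNIV) (simp_all add: ring_distribs ten_lin s_mult)

lemmas inner_lift = TP.lift_add[OF vs_tensor inner_bilin] TP.lift_scale[OF vs_tensor inner_bilin]
  TP.lift_zero[OF vs_tensor inner_bilin] TP.lift_tens_add[OF vs_tensor inner_bilin] TP.lift_tens[OF vs_tensor inner_bilin]

lemma inner_closed: "T \<in> TT \<Longrightarrow> lift_alg s (\<lambda>c d. ten (a * c) (b * d)) T \<in> TT"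
  by (rule TP.lift_closed[OF vs_tensor inner_bilin TP.T_sub]) auto

lemma outer_bilin:
  assumes "T \<in> TT"
  shows "bilinear_on (full s) (full s) tsc (\<lambda>a b. lift_alg s (\<lambda>c d. ten (a * c) (b * d)) T)"
proof -
  define I where "I a b = lift_alg s (\<lambda>c d. ten (a * c) (b * d))" for a b
  have I: "I a b 0 = 0" "T \<in> TT \<Longrightarrow> I a b (ten x y + T) = ten (a * x) (b * y) + I a b T" for a b x y T
    unfolding I_def by (simp_all only: inner_lift UNIV_I vspace.simps)
  have I': "T \<in> TT \<Longrightarrow> I a b (T + ten x y) = ten (a * x) (b * y) + I a b T" for a b x y T
    using I(2) by (simp only: add.commute)
  have "bilinear_on (full s) (full s) tsc (\<lambda>a b. I a b T)"
  proof (rule bilin_UNIV)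
    fix a a' b b' :: 'u and c
    show "I (a + a') b T = I a b T + I a' b T"
      using assms by (induction T rule: TP.T_induct)
        (auto simp: I I' ring_distribs ten_lin s_mult TP.T.scale_right_distrib TP.T.scale_zero_right algebra_simps)
    show "I a (b + b') T = I a b T + I a b' T"
      using assms by (induction T rule: TP.T_induct)
        (auto simp: I I' ring_distribs ten_lin s_mult TP.T.scale_right_distrib TP.T.scale_zero_right algebra_simps)
    show "I (s c a) b T = tsc c (I a b T)"
      using assms by (induction T rule: TP.T_induct)
        (auto simp: I I' ring_distribs ten_lin s_mult TP.T.scale_right_distrib TP.T.scale_zero_right algebra_simps)
    show "I a (s c b) T = tsc c (I a b T)"
      using assms by (induction T rule: TP.T_induct)
        (auto simp: I I' ring_distribs ten_lin s_mult TP.T.scale_right_distrib TP.T.scale_zero_right algebra_simps)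
  qed
  then show ?thesis by (simp add: I_def)
qed

abbreviation tmult :: "('k, 'u, 'u) tens \<Rightarrow> ('k, 'u, 'u) tens \<Rightarrow> ('k, 'u, 'u) tens" (infixl "\<odot>" 70) where
  "S \<odot> T \<equiv> tens_mult s S T"

lemma tmult_ten_left: "T \<in> TT \<Longrightarrow> ten a b \<odot> T = lift_alg s (\<lambda>c d. ten (a * c) (b * d)) T"
  unfolding tens_mult_def by (rule TP.lift_tens[OF vs_tensor outer_bilin]) simp_all

lemma tmult_ten: "ten a b \<odot> ten c d = ten (a * c) (b * d)"
  using inner_lift(5)[of c d a b] by (simp add: tmult_ten_left)

lemma tmult_add_left: "S \<in> TT \<Longrightarrow> S' \<in> TT \<Longrightarrow> T \<in> TT \<Longrightarrow> (S + S') \<odot> T = S \<odot> T + S' \<odot> T"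
  unfolding tens_mult_def by (rule TP.lift_add[OF vs_tensor outer_bilin])

lemma tmult_scale_left: "S \<in> TT \<Longrightarrow> T \<in> TT \<Longrightarrow> tsc c S \<odot> T = tsc c (S \<odot> T)"
  unfolding tens_mult_def by (intro TP.lift_scale[OF vs_tensor outer_bilin])

lemma tmult_zero_left: "T \<in> TT \<Longrightarrow> 0 \<odot> T = 0"
  unfolding tens_mult_def by (rule TP.lift_zero[OF vs_tensor outer_bilin])

lemma tmult_add_right:
  assumes "S \<in> TT" "T \<in> TT" "T' \<in> TT"
  shows "S \<odot> (T + T') = S \<odot> T + S \<odot> T'"
  using assms
  by (induction S rule: TP.T_induct)
    (auto simp: TP.T_add tmult_zero_left tmult_add_left tmult_ten_left inner_lift algebra_simps)

lemma tmult_scale_right: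
  assumes "S \<in> TT" "T \<in> TT"
  shows "S \<odot> tsc c T = tsc c (S \<odot> T)"
  using assms
  by (induction S rule: TP.T_induct)
    (auto simp: TP.T_scale tmult_zero_left tmult_add_left tmult_ten_left inner_lift TP.T.scale_right_distrib)

lemmas tmult_add = tmult_add_left tmult_add_right
  and tmult_scale = tmult_scale_left tmult_scale_right

lemma tmult_zero [simp]: "T \<in> TT \<Longrightarrow> 0 \<odot> T = 0" "T \<in> TT \<Longrightarrow> T \<odot> 0 = 0"
  using tmult_scale(1)[of 0 T 0] tmult_scale(2)[of T 0 0] TP.T_zero by simp_all

lemma tmult_T: "S \<in> TT \<Longrightarrow> T \<in> TT \<Longrightarrow> S \<odot> T \<in> TT"
  unfolding tens_mult_def
  by (rule TP.lift_closed[OF vs_tensor outer_bilin TP.T_sub]) (auto intro: inner_closed)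

lemma tmult_diff: "S \<in> TT \<Longrightarrow> S' \<in> TT \<Longrightarrow> T \<in> TT \<Longrightarrow> (S - S') \<odot> T = S \<odot> T - S' \<odot> T"
  "S \<in> TT \<Longrightarrow> T \<in> TT \<Longrightarrow> T' \<in> TT \<Longrightarrow> S \<odot> (T - T') = S \<odot> T - S \<odot> T'"
  using tmult_add(1)[of "S - S'" S' T] tmult_add(2)[of S "T - T'" T'] TP.T_diff by simp_all

lemma tmult_sum: "(\<And>i. i \<in> I \<Longrightarrow> S i \<in> TT) \<Longrightarrow> T \<in> TT \<Longrightarrow> (\<Sum>i\<in>I. S i) \<odot> T = (\<Sum>i\<in>I. S i \<odot> T)"
  "(\<And>i. i \<in> I \<Longrightarrow> S i \<in> TT) \<Longrightarrow> T \<in> TT \<Longrightarrow> T \<odot> (\<Sum>i\<in>I. S i) = (\<Sum>i\<in>I. T \<odot> S i)"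
  by (induction I rule: infinite_finite_induct) (auto simp: tmult_add TP.T_sum)

lemma tmult_assoc: "S \<in> TT \<Longrightarrow> T \<in> TT \<Longrightarrow> V \<in> TT \<Longrightarrow> S \<odot> T \<odot> V = S \<odot> (T \<odot> V)"
proof -
  assume S: "S \<in> TT" and T: "T \<in> TT" and V: "V \<in> TT"
  have 1: "ten a b \<odot> ten c d \<odot> V = ten a b \<odot> (ten c d \<odot> V)" for a b c d
    using V by (induction V rule: TP.T_induct) (auto simp: tmult_add tmult_ten tmult_T mult.assoc)
  have 2: "ten a b \<odot> T \<odot> V = ten a b \<odot> (T \<odot> V)" for a b
    using T by (induction T rule: TP.T_induct) (use V in \<open>auto simp: tmult_add tmult_T 1\<close>)
  show ?thesis
    using S by (induction S rule: TP.T_induct) (use T V in \<open>auto simp: tmult_add tmult_T 2\<close>)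
qed

lemma tmult_one: "T \<in> TT \<Longrightarrow> ten 1 1 \<odot> T = T" "T \<in> TT \<Longrightarrow> T \<odot> ten 1 1 = T"
  by (induction T rule: TP.T_induct, auto simp: tmult_add tmult_ten)+

end

section \<open>The pair of morphisms given by the r-matrix\<close>

locale factorizable = lie_coord g N e co
  for g :: "('k::field_char_0, 'g::ab_group_add) lie" and N :: nat and e :: "nat \<Rightarrow> 'g" and co :: "nat \<Rightarrow> 'g \<Rightarrow> 'k" +
  fixes r :: "('k, 'g, 'g) tens" and m :: nat and a b :: "nat \<Rightarrow> 'g"
  assumes r: "r = (\<Sum>j<m. tens g g (a j) (b j))"
    and cybe: "cyb g r = 0"
    and ad_sym: "ad2 g x (sym_part g r) = 0"
    and nondeg: "bij_betw (\<lambda>\<xi>. lift g g (\<lambda>a b. scl g (\<xi> a) b) (sym_part g r)) (dual_carr g) UNIV"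
begin

abbreviation "d \<equiv> dual_lie g r"
abbreviation "V \<equiv> dual_carr g"
abbreviation "L \<equiv> Lmap g r"
abbreviation "R \<equiv> Rmap g r"
abbreviation "ad_star \<equiv> coad g"

lemma carr_d [simp]: "carr d = V"
  by (simp add: dual_lie_def)

lemma scl_d: "scl d c \<xi> = (\<lambda>x. c * \<xi> x)"
  by (simp add: dual_lie_def)

lemma V_lin:
  assumes "\<xi> \<in> V"
  shows "\<xi> (x + y) = \<xi> x + \<xi> y" "\<xi> (x - y) = \<xi> x - \<xi> y" "\<xi> (scl g c x) = c * \<xi> x" "\<xi> 0 = 0" "\<xi> (- x) = - \<xi> x"
    "\<xi> (\<Sum>i\<in>I. f i) = (\<Sum>i\<in>I. \<xi> (f i))"
  using assms by (simp_all add: dual_carr_def lin_add lin_diff lin_scale lin_zero lin_neg lin_sum)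

lemma V_I: "(\<And>x y. \<xi> (x + y) = \<xi> x + \<xi> y) \<Longrightarrow> (\<And>c x. \<xi> (scl g c x) = c * \<xi> x) \<Longrightarrow> \<xi> \<in> V"
  unfolding dual_carr_def mem_Collect_eq by (rule linearI[OF vs_g vector_space_field])

lemma vs_d: "vector_space (scl d)"
  by unfold_locales (auto simp: scl_d plus_fun_apply fun_eq_iff algebra_simps)

sublocale dual: vector_space "scl d" by (rule vs_d)

lemma V_sub: "dual.subspace V"
  by (rule dual.subspaceI) (auto intro!: V_I simp: V_lin scl_d plus_fun_apply zero_fun_apply algebra_simps)

lemmas V_add = dual.subspace_add[OF V_sub]
  and V_scale = dual.subspace_scale[OF V_sub]
  and V_diff = dual.subspace_diff[OF V_sub]
  and V_zero = dual.subspace_0[OF V_sub]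
  and V_sum = dual.subspace_sum[OF V_sub]

lemma fun_sum_apply: "(\<Sum>i\<in>I. f i) x = (\<Sum>i\<in>I. (f i x :: 'k))"
  by (induction I rule: infinite_finite_induct) (auto simp: plus_fun_apply zero_fun_apply)

lemma co_V: "co i \<in> V"
  by (simp add: dual_carr_def co_linear)

lemma V_expand: "\<xi> \<in> V \<Longrightarrow> \<xi> = (\<Sum>i<N. scl d (\<xi> (e i)) (co i))"
proof
  fix x assume "\<xi> \<in> V"
  then have "(\<Sum>i<N. co i x * \<xi> (e i)) = \<xi> x" unfolding dual_carr_def mem_Collect_eq by (rule linear_expand)
  then show "\<xi> x = (\<Sum>i<N. scl d (\<xi> (e i)) (co i)) x" by (simp add: fun_sum_apply scl_d mult.commute)
qed

lemma is_vspace_g: "is_vspace g"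
  using lie by (simp add: lie_algebra_def)

lemma is_vspace_d: "is_vspace d"
  using vs_d V_sub by (simp add: is_vspace_def)

sublocale TG: tensor_pair g g
  by unfold_locales (fact is_vspace_g)+

sublocale TD: tensor_pair d d
  by unfold_locales (fact is_vspace_d)+

lemma is_vspace_gg: "is_vspace (tensor g g)"
  using vs_tensor TG.T_sub by (simp add: is_vspace_def)

sublocale T3: tensor_pair "tensor g g" g
  by unfold_locales (fact is_vspace_g is_vspace_gg)+

lemma bilin_g:
  assumes "\<And>x x' y. \<beta> (x + x') y = \<beta> x y + \<beta> x' y" "\<And>x y y'. \<beta> x (y + y') = \<beta> x y + \<beta> x y'"
    and "\<And>c x y. \<beta> (scl g c x) y = sA c (\<beta> x y)" "\<And>c x y. \<beta> x (scl g c y) = sA c (\<beta> x y)"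
  shows "bilinear_on g g sA \<beta>"
  by (rule bilinear_onI) (use assms in auto)

lemma tens_gg: "tens g g (x + x') y = tens g g x y + tens g g x' y" "tens g g x (y + y') = tens g g x y + tens g g x y'"
  "tens g g (scl g c x) y = scl (tensor g g) c (tens g g x y)" "tens g g x (scl g c y) = scl (tensor g g) c (tens g g x y)"
  "tens g g x y \<in> carr (tensor g g)"
  using TG.tens_add_left TG.tens_add_right TG.tens_scale_left[of x y c] TG.tens_scale_right[of x y c] TG.tens_T
  by (simp_all add: univ)

lemma r_T: "r \<in> carr (tensor g g)"
  unfolding r by (intro TG.T_sum tens_gg)

lemma flip_bilin: "bilinear_on g g (scl (tensor g g)) (\<lambda>x y. tens g g y x)"
  by (rule bilin_g) (auto simp: tens_gg)

lemma flip_r: "flip g r = (\<Sum>j<m. tens g g (b j) (a j))"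
  unfolding flip_def r by (rule TG.lift_sum_tens[OF vs_tensor flip_bilin]) (auto simp: univ)

lemma flip_r_T: "flip g r \<in> carr (tensor g g)"
  unfolding flip_r by (intro TG.T_sum tens_gg)

lemma ad2_bilin: "bilinear_on g g (scl (tensor g g)) (\<lambda>y z. tens g g (brk g x y) z + tens g g y (brk g x z))"
  by (rule bilin_g) (auto simp: tens_gg brk_add brk_scale TG.T.scale_right_distrib algebra_simps)

text \<open>The symmetric part of \<open>r\<close> is invariant, so the antisymmetrisation in the definition of the cobracket
  has no effect.\<close>

lemma cobracket_r: "cobracket g r x = (\<Sum>j<m. tens g g (brk g x (a j)) (b j) + tens g g (a j) (brk g x (b j)))"
proof -
  have 0: "ad2 g x r + ad2 g x (flip g r) = 0"
    using ad_sym[of x] TG.lift_add[OF vs_tensor ad2_bilin r_T flip_r_T] by (simp add: ad2_def sym_part_def)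
  have "cobracket g r x = scl (tensor g g) (1 / 2) (ad2 g x r - ad2 g x (flip g r))"
    unfolding cobracket_def ad2_def
    by (simp add: TG.lift_scale[OF vs_tensor ad2_bilin] TG.lift_diff[OF vs_tensor ad2_bilin] TG.T_diff r_T flip_r_T)
  also have "ad2 g x r - ad2 g x (flip g r) = scl (tensor g g) 2 (ad2 g x r)"
    using 0 TG.T.scale_left_distrib[of 1 1 "ad2 g x r"] by (simp add: eq_neg_iff_add_eq_0[symmetric])
  finally have "cobracket g r x = ad2 g x r" by simp
  also have "\<dots> = (\<Sum>j<m. tens g g (brk g x (a j)) (b j) + tens g g (a j) (brk g x (b j)))"
    unfolding ad2_def r by (rule TG.lift_sum_tens[OF vs_tensor ad2_bilin]) (auto simp: univ)
  finally show ?thesis .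
qed

lemma pair_bilin: "\<xi> \<in> V \<Longrightarrow> \<eta> \<in> V \<Longrightarrow> bilinear_on g g (*) (\<lambda>x y. \<xi> x * \<eta> y)"
  by (rule bilin_g) (auto simp: V_lin algebra_simps)

lemma brk_d: "\<xi> \<in> V \<Longrightarrow> \<eta> \<in> V \<Longrightarrow>
    brk d \<xi> \<eta> x = (\<Sum>j<m. \<xi> (brk g x (a j)) * \<eta> (b j) + \<xi> (a j) * \<eta> (brk g x (b j)))"
  unfolding dual_lie_def
  by (simp add: cobracket_r TG.lift_sum_scaled[OF vector_space_field pair_bilin] TG.lift_add[OF vector_space_field pair_bilin]
      TG.lift_tens[OF vector_space_field pair_bilin] TG.T_add tens_gg univ)

lemma LR_bilin: "\<xi> \<in> V \<Longrightarrow> bilinear_on g g (scl g) (\<lambda>a b. scl g (\<xi> a) b)" "\<xi> \<in> V \<Longrightarrow> bilinear_on g g (scl g) (\<lambda>a b. scl g (\<xi> b) a)"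
  by (rule bilin_g; simp add: V_lin G.scale_left_distrib G.scale_right_distrib mult.commute)+

lemma L_eq: "\<xi> \<in> V \<Longrightarrow> L \<xi> = (\<Sum>j<m. scl g (\<xi> (a j)) (b j))"
  unfolding Lmap_def r by (subst TG.lift_sum_tens[OF vs_g LR_bilin(1)]) (auto simp: univ)

lemma R_eq: "\<xi> \<in> V \<Longrightarrow> R \<xi> = - (\<Sum>j<m. scl g (\<xi> (b j)) (a j))"
  unfolding Rmap_def r by (subst TG.lift_sum_tens[OF vs_g LR_bilin(2)]) (auto simp: univ)

lemma L_add: "\<xi> \<in> V \<Longrightarrow> \<eta> \<in> V \<Longrightarrow> L (\<xi> + \<eta>) = L \<xi> + L \<eta>"
  and L_scale: "\<xi> \<in> V \<Longrightarrow> L (scl d c \<xi>) = scl g c (L \<xi>)"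
  and R_add: "\<xi> \<in> V \<Longrightarrow> \<eta> \<in> V \<Longrightarrow> R (\<xi> + \<eta>) = R \<xi> + R \<eta>"
  and R_scale: "\<xi> \<in> V \<Longrightarrow> R (scl d c \<xi>) = scl g c (R \<xi>)"
  by (simp_all add: L_eq R_eq V_add V_scale plus_fun_apply G.scale_left_distrib sum.distrib)
    (simp_all add: scl_d G.scale_sum_right)

lemma ad_star_V: "\<xi> \<in> V \<Longrightarrow> ad_star x \<xi> \<in> V"
  by (rule V_I) (simp_all add: coad_def brk_add brk_scale V_lin)

lemma L_ad_star: "\<xi> \<in> V \<Longrightarrow> L (ad_star x \<xi>) = - (\<Sum>j<m. scl g (\<xi> (brk g x (a j))) (b j))"
  and R_ad_star: "\<xi> \<in> V \<Longrightarrow> R (ad_star x \<xi>) = (\<Sum>j<m. scl g (\<xi> (brk g x (b j))) (a j))"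
  by (simp_all add: L_eq R_eq ad_star_V) (simp_all add: coad_def sum_negf)

lemma ad_star_add: "\<xi> \<in> V \<Longrightarrow> ad_star (x + y) \<xi> = ad_star x \<xi> + ad_star y \<xi>"
  "ad_star x (\<xi> + \<eta>) = ad_star x \<xi> + ad_star x \<eta>"
  and ad_star_scale: "\<xi> \<in> V \<Longrightarrow> ad_star (scl g c x) \<xi> = scl d c (ad_star x \<xi>)"
    "ad_star x (scl d c \<xi>) = scl d c (ad_star x \<xi>)"
  by (auto simp: coad_def brk_add brk_scale V_lin plus_fun_apply scl_d fun_eq_iff)

text \<open>The dual bracket through the coadjoint action of \<open>g\<close>; all properties of \<open>g\<^sup>*\<close> are derived from this
  formula and from the morphism properties of \<open>L\<close> and \<open>R\<close>.\<close>

lemma brk_d_ad_star: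
  assumes \<xi>: "\<xi> \<in> V" and \<eta>: "\<eta> \<in> V"
  shows "brk d \<xi> \<eta> = ad_star (L \<xi>) \<eta> - ad_star (R \<eta>) \<xi>"
proof
  fix x
  have 1: "\<eta> (brk g (L \<xi>) x) = - (\<Sum>j<m. \<xi> (a j) * \<eta> (brk g x (b j)))"
    using \<xi> \<eta> by (subst brk_anti) (simp add: L_eq brk_sum brk_scale V_lin)
  have 2: "\<xi> (brk g (R \<eta>) x) = (\<Sum>j<m. \<xi> (brk g x (a j)) * \<eta> (b j))"
    using \<xi> \<eta> by (subst brk_anti) (simp add: R_eq brk_sum brk_neg brk_scale V_lin mult.commute)
  show "brk d \<xi> \<eta> x = (ad_star (L \<xi>) \<eta> - ad_star (R \<eta>) \<xi>) x"
    using \<xi> \<eta> by (simp add: brk_d coad_def minus_apply 1 2 sum.distrib)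
qed

lemma brk_d_V: "\<xi> \<in> V \<Longrightarrow> \<eta> \<in> V \<Longrightarrow> brk d \<xi> \<eta> \<in> V"
  by (simp add: brk_d_ad_star ad_star_V V_diff)

lemma L_pairing: "\<xi> \<in> V \<Longrightarrow> \<eta> \<in> V \<Longrightarrow> \<eta> (L \<xi>) = - \<xi> (R \<eta>)"
  by (simp add: L_eq R_eq V_lin mult.commute)

text \<open>The classical Yang-Baxter equation is used by applying a linear map to its left-hand side, that is,
  by evaluating a trilinear map on it.\<close>

definition trilinear :: "('g \<Rightarrow> 'g \<Rightarrow> 'g \<Rightarrow> 'g) \<Rightarrow> bool" where
  "trilinear \<theta> \<longleftrightarrow>
    (\<forall>x x' y z. \<theta> (x + x') y z = \<theta> x y z + \<theta> x' y z) \<and> (\<forall>x y y' z. \<theta> x (y + y') z = \<theta> x y z + \<theta> x y' z) \<and>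
    (\<forall>x y z z'. \<theta> x y (z + z') = \<theta> x y z + \<theta> x y z') \<and>
    (\<forall>c x y z. \<theta> (scl g c x) y z = scl g c (\<theta> x y z) \<and> \<theta> x (scl g c y) z = scl g c (\<theta> x y z) \<and>
       \<theta> x y (scl g c z) = scl g c (\<theta> x y z))"

lemma tens3_linear: "tens3 g (x + x') y z = tens3 g x y z + tens3 g x' y z" "tens3 g x (y + y') z = tens3 g x y z + tens3 g x y' z"
  "tens3 g x y (z + z') = tens3 g x y z + tens3 g x y z'"
  "tens3 g (scl g c x) y z = scl (tensor (tensor g g) g) c (tens3 g x y z)"
  "tens3 g x (scl g c y) z = scl (tensor (tensor g g) g) c (tens3 g x y z)"
  "tens3 g x y (scl g c z) = scl (tensor (tensor g g) g) c (tens3 g x y z)"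
  "tens3 g x y z \<in> carr (tensor (tensor g g) g)"
  by (simp_all add: tens3_def tens_gg T3.tens_add_left T3.tens_add_right T3.tens_scale_left T3.tens_scale_right T3.tens_T univ)

lemma cybe_trilinear:
  assumes "trilinear \<theta>"
  shows "(\<Sum>i<m. \<Sum>j<m. \<theta> (brk g (a i) (a j)) (b i) (b j) + \<theta> (a i) (brk g (b i) (a j)) (b j)
     + \<theta> (a i) (a j) (brk g (b i) (b j))) = 0"
proof -
  let ?s3 = "scl (tensor (tensor g g) g)"
  let ?K = "\<lambda>a b c d. tens3 g (brk g a c) b d + tens3 g a (brk g b c) d + tens3 g a c (brk g b d)"
  have K1: "bilinear_on g g ?s3 (\<lambda>c d. ?K x y c d)" for x y
    by (rule bilin_g) (simp_all add: tens3_linear brk_add brk_scale T3.T.scale_right_distrib algebra_simps)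
  have in1: "lift g g (\<lambda>c d. ?K x y c d) r = (\<Sum>j<m. ?K x y (a j) (b j))" for x y
    unfolding r by (rule TG.lift_sum_tens[OF vs_tensor K1]) (simp_all add: univ)
  have K2: "bilinear_on g g ?s3 (\<lambda>x y. \<Sum>j<m. ?K x y (a j) (b j))"
    by (rule bilin_g)
      (simp_all add: tens3_linear brk_add brk_scale T3.T.scale_right_distrib T3.T.scale_sum_right sum.distrib algebra_simps)
  have "lift g g (\<lambda>x y. \<Sum>j<m. ?K x y (a j) (b j)) r = (\<Sum>i<m. \<Sum>j<m. ?K (a i) (b i) (a j) (b j))"
    unfolding r by (rule TG.lift_sum_tens[OF vs_tensor K2]) (simp_all add: univ)
  then have cyb: "(\<Sum>i<m. \<Sum>j<m. ?K (a i) (b i) (a j) (b j)) = 0"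
    using cybe unfolding cyb_def in1 by simp
  have \<theta>2: "bilinear_on g g (scl g) (\<lambda>x y. \<theta> x y z)" for z
    using assms by (intro bilin_g) (simp_all add: trilinear_def)
  have in2: "lift g g (\<lambda>x y. \<theta> x y z) (tens g g x y) = \<theta> x y z" for x y z
    by (rule TG.lift_tens[OF vs_g \<theta>2]) (simp_all add: univ)
  define \<Lambda> where "\<Lambda> T z = lift g g (\<lambda>x y. \<theta> x y z) T" for T z
  have \<Lambda>: "\<Lambda> 0 z = 0" "T \<in> carr (tensor g g) \<Longrightarrow> \<Lambda> (tens g g x y + T) z = \<theta> x y z + \<Lambda> T z" for x y z T
    unfolding \<Lambda>_def by (simp_all add: TG.lift_zero[OF vs_g \<theta>2] TG.lift_tens_add[OF vs_g \<theta>2] univ)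
  have \<theta>3: "bilinear_on (tensor g g) g (scl g) \<Lambda>"
  proof (rule bilinear_onI)
    fix T z z' c assume T: "T \<in> carr (tensor g g)"
    show "\<Lambda> T (z + z') = \<Lambda> T z + \<Lambda> T z'" using T
      by (induction T rule: TG.T_induct) (use assms in \<open>auto simp: \<Lambda> trilinear_def\<close>)
    show "\<Lambda> T (scl g c z) = scl g c (\<Lambda> T z)" using T
      by (induction T rule: TG.T_induct) (use assms in \<open>auto simp: \<Lambda> trilinear_def G.scale_right_distrib\<close>)
    show "\<Lambda> (scl (tensor g g) c T) z = scl g c (\<Lambda> T z)"
      using T unfolding \<Lambda>_def by (rule TG.lift_scale[OF vs_g \<theta>2])
    fix T' assume "T' \<in> carr (tensor g g)"
    with T show "\<Lambda> (T + T') z = \<Lambda> T z + \<Lambda> T' z"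
      unfolding \<Lambda>_def by (rule TG.lift_add[OF vs_g \<theta>2])
  qed
  have ev: "lift (tensor g g) g \<Lambda> (tens3 g x y z) = \<theta> x y z" for x y z
    unfolding tens3_def by (subst T3.lift_tens[OF vs_g \<theta>3]) (simp_all add: univ tens_gg \<Lambda>_def in2)
  have "lift (tensor g g) g \<Lambda> (\<Sum>i<m. \<Sum>j<m. ?K (a i) (b i) (a j) (b j)) =
     (\<Sum>i<m. \<Sum>j<m. \<theta> (brk g (a i) (a j)) (b i) (b j) + \<theta> (a i) (brk g (b i) (a j)) (b j)
     + \<theta> (a i) (a j) (brk g (b i) (b j)))"
    by (simp add: T3.lift_sum_scaled[OF vs_g \<theta>3] T3.lift_add[OF vs_g \<theta>3] T3.T_sum T3.T_add tens3_linear ev)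
  then show ?thesis by (simp add: cyb T3.lift_zero[OF vs_g \<theta>3])
qed

lemma L_brk: assumes \<xi>: "\<xi> \<in> V" and \<eta>: "\<eta> \<in> V" shows "L (brk d \<xi> \<eta>) = brk g (L \<xi>) (L \<eta>)"
proof -
  have "trilinear (\<lambda>x y z. scl g (\<xi> x * \<eta> y) z)"
    using \<xi> \<eta> by (simp add: trilinear_def V_lin G.scale_left_distrib G.scale_right_distrib ring_distribs mult_ac)
  from cybe_trilinear[OF this]
  have f1: "(\<Sum>i<m. \<Sum>j<m. scl g (\<xi> (brk g (a i) (a j)) * \<eta> (b i)) (b j)) + (\<Sum>i<m. \<Sum>j<m. scl g (\<xi> (a i) * \<eta> (brk g (b i) (a j))) (b j))
     + (\<Sum>i<m. \<Sum>j<m. scl g (\<xi> (a i) * \<eta> (a j)) (brk g (b i) (b j))) = 0"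
    by (simp add: sum.distrib)
  have f2: "(\<Sum>i<m. \<Sum>j<m. scl g (\<xi> (a i) * \<eta> (a j)) (brk g (b i) (b j))) = brk g (L \<xi>) (L \<eta>)"
    by (simp only: L_eq \<xi> \<eta> brk_sum(1)) (simp add: brk_sum brk_scale G.scale_sum_right mult.commute)
  have f3: "L (brk d \<xi> \<eta>) = - ((\<Sum>i<m. \<Sum>j<m. scl g (\<xi> (brk g (a i) (a j)) * \<eta> (b i)) (b j)) + (\<Sum>i<m. \<Sum>j<m. scl g (\<xi> (a i) * \<eta> (brk g (b i) (a j))) (b j)))"
  proof -
    have "scl g (brk d \<xi> \<eta> (a k)) (b k) = - ((\<Sum>j<m. scl g (\<xi> (brk g (a j) (a k)) * \<eta> (b j)) (b k)) + (\<Sum>j<m. scl g (\<xi> (a j) * \<eta> (brk g (b j) (a k))) (b k)))" for k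
    proof -
      have "brk d \<xi> \<eta> (a k) = - (\<Sum>j<m. \<xi> (brk g (a j) (a k)) * \<eta> (b j) + \<xi> (a j) * \<eta> (brk g (b j) (a k)))"
        using \<xi> \<eta> by (simp add: brk_d brk_anti[of "a k"] V_lin sum_negf sum.distrib sum_subtractf)
      then show ?thesis by (simp add: sum.distrib G.scale_left_distrib G.scale_left_diff_distrib G.scale_sum_left)
    qed
    then have "L (brk d \<xi> \<eta>) = - ((\<Sum>k<m. \<Sum>j<m. scl g (\<xi> (brk g (a j) (a k)) * \<eta> (b j)) (b k)) + (\<Sum>k<m. \<Sum>j<m. scl g (\<xi> (a j) * \<eta> (brk g (b j) (a k))) (b k)))"
      using \<xi> \<eta> by (simp add: L_eq brk_d_V sum_negf sum.distrib sum_subtractf)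
    then show ?thesis
      unfolding sum.swap[of "\<lambda>k j. scl g (\<xi> (brk g (a j) (a k)) * \<eta> (b j)) (b k)" "{..<m}" "{..<m}"]
        sum.swap[of "\<lambda>k j. scl g (\<xi> (a j) * \<eta> (brk g (b j) (a k))) (b k)" "{..<m}" "{..<m}"] .
  qed
  have "X = - (P + Q)" if "P + Q + X = 0" for X P Q :: 'g
    using that by (simp only: eq_neg_iff_add_eq_0 add.commute)
  from this[OF f1] show ?thesis unfolding f3 f2[symmetric] by simp
qed

lemma R_brk: assumes \<xi>: "\<xi> \<in> V" and \<eta>: "\<eta> \<in> V" shows "R (brk d \<xi> \<eta>) = brk g (R \<xi>) (R \<eta>)"
proof -
  have "trilinear (\<lambda>x y z. scl g (\<xi> y * \<eta> z) x)"
    using \<xi> \<eta> by (simp add: trilinear_def V_lin G.scale_left_distrib G.scale_right_distrib ring_distribs mult_ac)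
  from cybe_trilinear[OF this]
  have f1: "(\<Sum>i<m. \<Sum>j<m. scl g (\<xi> (b i) * \<eta> (b j)) (brk g (a i) (a j))) + (\<Sum>i<m. \<Sum>j<m. scl g (\<xi> (brk g (b i) (a j)) * \<eta> (b j)) (a i))
     + (\<Sum>i<m. \<Sum>j<m. scl g (\<xi> (a j) * \<eta> (brk g (b i) (b j))) (a i)) = 0"
    by (simp add: sum.distrib)
  have f2: "(\<Sum>i<m. \<Sum>j<m. scl g (\<xi> (b i) * \<eta> (b j)) (brk g (a i) (a j))) = brk g (R \<xi>) (R \<eta>)"
    by (simp only: R_eq \<xi> \<eta> brk_sum(1) brk_neg minus_minus) (simp add: brk_sum brk_scale G.scale_sum_right mult.commute)
  have f3: "R (brk d \<xi> \<eta>) = - ((\<Sum>i<m. \<Sum>j<m. scl g (\<xi> (brk g (b i) (a j)) * \<eta> (b j)) (a i)) + (\<Sum>i<m. \<Sum>j<m. scl g (\<xi> (a j) * \<eta> (brk g (b i) (b j))) (a i)))"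
    using \<xi> \<eta> by (simp add: R_eq brk_d_V brk_d sum.distrib G.scale_left_distrib G.scale_sum_left)
  have "X = - (P + Q)" if "X + P + Q = 0" for X P Q :: 'g
    using that by (simp only: eq_neg_iff_add_eq_0 add.assoc)
  from this[OF f1] show ?thesis unfolding f3 f2[symmetric] by simp
qed

text \<open>The image of \<open>r\<close> under the bracket, the semiclassical counterpart of the Drinfeld element, which
  implements the square of the antipode of a quantum group.\<close>

definition "h\<^sub>r = (\<Sum>j<m. brk g (a j) (b j))"

text \<open>Bracketing the first two legs of the Yang-Baxter equation gives
  \<open>\<Sum> [h\<^sub>r, a\<^sub>j] \<otimes> b\<^sub>j + S = 0\<close>, and bracketing the last two gives \<open>S + \<Sum> a\<^sub>j \<otimes> [b\<^sub>j, h\<^sub>r] = 0\<close>, with the same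
  \<open>S = \<Sum> [a\<^sub>i, a\<^sub>j] \<otimes> [b\<^sub>i, b\<^sub>j]\<close>. Hence \<open>r\<close> is invariant under \<open>h\<^sub>r\<close>.\<close>

lemma L_equivariant_h\<^sub>r:
  assumes \<xi>: "\<xi> \<in> V"
  shows "brk g h\<^sub>r (L \<xi>) = L (ad_star h\<^sub>r \<xi>)"
proof -
  define S where "S = (\<Sum>i<m. \<Sum>j<m. scl g (\<xi> (brk g (a i) (a j))) (brk g (b i) (b j)))"
  have jac: "brk g (brk g x z) y + brk g x (brk g y z) = brk g (brk g x y) z" for x y z
    using jacobi[of x y z] brk_anti[of "brk g x z" y] brk_anti[of "brk g x y" z] brk_anti[of z x] 
    by (simp add: brk_neg algebra_simps)
  have "trilinear (\<lambda>x y z. scl g (\<xi> (brk g x y)) z)" "trilinear (\<lambda>x y z. scl g (\<xi> x) (brk g y z))"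
    using \<xi> by (simp_all add: trilinear_def V_lin brk_add brk_scale G.scale_left_distrib G.scale_right_distrib mult_ac)
  note this[THEN cybe_trilinear]
  then have 1: "(\<Sum>i<m. \<Sum>j<m. scl g (\<xi> (brk g (brk g (a i) (a j)) (b i) + brk g (a i) (brk g (b i) (a j)))) (b j)) + S = 0"
    and 2: "S + (\<Sum>i<m. \<Sum>j<m. scl g (\<xi> (a i)) (brk g (brk g (b i) (a j)) (b j) + brk g (a j) (brk g (b i) (b j)))) = 0"
    using \<xi> by (simp_all add: S_def sum.distrib V_lin G.scale_left_distrib G.scale_right_distrib add.assoc)
  have 3: "brk g (brk g x y) z + brk g y (brk g x z) = brk g x (brk g y z)" for x y z
    using jac[of x z y] brk_anti[of y "brk g x z"] brk_anti[of z y] by (simp add: brk_neg algebra_simps)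
  have "(\<Sum>i<m. \<Sum>j<m. scl g (\<xi> (brk g (brk g (a i) (b i)) (a j))) (b j)) = (\<Sum>j<m. scl g (\<xi> (brk g h\<^sub>r (a j))) (b j))"
    using \<xi> by (subst sum.swap) (simp add: h\<^sub>r_def brk_sum V_lin G.scale_sum_left)
  also have "\<dots> = - L (ad_star h\<^sub>r \<xi>)"
    using \<xi> by (simp add: L_ad_star)
  finally have 4: "- L (ad_star h\<^sub>r \<xi>) + S = 0" using 1 unfolding jac by simp
  have "(\<Sum>i<m. \<Sum>j<m. scl g (\<xi> (a i)) (brk g (b i) (brk g (a j) (b j)))) = brk g (L \<xi>) h\<^sub>r"
    by (simp only: L_eq \<xi> brk_sum(1)) (simp add: h\<^sub>r_def brk_sum brk_scale G.scale_sum_right)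
  then have "S + brk g (L \<xi>) h\<^sub>r = 0" using 2 unfolding 3 by simp
  with 4 show ?thesis using brk_anti[of "L \<xi>" "h\<^sub>r"] by (simp add: eq_neg_iff_add_eq_0)
qed

definition "\<tau> \<xi> = L \<xi> - R \<xi>"

lemma \<tau>_sum: "\<xi> \<in> V \<Longrightarrow> \<tau> \<xi> = lift g g (\<lambda>a b. scl g (\<xi> a) b) (sym_part g r)"
  unfolding sym_part_def \<tau>_def
  by (subst TG.lift_add[OF vs_g LR_bilin(1) r_T flip_r_T], assumption, unfold flip_r, subst TG.lift_sum_tens[OF vs_g LR_bilin(1)])
    (simp_all add: univ Lmap_def[symmetric] R_eq)

lemma \<tau>_bij: "bij_betw \<tau> V UNIV"
  using nondeg by (rule bij_betw_cong[THEN iffD1, rotated]) (simp add: \<tau>_sum)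

lemma \<tau>_add: "\<xi> \<in> V \<Longrightarrow> \<eta> \<in> V \<Longrightarrow> \<tau> (\<xi> + \<eta>) = \<tau> \<xi> + \<tau> \<eta>"
  and \<tau>_scale: "\<xi> \<in> V \<Longrightarrow> \<tau> (scl d c \<xi>) = scl g c (\<tau> \<xi>)"
  by (simp_all add: \<tau>_def L_add R_add L_scale R_scale G.scale_right_diff_distrib)

lemma \<tau>_equivariant:
  assumes \<xi>: "\<xi> \<in> V"
  shows "brk g x (\<tau> \<xi>) = \<tau> (ad_star x \<xi>)"
proof -
  have P: "bilinear_on g g (scl g) (\<lambda>a b. scl g (\<xi> a) b)" by (rule LR_bilin(1)[OF \<xi>])
  let ?t = "\<Sum>j<m. tens g g (brk g x (a j)) (b j) + tens g g (a j) (brk g x (b j)) + (tens g g (brk g x (b j)) (a j) + tens g g (b j) (brk g x (a j)))"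
  have "ad2 g x (sym_part g r) = ?t"
    unfolding ad2_def sym_part_def
    by (subst TG.lift_add[OF vs_tensor ad2_bilin r_T flip_r_T], unfold flip_r, subst (1) r,
       subst (1 2) TG.lift_sum_tens[OF vs_tensor ad2_bilin]) (simp_all add: univ sum.distrib)
  then have "lift g g (\<lambda>a b. scl g (\<xi> a) b) ?t = 0"
    using ad_sym[of x] TG.lift_zero[OF vs_g P] by simp
  then have "(\<Sum>j<m. scl g (\<xi> (brk g x (a j))) (b j) + scl g (\<xi> (a j)) (brk g x (b j)) + (scl g (\<xi> (brk g x (b j))) (a j) + scl g (\<xi> (b j)) (brk g x (a j)))) = 0"
    by (simp add: TG.lift_sum_scaled[OF vs_g P] TG.lift_add[OF vs_g P] TG.lift_tens[OF vs_g P] TG.T_add tens_gg univ)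
  then show ?thesis
    using \<xi> by (simp add: \<tau>_def L_ad_star R_ad_star L_eq R_eq brk_add brk_sum brk_scale sum.distrib eq_neg_iff_add_eq_0 algebra_simps)
qed

text \<open>In the double, \<open>g\<close> is embedded diagonally into \<open>g \<oplus> g\<close> and \<open>g\<^sup>*\<close> by \<open>(L, R)\<close>. The bracket of \<open>x\<close> and \<open>\<xi>\<close> has
  the component \<open>ad_star x \<xi>\<close> in \<open>g\<^sup>*\<close>; its component in \<open>g\<close> is the following element, computed in the
  first copy of \<open>g\<close> here and in the second one in \<open>dress_R\<close>.\<close>

definition "dress x \<xi> = brk g x (L \<xi>) - L (ad_star x \<xi>)"

lemma dress_R: "\<xi> \<in> V \<Longrightarrow> dress x \<xi> = brk g x (R \<xi>) - R (ad_star x \<xi>)"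
  using \<tau>_equivariant[of \<xi> x] by (simp add: \<tau>_def dress_def brk_diff algebra_simps)

lemma dress_h\<^sub>r: "\<xi> \<in> V \<Longrightarrow> dress h\<^sub>r \<xi> = 0"
  by (simp add: dress_def L_equivariant_h\<^sub>r)

lemma dress_pairing:
  assumes "\<xi> \<in> V" "\<eta> \<in> V"
  shows "\<eta> (dress x \<xi>) = brk d \<xi> \<eta> x"
proof -
  have "\<eta> (L (ad_star x \<xi>)) = \<xi> (brk g x (R \<eta>))"
    using assms by (simp add: L_pairing ad_star_V) (simp add: coad_def)
  moreover have "brk d \<xi> \<eta> x = \<eta> (brk g x (L \<xi>)) - \<xi> (brk g x (R \<eta>))"
    using assms by (simp add: brk_d_ad_star minus_apply coad_def brk_anti[of _ x] V_lin)
  ultimately show ?thesis using assms by (simp add: dress_def V_lin)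
qed

text \<open>An operator and its transpose have the same effect on the canonical element \<open>\<Sum> e\<^sup>i \<otimes> e\<^sub>i\<close>.\<close>

lemma canonical_transpose:
  fixes B :: "('g \<Rightarrow> 'k) \<Rightarrow> 'g \<Rightarrow> 'a::ab_group_add"
  assumes vs: "vector_space sA"
    and B1: "\<And>\<xi> \<eta> x. \<xi> \<in> V \<Longrightarrow> \<eta> \<in> V \<Longrightarrow> B (\<xi> + \<eta>) x = B \<xi> x + B \<eta> x"
    and B2: "\<And>\<xi> c x. \<xi> \<in> V \<Longrightarrow> B (scl d c \<xi>) x = sA c (B \<xi> x)"
    and B3: "\<And>\<xi> x y. \<xi> \<in> V \<Longrightarrow> B \<xi> (x + y) = B \<xi> x + B \<xi> y"
    and B4: "\<And>\<xi> c x. \<xi> \<in> V \<Longrightarrow> B \<xi> (scl g c x) = sA c (B \<xi> x)"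
    and A: "\<And>\<eta>. \<eta> \<in> V \<Longrightarrow> A \<eta> \<in> V" and At: "\<And>\<eta> x. \<eta> \<in> V \<Longrightarrow> A \<eta> x = \<eta> (A' x)"
  shows "(\<Sum>i<N. B (A (co i)) (e i)) = (\<Sum>i<N. B (co i) (A' (e i)))"
proof -
  interpret sA: vector_space sA by (rule vs)
  have B0: "B 0 x = 0" for x using B2[OF V_zero, of 0 x] by simp
  have Bs: "B (\<Sum>i\<in>I. scl d (c i) (f i)) x = (\<Sum>i\<in>I. sA (c i) (B (f i) x))" if "\<And>i. i \<in> I \<Longrightarrow> f i \<in> V" for I :: "nat set" and c f x
    using that by (induction I rule: infinite_finite_induct) (auto simp: B0 B1 B2 V_sum V_scale)
  have B0': "B \<xi> 0 = 0" if "\<xi> \<in> V" for \<xi> using B4[OF that, of 0 0] by simp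
  have Bs': "B \<xi> (\<Sum>i\<in>I. scl g (c i) (f i)) = (\<Sum>i\<in>I. sA (c i) (B \<xi> (f i)))" if "\<xi> \<in> V" for I :: "nat set" and c f \<xi>
    using that by (induction I rule: infinite_finite_induct) (auto simp: B0' B3 B4)
  have "(\<Sum>i<N. B (A (co i)) (e i)) = (\<Sum>i<N. \<Sum>j<N. sA (co i (A' (e j))) (B (co j) (e i)))"
  proof (rule sum.cong)
    fix i
    have "A (co i) = (\<Sum>j<N. scl d (co i (A' (e j))) (co j))"
      using V_expand[OF A[OF co_V[of i]]] by (simp add: At co_V)
    then show "B (A (co i)) (e i) = (\<Sum>j<N. sA (co i (A' (e j))) (B (co j) (e i)))"
      by (simp add: Bs co_V)
  qed simp
  also have "\<dots> = (\<Sum>j<N. \<Sum>i<N. sA (co i (A' (e j))) (B (co j) (e i)))"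
    by (rule sum.swap)
  also have "\<dots> = (\<Sum>j<N. B (co j) (\<Sum>i<N. scl g (co i (A' (e j))) (e i)))"
    by (simp add: Bs' co_V)
  finally show ?thesis by (simp add: co_expand)
qed

lemma eval_bilin: "bilinear_on d d (*) (\<lambda>\<xi> \<eta>. \<xi> x * \<eta> y)"
  by (rule bilinear_onI) (auto simp: plus_fun_apply scl_d algebra_simps)

lemma tensor_dd_eqI:
  assumes T: "T \<in> carr (tensor d d)" and S: "S \<in> carr (tensor d d)"
    and eq: "\<And>x y. lift d d (\<lambda>\<xi> \<eta>. \<xi> x * \<eta> y) T = lift d d (\<lambda>\<xi> \<eta>. \<xi> x * \<eta> y) S"
  shows "T = S"
proof -
  let ?ev = "\<lambda>T i j. lift d d (\<lambda>\<xi> \<eta>. \<xi> (e i) * \<eta> (e j)) T"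
  have "T = (\<Sum>i<N. \<Sum>j<N. scl (tensor d d) (?ev T i j) (tens d d (co i) (co j)))" if "T \<in> carr (tensor d d)" for T
    using that
  proof (induction T rule: TD.T_induct)
    case zero
    show ?case by (simp add: TD.lift_zero[OF vector_space_field eval_bilin])
  next
    case (add \<xi> \<eta> T)
    then have V: "\<xi> \<in> V" "\<eta> \<in> V" by simp_all
    have l: "tens d d (\<Sum>i\<in>I. scl d (c i) (co i)) \<eta> = (\<Sum>i\<in>I. scl (tensor d d) (c i) (tens d d (co i) \<eta>))"
      if "\<eta> \<in> V" for I :: "nat set" and c \<eta>
      using that by (induction I rule: infinite_finite_induct)
        (auto simp: TD.tens_add_left TD.tens_scale_left co_V V_sum V_scale)
    have rr: "tens d d \<xi> (\<Sum>i\<in>I. scl d (c i) (co i)) = (\<Sum>i\<in>I. scl (tensor d d) (c i) (tens d d \<xi> (co i)))"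
      if "\<xi> \<in> V" for I :: "nat set" and c \<xi>
      using that by (induction I rule: infinite_finite_induct)
        (auto simp: TD.tens_add_right TD.tens_scale_right co_V V_sum V_scale)
    have "tens d d \<xi> \<eta> = (\<Sum>i<N. scl (tensor d d) (\<xi> (e i)) (tens d d (co i) \<eta>))"
      using l[OF V(2), of "\<lambda>i. \<xi> (e i)" "{..<N}"] unfolding V_expand[OF V(1), symmetric] .
    also have "\<dots> = (\<Sum>i<N. scl (tensor d d) (\<xi> (e i)) (\<Sum>j<N. scl (tensor d d) (\<eta> (e j)) (tens d d (co i) (co j))))"
    proof (rule sum.cong)
      fix i
      show "scl (tensor d d) (\<xi> (e i)) (tens d d (co i) \<eta>) =
        scl (tensor d d) (\<xi> (e i)) (\<Sum>j<N. scl (tensor d d) (\<eta> (e j)) (tens d d (co i) (co j)))"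
        using rr[OF co_V, of i "\<lambda>i. \<eta> (e i)" "{..<N}"] unfolding V_expand[OF V(2), symmetric] by (rule arg_cong)
    qed simp
    finally have te: "tens d d \<xi> \<eta> = (\<Sum>i<N. \<Sum>j<N. scl (tensor d d) (\<xi> (e i) * \<eta> (e j)) (tens d d (co i) (co j)))"
      by (simp add: TD.T.scale_sum_right)
    have "?ev (tens d d \<xi> \<eta> + T) i j = \<xi> (e i) * \<eta> (e j) + ?ev T i j" for i j
      by (rule TD.lift_tens_add[OF vector_space_field eval_bilin]) (use add in auto)
    then show ?case
      by (simp only: TD.T.scale_left_distrib sum.distrib te[symmetric] add.IH[symmetric])
  qed
  from this[OF T] this[OF S] show ?thesis by (simp add: eq)
qed

lemma dual_cobracket_eq:
  assumes \<xi>: "\<xi> \<in> V"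
  shows "dual_cobracket g r \<xi> = (\<Sum>i<N. tens d d (ad_star (e i) \<xi>) (co i))"
proof -
  let ?T = "\<Sum>i<N. tens d d (ad_star (e i) \<xi>) (co i)"
  have T: "?T \<in> carr (tensor d d)"
    using \<xi> by (intro TD.T_sum TD.tens_T) (simp_all add: ad_star_V co_V)
  have ev: "lift d d (\<lambda>\<eta> \<zeta>. \<eta> x * \<zeta> y) ?T = \<xi> (brk g x y)" for x y
  proof -
    have "lift d d (\<lambda>\<eta> \<zeta>. \<eta> x * \<zeta> y) ?T = (\<Sum>i<N. ad_star (e i) \<xi> x * co i y)"
      using \<xi> by (intro TD.lift_sum_tens[OF vector_space_field eval_bilin]) (simp_all add: ad_star_V co_V)
    also have "\<dots> = \<xi> (brk g x (\<Sum>i<N. scl g (co i y) (e i)))"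
      using \<xi> by (simp add: coad_def brk_sum brk_scale V_lin brk_anti[of _ x] mult.commute)
    finally show ?thesis by (simp add: co_expand)
  qed
  show ?thesis unfolding dual_cobracket_def Let_def univ
  proof (rule the_equality)
    show "?T \<in> carr (tensor d d) \<and> (\<forall>x\<in>UNIV. \<forall>y\<in>UNIV. lift d d (\<lambda>m n. m x * n y) ?T = \<xi> (brk g x y))"
      using T ev by blast
    fix S assume "S \<in> carr (tensor d d) \<and> (\<forall>x\<in>UNIV. \<forall>y\<in>UNIV. lift d d (\<lambda>m n. m x * n y) S = \<xi> (brk g x y))"
    then show "S = ?T" by (intro tensor_dd_eqI) (simp_all add: T ev)
  qed
qed

lemma brk_d_add: "\<xi> \<in> V \<Longrightarrow> \<xi>' \<in> V \<Longrightarrow> \<eta> \<in> V \<Longrightarrow> brk d (\<xi> + \<xi>') \<eta> = brk d \<xi> \<eta> + brk d \<xi>' \<eta>"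
  "\<xi> \<in> V \<Longrightarrow> \<eta> \<in> V \<Longrightarrow> \<eta>' \<in> V \<Longrightarrow> brk d \<xi> (\<eta> + \<eta>') = brk d \<xi> \<eta> + brk d \<xi> \<eta>'"
  and brk_d_scale: "\<xi> \<in> V \<Longrightarrow> \<eta> \<in> V \<Longrightarrow> brk d (scl d c \<xi>) \<eta> = scl d c (brk d \<xi> \<eta>)"
  "\<xi> \<in> V \<Longrightarrow> \<eta> \<in> V \<Longrightarrow> brk d \<xi> (scl d c \<eta>) = scl d c (brk d \<xi> \<eta>)"
  by (simp_all add: brk_d_ad_star V_add V_scale L_add R_add L_scale R_scale ad_star_add ad_star_scale
     dual.scale_right_diff_distrib)

lemma brk_d_bilin: "bilinear_on d d (scl d) (brk d)"
  by (rule bilinear_onI) (simp_all add: brk_d_add brk_d_scale)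

lemma dual_D_sum:
  "\<xi> \<in> V \<Longrightarrow> dual_D g r \<xi> = scl d (1/2) (\<Sum>i<N. brk d (ad_star (e i) \<xi>) (co i))"
  unfolding dual_D_def Let_def dual_cobracket_eq
  by (subst TD.lift_sum_tens[OF vs_d brk_d_bilin]) (simp_all add: ad_star_V co_V)

text \<open>\<open>D\<close> is the transpose of the composite of cobracket and bracket of \<open>g\<close>, and that composite is
  \<open>1/2 ad\<close> of \<open>- h\<^sub>r\<close>, because the cobracket is the coboundary of \<open>r\<close>.\<close>

lemma dual_D_eq:
  assumes \<xi>: "\<xi> \<in> V"
  shows "dual_D g r \<xi> = scl d (1/2) (ad_star h\<^sub>r \<xi>)"
proof -
  have "(\<Sum>i<N. brk d (ad_star (e i) \<xi>) (co i)) = ad_star h\<^sub>r \<xi>"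
  proof
    fix x
    have ex: "(\<Sum>i<N. \<xi> (brk g (e i) z) * co i y) = \<xi> (brk g y z)" for y z
    proof -
      have "\<xi> (brk g (\<Sum>i<N. scl g (co i y) (e i)) z) = (\<Sum>i<N. \<xi> (brk g (e i) z) * co i y)"
        using \<xi> by (simp add: brk_sum brk_scale V_lin mult.commute)
      then show ?thesis by (simp add: co_expand)
    qed
    have "(\<Sum>i<N. brk d (ad_star (e i) \<xi>) (co i)) x =
      (\<Sum>i<N. \<Sum>j<m. - (\<xi> (brk g (e i) (brk g x (a j))) * co i (b j)) - \<xi> (brk g (e i) (a j)) * co i (brk g x (b j)))"
      using \<xi> by (simp add: fun_sum_apply brk_d ad_star_V co_V) (simp add: coad_def)
    also have "\<dots> = (\<Sum>j<m. - \<xi> (brk g (b j) (brk g x (a j))) - \<xi> (brk g (brk g x (b j)) (a j)))"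
      by (subst sum.swap) (simp add: sum_subtractf sum_negf ex)
    also have "\<dots> = (\<Sum>j<m. \<xi> (brk g x (brk g (a j) (b j))))"
    proof (rule sum.cong)
      fix j
      have "brk g x (brk g (a j) (b j)) = - brk g (b j) (brk g x (a j)) - brk g (brk g x (b j)) (a j)"
      proof -
        have "brk g (brk g x (b j)) (a j) = brk g (a j) (brk g (b j) x)"
          using brk_anti[of "brk g x (b j)" "a j"] brk_anti[of x "b j"] by (simp add: brk_neg)
        moreover have "X = - Z - Y" if "X + Y + Z = 0" for X Y Z :: 'g
          using that by (simp add: algebra_simps eq_neg_iff_add_eq_0)
        ultimately show ?thesis using jacobi[of x "a j" "b j"] by simp
      qed
      then show "- \<xi> (brk g (b j) (brk g x (a j))) - \<xi> (brk g (brk g x (b j)) (a j)) = \<xi> (brk g x (brk g (a j) (b j)))"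
        using \<xi> by (simp add: V_lin)
    qed simp
    also have "\<dots> = ad_star h\<^sub>r \<xi> x"
      using \<xi> by (simp add: coad_def h\<^sub>r_def brk_sum V_lin brk_anti[of _ x] sum_negf)
    finally show "(\<Sum>i<N. brk d (ad_star (e i) \<xi>) (co i)) x = ad_star h\<^sub>r \<xi> x" .
  qed
  then show ?thesis using \<xi> by (simp add: dual_D_sum)
qed

end

section \<open>Structure maps of enveloping algebras\<close>

sublocale env_alg \<subseteq> TA: tens_algebra s
  using enveloping by unfold_locales (simp add: enveloping_algebra_def)

context env_alg
begin

text \<open>A linear map that satisfies the Leibniz rule for left multiplication by generators is a derivation, and
  hence the one determined by \<open>f\<close>.\<close>

lemma der_extension_eq:
  assumes lin: "Vector_Spaces.linear s s \<phi>" and one: "\<phi> 1 = 0"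
    and mult: "\<And>x u. x \<in> carr h \<Longrightarrow> \<phi> (\<iota> x * u) = \<iota> (f x) * u + \<iota> x * \<phi> u"
  shows "der_extension h s \<iota> f = \<phi>" and "\<phi> (u * v) = \<phi> u * v + u * \<phi> v" and "x \<in> carr h \<Longrightarrow> \<phi> (\<iota> x) = \<iota> (f x)"
proof -
  have der: "\<phi> (u * v) = \<phi> u * v + u * \<phi> v" for u v
  proof (induction u rule: env_induct)
    case (mult x u)
    then show ?case using assms(3)[of x "u * v"] assms(3)[of x u] by (simp add: algebra_simps)
  qed (simp_all add: one lin_add[OF lin] lin_scale[OF lin] scale_mult V.scale_right_distrib ring_distribs)
  then show "\<phi> (u * v) = \<phi> u * v + u * \<phi> v" .
  have gen: "\<phi> (\<iota> x) = \<iota> (f x)" if "x \<in> carr h" for x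
    using mult[OF that, of 1] one by simp
  then show "x \<in> carr h \<Longrightarrow> \<phi> (\<iota> x) = \<iota> (f x)" .
  show "der_extension h s \<iota> f = \<phi>" unfolding der_extension_def
  proof (rule the_equality)
    show "Vector_Spaces.linear s s \<phi> \<and> (\<forall>x y. \<phi> (x * y) = \<phi> x * y + x * \<phi> y) \<and> (\<forall>x\<in>carr h. \<phi> (\<iota> x) = \<iota> (f x))"
      using lin der gen by blast
    fix \<psi> assume \<psi>: "Vector_Spaces.linear s s \<psi> \<and> (\<forall>x y. \<psi> (x * y) = \<psi> x * y + x * \<psi> y) \<and> (\<forall>x\<in>carr h. \<psi> (\<iota> x) = \<iota> (f x))"
    then have "\<psi> 1 = \<psi> 1 + \<psi> 1" by (metis mult_1 mult_1_right)
    then have "\<psi> 1 = 0" by simp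
    then show "\<psi> = \<phi>" using \<psi> lin by (intro linear_eqI) (simp_all add: one gen der)
  qed
qed

lemma alg_extension:
  fixes sA :: "'k \<Rightarrow> 'a::ring_1 \<Rightarrow> 'a"
  assumes algA: "is_algebra sA"
    and add: "\<And>x y. x \<in> carr h \<Longrightarrow> y \<in> carr h \<Longrightarrow> f (x + y) = f x + f y"
    and scale: "\<And>c x. x \<in> carr h \<Longrightarrow> f (scl h c x) = sA c (f x)"
    and brk: "\<And>x y. x \<in> carr h \<Longrightarrow> y \<in> carr h \<Longrightarrow> f (brk h x y) = f x * f y - f y * f x"
  shows "Vector_Spaces.linear s sA (alg_extension h s \<iota> sA f)" "alg_extension h s \<iota> sA f 1 = 1"
    "alg_extension h s \<iota> sA f (u * v) = alg_extension h s \<iota> sA f u * alg_extension h s \<iota> sA f v"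
    "x \<in> carr h \<Longrightarrow> alg_extension h s \<iota> sA f (\<iota> x) = f x"
proof -
  interpret A: tens_algebra sA by unfold_locales (rule algA)
  obtain \<phi> where \<phi>: "Vector_Spaces.linear s sA \<phi>" "\<phi> 1 = 1" "\<And>x u. x \<in> carr h \<Longrightarrow> \<phi> (\<iota> x * u) = f x * \<phi> u"
    by (rule module_extension[OF A.vs_s, where M = UNIV and z = 1 and A = "\<lambda>x u. f x * u"])
      (auto simp: add scale brk A.s_mult algebra_simps A.TP.M.subspace_UNIV[simplified])
  have mult: "\<phi> (u * v) = \<phi> u * \<phi> v" for u v
    by (induction u rule: env_induct)
      (simp_all add: \<phi>(2,3) lin_add[OF \<phi>(1)] lin_scale[OF \<phi>(1)] scale_mult A.s_mult ring_distribs mult.assoc)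
  have gen: "\<phi> (\<iota> x) = f x" if "x \<in> carr h" for x using \<phi>(3)[OF that, of 1] \<phi>(2) by simp
  have eq: "alg_extension h s \<iota> sA f = \<phi>" unfolding alg_extension_def
  proof (rule the_equality)
    show "Vector_Spaces.linear s sA \<phi> \<and> \<phi> 1 = 1 \<and> (\<forall>x y. \<phi> (x * y) = \<phi> x * \<phi> y) \<and> (\<forall>x\<in>carr h. \<phi> (\<iota> x) = f x)"
      using \<phi> mult gen by blast
    fix \<psi> assume \<psi>: "Vector_Spaces.linear s sA \<psi> \<and> \<psi> 1 = 1 \<and> (\<forall>x y. \<psi> (x * y) = \<psi> x * \<psi> y) \<and> (\<forall>x\<in>carr h. \<psi> (\<iota> x) = f x)"
    then show "\<psi> = \<phi>" using \<phi> by (intro linear_eqI) simp_all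
  qed
  show "Vector_Spaces.linear s sA (alg_extension h s \<iota> sA f)" "alg_extension h s \<iota> sA f 1 = 1"
    "alg_extension h s \<iota> sA f (u * v) = alg_extension h s \<iota> sA f u * alg_extension h s \<iota> sA f v"
    "x \<in> carr h \<Longrightarrow> alg_extension h s \<iota> sA f (\<iota> x) = f x"
    unfolding eq using \<phi> mult gen by blast+
qed

lemma antipode:
  shows "Vector_Spaces.linear s s (antipode h s \<iota>)" "antipode h s \<iota> 1 = 1"
    "antipode h s \<iota> (u * v) = antipode h s \<iota> v * antipode h s \<iota> u"
    "x \<in> carr h \<Longrightarrow> antipode h s \<iota> (\<iota> x) = - \<iota> x"
proof -
  obtain \<phi> where \<phi>: "Vector_Spaces.linear s s \<phi>" "\<phi> 1 = 1" "\<And>x u. x \<in> carr h \<Longrightarrow> \<phi> (\<iota> x * u) = - (\<phi> u * \<iota> x)"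
    by (rule module_extension[OF vs, where M = UNIV and z = 1 and A = "\<lambda>x u. - (u * \<iota> x)"])
      (auto simp: \<iota>_add \<iota>_scale \<iota>_brk scale_mult algebra_simps V.subspace_UNIV)
  have mult: "\<phi> (u * v) = \<phi> v * \<phi> u" for u v
    by (induction u rule: env_induct)
      (simp_all add: \<phi>(2,3) lin_add[OF \<phi>(1)] lin_scale[OF \<phi>(1)] scale_mult ring_distribs mult.assoc)
  have gen: "\<phi> (\<iota> x) = - \<iota> x" if "x \<in> carr h" for x using \<phi>(3)[OF that, of 1] \<phi>(2) by simp
  have eq: "antipode h s \<iota> = \<phi>" unfolding antipode_def
  proof (rule the_equality)
    show "Vector_Spaces.linear s s \<phi> \<and> \<phi> 1 = 1 \<and> (\<forall>x y. \<phi> (x * y) = \<phi> y * \<phi> x) \<and> (\<forall>x\<in>carr h. \<phi> (\<iota> x) = - \<iota> x)"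
      using \<phi> mult gen by blast
    fix \<psi> assume \<psi>: "Vector_Spaces.linear s s \<psi> \<and> \<psi> 1 = 1 \<and> (\<forall>x y. \<psi> (x * y) = \<psi> y * \<psi> x) \<and> (\<forall>x\<in>carr h. \<psi> (\<iota> x) = - \<iota> x)"
    then show "\<psi> = \<phi>" using \<phi> by (intro linear_eqI) simp_all
  qed
  show "Vector_Spaces.linear s s (antipode h s \<iota>)" "antipode h s \<iota> 1 = 1"
    "antipode h s \<iota> (u * v) = antipode h s \<iota> v * antipode h s \<iota> u"
    "x \<in> carr h \<Longrightarrow> antipode h s \<iota> (\<iota> x) = - \<iota> x"
    unfolding eq using \<phi> mult gen by blast+
qed

abbreviation "\<Delta> \<equiv> coproduct h s \<iota>"

definition "prim x = TA.ten (\<iota> x) 1 + TA.ten 1 (\<iota> x)"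

lemma prim_T [simp]: "prim x \<in> TA.TT"
  by (simp add: prim_def TA.TP.T_add)

lemma prim_ten: "TA.tmult (prim x) (TA.ten u v) = TA.ten (\<iota> x * u) v + TA.ten u (\<iota> x * v)"
  by (simp add: prim_def TA.tmult_add TA.tmult_ten)

lemma coproduct:
  shows "Vector_Spaces.linear s TA.tsc \<Delta>" "\<Delta> u \<in> TA.TT" "\<Delta> 1 = TA.ten 1 1"
    "\<Delta> (u * v) = TA.tmult (\<Delta> u) (\<Delta> v)" "x \<in> carr h \<Longrightarrow> \<Delta> (\<iota> x) = prim x"
proof -
  have brk: "TA.tmult (prim (brk h x y)) T = TA.tmult (prim x) (TA.tmult (prim y) T) - TA.tmult (prim y) (TA.tmult (prim x) T)"
    if "x \<in> carr h" "y \<in> carr h" "T \<in> TA.TT" for x y T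
    using that(3)
  proof (induction T rule: TA.TP.T_induct)
    case (add u v T)
    have "TA.tmult (prim (brk h x y)) (TA.ten u v) = TA.tmult (prim x) (TA.tmult (prim y) (TA.ten u v)) - TA.tmult (prim y) (TA.tmult (prim x) (TA.ten u v))"
      using that by (simp add: prim_ten TA.tmult_add \<iota>_brk left_diff_distrib TA.ten_diff mult.assoc)
    then show ?case using add by (simp add: TA.tmult_add TA.tmult_T)
  qed simp
  obtain \<phi> where \<phi>: "Vector_Spaces.linear s TA.tsc \<phi>" "\<phi> 1 = TA.ten 1 1" "\<And>u. \<phi> u \<in> TA.TT"
      "\<And>x u. x \<in> carr h \<Longrightarrow> \<phi> (\<iota> x * u) = TA.tmult (prim x) (\<phi> u)"
  proof (rule module_extension[OF vs_tensor TA.TP.T_sub TA.ten_T[of 1 1], where A = "\<lambda>x u. TA.tmult (prim x) u"])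
    fix x y T c assume x: "x \<in> carr h" and T: "T \<in> TA.TT"
    have "prim (scl h c x) = TA.tsc c (prim x)"
      using x by (simp add: prim_def \<iota>_scale TA.ten_lin TA.TP.T.scale_right_distrib)
    then show "TA.tmult (prim (scl h c x)) T = TA.tsc c (TA.tmult (prim x) T)"
      using T by (simp add: TA.tmult_scale)
    assume y: "y \<in> carr h"
    have "prim (x + y) = prim x + prim y"
      using x y by (simp add: prim_def \<iota>_add TA.ten_lin)
    then show "TA.tmult (prim (x + y)) T = TA.tmult (prim x) T + TA.tmult (prim y) T"
      using T by (simp add: TA.tmult_add)
  qed (use brk in \<open>simp_all add: TA.tmult_add TA.tmult_scale TA.tmult_T\<close>)
  have mult: "\<phi> (u * v) = TA.tmult (\<phi> u) (\<phi> v)" for u v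
    by (induction u rule: env_induct)
      (simp_all add: \<phi> lin_add[OF \<phi>(1)] lin_scale[OF \<phi>(1)] scale_mult TA.tmult_add TA.tmult_scale TA.tmult_assoc
        TA.tmult_one ring_distribs mult.assoc)
  have gen: "\<phi> (\<iota> x) = prim x" if "x \<in> carr h" for x
    using \<phi>(4)[OF that, of 1] \<phi>(2) by (simp add: TA.tmult_one)
  have eq: "\<Delta> = \<phi>" unfolding coproduct_def Let_def prim_def[symmetric]
  proof (rule the_equality)
    show "Vector_Spaces.linear s TA.tsc \<phi> \<and> (\<forall>x. \<phi> x \<in> TA.TT) \<and> \<phi> 1 = TA.ten 1 1 \<and>
       (\<forall>x y. \<phi> (x * y) = TA.tmult (\<phi> x) (\<phi> y)) \<and> (\<forall>x\<in>carr h. \<phi> (\<iota> x) = prim x)"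
      using \<phi> mult gen by blast
    fix \<psi> assume \<psi>: "Vector_Spaces.linear s TA.tsc \<psi> \<and> (\<forall>x. \<psi> x \<in> TA.TT) \<and> \<psi> 1 = TA.ten 1 1 \<and>
       (\<forall>x y. \<psi> (x * y) = TA.tmult (\<psi> x) (\<psi> y)) \<and> (\<forall>x\<in>carr h. \<psi> (\<iota> x) = prim x)"
    then show "\<psi> = \<phi>" using \<phi> by (intro linear_eqI) simp_all
  qed
  show "Vector_Spaces.linear s TA.tsc \<Delta>" "\<Delta> u \<in> TA.TT" "\<Delta> 1 = TA.ten 1 1"
    "\<Delta> (u * v) = TA.tmult (\<Delta> u) (\<Delta> v)" "x \<in> carr h \<Longrightarrow> \<Delta> (\<iota> x) = prim x"
    unfolding eq using \<phi> mult gen by blast+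
qed

lemma coproduct_gen: "x \<in> carr h \<Longrightarrow> \<Delta> (\<iota> x * u) = TA.tmult (prim x) (\<Delta> u)"
  by (simp add: coproduct)

definition "left_below n = TA.TP.T.span {TA.ten u v | u v. u \<in> filt n}"

lemma left_below_mult: "x \<in> carr h \<Longrightarrow> T \<in> left_below n \<Longrightarrow> TA.tmult (prim x) T \<in> left_below (Suc n)"
proof -
  assume x: "x \<in> carr h" and T: "T \<in> left_below n"
  have "T \<in> TA.TT \<and> TA.tmult (prim x) T \<in> left_below (Suc n)"
    using T unfolding left_below_def
  proof (rule TA.TP.T.span_induct)
    show "TA.TP.T.subspace {T. T \<in> TA.TT \<and> TA.tmult (prim x) T \<in> TA.TP.T.span {TA.ten u v |u v. u \<in> filt (Suc n)}}"
      by (rule TA.TP.T.subspaceI)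
       (auto simp: TA.tmult_add TA.tmult_scale TA.TP.T_add TA.TP.T_zero TA.TP.T_scale TA.TP.T.span_zero TA.TP.T.span_add TA.TP.T.span_scale)
  next
    fix T assume "T \<in> {TA.ten u v |u v. u \<in> filt n}"
    then obtain u v where T: "T = TA.ten u v" "u \<in> filt n" by blast
    then have "TA.ten (\<iota> x * u) v \<in> TA.TP.T.span {TA.ten u v |u v. u \<in> filt (Suc n)}"
      "TA.ten u (\<iota> x * v) \<in> TA.TP.T.span {TA.ten u v |u v. u \<in> filt (Suc n)}"
      using x filt_mult filt_Suc by (intro TA.TP.T.span_base; blast)+
    then show "T \<in> TA.TT \<and> TA.tmult (prim x) T \<in> TA.TP.T.span {TA.ten u v |u v. u \<in> filt (Suc n)}"
      using T by (simp add: prim_ten TA.TP.T.span_add)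
  qed
  then show ?thesis ..
qed

text \<open>The only term of \<open>\<Delta> u\<close> whose first factor has full degree is \<open>u \<otimes> 1\<close>.\<close>

lemma coproduct_left_below: "u \<in> filt (Suc n) \<Longrightarrow> \<Delta> u - TA.ten u 1 \<in> left_below n"
proof (induction n arbitrary: u rule: less_induct)
  case (less n)
  from less.prems show ?case
  proof (induction rule: filt_Suc_induct)
    case (add u v)
    then have "(\<Delta> u - TA.ten u 1) + (\<Delta> v - TA.ten v 1) \<in> left_below n"
      unfolding left_below_def by (rule TA.TP.T.span_add)
    then show ?case by (simp add: lin_add[OF coproduct(1)] TA.ten_lin algebra_simps)
  next
    case (scale c u)
    then have "TA.tsc c (\<Delta> u - TA.ten u 1) \<in> left_below n"
      unfolding left_below_def by (rule TA.TP.T.span_scale)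
    then show ?case by (simp add: lin_scale[OF coproduct(1)] TA.ten_lin TA.TP.T.scale_right_diff_distrib)
  next
    case one
    show ?case by (simp add: coproduct left_below_def TA.TP.T.span_zero)
  next
    case (mult x u)
    show ?case
    proof (cases n)
      case 0
      then have "u = 0" using mult by simp
      then show ?thesis by (simp add: lin_zero[OF coproduct(1)] TA.ten_lin left_below_def TA.TP.T.span_zero)
    next
      case (Suc k)
      have "\<Delta> (\<iota> x * u) - TA.ten (\<iota> x * u) 1 = TA.tmult (prim x) (\<Delta> u - TA.ten u 1) + TA.ten u (\<iota> x)"
        using mult by (simp add: coproduct_gen TA.tmult_diff coproduct prim_ten)
      moreover have "TA.ten u (\<iota> x) \<in> left_below n"
        unfolding left_below_def using mult by (intro TA.TP.T.span_base) blast
      moreover have "TA.tmult (prim x) (\<Delta> u - TA.ten u 1) \<in> left_below n"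
        using mult less.IH[of k u] left_below_mult Suc by blast
      ultimately show ?thesis by (simp add: left_below_def TA.TP.T.span_add)
    qed
  qed
qed

end

text \<open>Here \<open>sU\<close>, \<open>\<iota>U\<close> is \<open>U(g)\<close> and \<open>sW\<close>, \<open>\<iota>W\<close> is \<open>U(g\<^sup>*)\<close>.\<close>

locale semenov = factorizable g N e co r m a b
  for g :: "('k::field_char_0, 'g::ab_group_add) lie" and N e co and r :: "('k, 'g, 'g) tens" and m a b +
  fixes sU :: "'k \<Rightarrow> 'u::ring_1 \<Rightarrow> 'u" and \<iota>U :: "'g \<Rightarrow> 'u"
    and sW :: "'k \<Rightarrow> 'w::ring_1 \<Rightarrow> 'w" and \<iota>W :: "('g \<Rightarrow> 'k) \<Rightarrow> 'w"
  assumes env_U: "enveloping_algebra g sU \<iota>U" and env_W: "enveloping_algebra (dual_lie g r) sW \<iota>W"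
begin

sublocale U: env_lie g sU \<iota>U
  by unfold_locales (simp_all add: env_U univ)

sublocale W: env_lie d sW \<iota>W
  by unfold_locales (simp_all add: env_W brk_d_V)

abbreviation "\<alpha> \<equiv> alpha g r sU \<iota>U sW \<iota>W"

lemma \<iota>U_lin: "\<iota>U (x + y) = \<iota>U x + \<iota>U y" "\<iota>U (scl g c x) = sU c (\<iota>U x)" "\<iota>U (x - y) = \<iota>U x - \<iota>U y"
  "\<iota>U (brk g x y) = \<iota>U x * \<iota>U y - \<iota>U y * \<iota>U x"
  using U.\<iota>_add[of "x - y" y] by (simp_all add: U.\<iota>_add U.\<iota>_scale U.\<iota>_brk univ)

lemma alg_U: "is_algebra sU" and alg_W: "is_algebra sW"
  using env_U env_W by (simp_all add: enveloping_algebra_def)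

text \<open>\<open>\<xi>\<close> is primitive and the antipode reverses products; therefore \<open>\<xi>\<close> acts on \<open>\<Sum> L(w\<^sub>1) S\<^sub>0(R(w\<^sub>2))\<close> through \<open>L\<close>
  on the left and through \<open>- R\<close> on the right.\<close>

lemma alpha:
  shows "Vector_Spaces.linear sW sU \<alpha>" "\<alpha> 1 = 1"
    "\<xi> \<in> V \<Longrightarrow> \<alpha> (\<iota>W \<xi> * u) = \<iota>U (L \<xi>) * \<alpha> u - \<alpha> u * \<iota>U (R \<xi>)"
proof -
  let ?L = "alg_extension d sW \<iota>W sU (\<lambda>\<xi>. \<iota>U (L \<xi>))" and ?R = "alg_extension d sW \<iota>W sU (\<lambda>\<xi>. \<iota>U (R \<xi>))"
  let ?S = "antipode g sU \<iota>U"
  have L: "Vector_Spaces.linear sW sU ?L" "?L 1 = 1" "?L (u * v) = ?L u * ?L v" "\<xi> \<in> V \<Longrightarrow> ?L (\<iota>W \<xi>) = \<iota>U (L \<xi>)" for u v \<xi>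
    by (rule W.alg_extension[OF alg_U]; simp add: L_add L_scale L_brk \<iota>U_lin)+
  have R: "Vector_Spaces.linear sW sU ?R" "?R 1 = 1" "?R (u * v) = ?R u * ?R v" "\<xi> \<in> V \<Longrightarrow> ?R (\<iota>W \<xi>) = \<iota>U (R \<xi>)" for u v \<xi>
    by (rule W.alg_extension[OF alg_U]; simp add: R_add R_scale R_brk \<iota>U_lin)+
  have S: "Vector_Spaces.linear sU sU ?S" "?S 1 = 1" "?S (u * v) = ?S v * ?S u" "?S (\<iota>U x) = - \<iota>U x" for u v x
    by (rule U.antipode; simp add: univ)+
  define M where "M = lift_alg sW (\<lambda>a b. ?L a * ?S (?R b))"
  have bil: "bilinear_on (full sW) (full sW) sU (\<lambda>a b. ?L a * ?S (?R b))"
    by (rule W.TA.bilin_UNIV)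
      (simp_all add: lin_add[OF L(1)] lin_add[OF R(1)] lin_add[OF S(1)] lin_scale[OF L(1)] lin_scale[OF R(1)] lin_scale[OF S(1)]
        U.scale_mult ring_distribs)
  have M: "M 0 = 0" "M (W.TA.ten x y) = ?L x * ?S (?R y)"
    "T \<in> W.TA.TT \<Longrightarrow> T' \<in> W.TA.TT \<Longrightarrow> M (T + T') = M T + M T'" "T \<in> W.TA.TT \<Longrightarrow> M (W.TA.tsc c T) = sU c (M T)" for T T' x y c
    unfolding M_def
    by (simp_all add: W.TA.TP.lift_zero[OF U.vs bil] W.TA.TP.lift_tens[OF U.vs bil] W.TA.TP.lift_add[OF U.vs bil] W.TA.TP.lift_scale[OF U.vs bil])
  have \<alpha>: "\<alpha> u = M (W.\<Delta> u)" for u by (simp add: alpha_def M_def)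
  show "Vector_Spaces.linear sW sU \<alpha>"
    by (rule linearI[OF W.vs U.vs])
      (simp_all add: \<alpha> M W.coproduct lin_add[OF W.coproduct(1)] lin_scale[OF W.coproduct(1)])
  show "\<alpha> 1 = 1" by (simp add: \<alpha> M W.coproduct L R S)
  assume \<xi>: "\<xi> \<in> V"
  have "M (W.TA.tmult (W.prim \<xi>) T) = \<iota>U (L \<xi>) * M T - M T * \<iota>U (R \<xi>)" if "T \<in> W.TA.TT" for T
    using that
  proof (induction T rule: W.TA.TP.T_induct)
    case (add x y T)
    have "M (W.TA.tmult (W.prim \<xi>) (W.TA.ten x y)) = \<iota>U (L \<xi>) * M (W.TA.ten x y) - M (W.TA.ten x y) * \<iota>U (R \<xi>)"
      using \<xi> by (simp add: W.prim_ten M L R S mult.assoc)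
    then show ?case using add by (simp add: W.TA.tmult_add W.TA.tmult_T M algebra_simps)
  qed (simp add: M)
  then show "\<alpha> (\<iota>W \<xi> * u) = \<iota>U (L \<xi>) * \<alpha> u - \<alpha> u * \<iota>U (R \<xi>)"
    using \<xi> by (simp add: \<alpha> W.coproduct_gen W.coproduct(2))
qed

end

section \<open>Polarisation and the bijectivity of \<open>\<alpha>\<close>\<close>

locale semenov_sym = semenov g N e co r m a b sU \<iota>U sW \<iota>W
  for g :: "('k::field_char_0, 'g::ab_group_add) lie" and N e co and r :: "('k, 'g, 'g) tens" and m a b
    and sU :: "'k \<Rightarrow> 'u::ring_1 \<Rightarrow> 'u" and \<iota>U
    and sW :: "'k \<Rightarrow> 'w::ring_1 \<Rightarrow> 'w" and \<iota>W +
  fixes sS :: "'k \<Rightarrow> 's::comm_ring_1 \<Rightarrow> 's" and \<iota>S :: "('g \<Rightarrow> 'k) \<Rightarrow> 's"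
  assumes sym: "symmetric_algebra (dual_lie g r) sS \<iota>S"
begin

abbreviation "d\<^sub>0 \<equiv> d\<lparr>brk := \<lambda>x y. 0\<rparr>"

sublocale S: env_alg d\<^sub>0 sS \<iota>S
  using sym by unfold_locales (simp add: symmetric_algebra_def)

lemma alg_S: "is_algebra sS"
  using S.enveloping by (simp add: enveloping_algebra_def)

lemma \<iota>S_add: "\<xi> \<in> V \<Longrightarrow> \<eta> \<in> V \<Longrightarrow> \<iota>S (\<xi> + \<eta>) = \<iota>S \<xi> + \<iota>S \<eta>"
  and \<iota>S_scale: "\<xi> \<in> V \<Longrightarrow> \<iota>S (scl d c \<xi>) = sS c (\<iota>S \<xi>)"
  using S.\<iota>_add S.\<iota>_scale by simp_all

text \<open>A derivation \<open>\<phi>\<close> corresponds to the algebra morphism \<open>p \<mapsto> (p, \<phi> p)\<close> into the dual numbers over \<open>S\<close>, and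
  this morphism exists by the universal property, applied to pairs.\<close>

lemma S_derivation:
  assumes f_add: "\<And>\<xi> \<eta>. \<xi> \<in> V \<Longrightarrow> \<eta> \<in> V \<Longrightarrow> f (\<xi> + \<eta>) = f \<xi> + f \<eta>"
    and f_scale: "\<And>\<xi> c. \<xi> \<in> V \<Longrightarrow> f (scl d c \<xi>) = sS c (f \<xi>)"
  obtains \<phi> where "Vector_Spaces.linear sS sS \<phi>" "\<phi> 1 = 0"
    "\<And>\<xi> p. \<xi> \<in> V \<Longrightarrow> \<phi> (\<iota>S \<xi> * p) = f \<xi> * p + \<iota>S \<xi> * \<phi> p"
proof -
  define s2 where "s2 c = map_prod (sS c) (sS c)" for c
  have vs2: "vector_space s2"
    by unfold_locales (auto simp: s2_def S.V.scale_left_distrib S.V.scale_right_distrib)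
  interpret S2: vector_space s2 by (rule vs2)
  have zero: "f 0 = 0" "\<iota>S 0 = 0"
    using f_scale[OF V_zero, of 0] \<iota>S_scale[OF V_zero, of 0] by simp_all
  obtain \<Phi> where \<Phi>: "Vector_Spaces.linear sS s2 \<Phi>" "\<Phi> 1 = (1, 0)" 
    "\<And>\<xi> p. \<xi> \<in> carr d\<^sub>0 \<Longrightarrow> \<Phi> (\<iota>S \<xi> * p) = (\<iota>S \<xi> * fst (\<Phi> p), f \<xi> * fst (\<Phi> p) + \<iota>S \<xi> * snd (\<Phi> p))"
    by (rule S.module_extension[OF vs2 S2.subspace_UNIV UNIV_I[of "(1, 0)"],
         where A = "\<lambda>\<xi> z. (\<iota>S \<xi> * fst z, f \<xi> * fst z + \<iota>S \<xi> * snd z)"])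
      (auto simp: zero s2_def f_add f_scale \<iota>S_add \<iota>S_scale S.scale_mult S.V.scale_right_distrib algebra_simps prod_eq_iff)
  have fst: "fst (\<Phi> p) = p" for p
    by (induction p rule: S.env_induct)
      (auto simp: \<Phi>(2,3) lin_add[OF \<Phi>(1)] lin_scale[OF \<Phi>(1)] s2_def)
  show thesis
  proof (rule that[of "\<lambda>p. snd (\<Phi> p)"])
    show "Vector_Spaces.linear sS sS (\<lambda>p. snd (\<Phi> p))"
      by (rule linearI[OF S.vs S.vs]) (simp_all add: lin_add[OF \<Phi>(1)] lin_scale[OF \<Phi>(1)] s2_def)
  qed (simp_all add: \<Phi> fst)
qed

text \<open>The derivation of \<open>S(g\<^sup>*)\<close>, the polynomial functions on \<open>g\<close>, in the constant direction \<open>x\<close>.\<close>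

definition part :: "'g \<Rightarrow> 's \<Rightarrow> 's" where
  "part x = (SOME \<phi>. Vector_Spaces.linear sS sS \<phi> \<and> \<phi> 1 = 0 \<and>
     (\<forall>\<xi>\<in>V. \<forall>p. \<phi> (\<iota>S \<xi> * p) = sS (\<xi> x) p + \<iota>S \<xi> * \<phi> p))"

lemma part: "Vector_Spaces.linear sS sS (part x)" "part x 1 = 0"
  "\<xi> \<in> V \<Longrightarrow> part x (\<iota>S \<xi> * p) = sS (\<xi> x) p + \<iota>S \<xi> * part x p"
proof -
  have "\<exists>\<phi>. Vector_Spaces.linear sS sS \<phi> \<and> \<phi> 1 = 0 \<and>
     (\<forall>\<xi>\<in>V. \<forall>p. \<phi> (\<iota>S \<xi> * p) = sS (\<xi> x) p + \<iota>S \<xi> * \<phi> p)"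
  proof (rule S_derivation[of "\<lambda>\<xi>. sS (\<xi> x) 1"])
    fix \<phi> assume "Vector_Spaces.linear sS sS \<phi>" "\<phi> 1 = 0"
      "\<And>\<xi> p. \<xi> \<in> V \<Longrightarrow> \<phi> (\<iota>S \<xi> * p) = sS (\<xi> x) 1 * p + \<iota>S \<xi> * \<phi> p"
    then show ?thesis by (auto simp: S.scale_mult intro!: exI[of _ \<phi>])
  qed (simp_all add: plus_fun_apply scl_d S.V.scale_left_distrib)
  from someI_ex[OF this] show "Vector_Spaces.linear sS sS (part x)" "part x 1 = 0"
    "\<xi> \<in> V \<Longrightarrow> part x (\<iota>S \<xi> * p) = sS (\<xi> x) p + \<iota>S \<xi> * part x p"
    unfolding part_def[symmetric] by blast+
qed

lemma part_add: "part (x + y) p = part x p + part y p"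
  by (induction p rule: S.env_induct)
    (auto simp: part lin_add[OF part(1)] lin_scale[OF part(1)] V_lin S.V.scale_left_distrib S.V.scale_right_distrib distrib_left add_ac)

lemma part_scale: "part (scl g c x) p = sS c (part x p)"
  by (induction p rule: S.env_induct)
    (auto simp: part lin_add[OF part(1)] lin_scale[OF part(1)] V_lin S.V.scale_right_distrib S.scale_mult mult.commute[of _ c])

lemma is_algebra_field: "is_algebra ((*) :: 'k \<Rightarrow> 'k \<Rightarrow> 'k)"
  by (simp add: is_algebra_def vector_space_field mult_ac)

definition counit :: "'s \<Rightarrow> 'k" where
  "counit = alg_extension d\<^sub>0 sS \<iota>S (*) (\<lambda>_. 0)"

lemma counit: "Vector_Spaces.linear sS (*) counit" "counit 1 = 1" "\<xi> \<in> V \<Longrightarrow> counit (\<iota>S \<xi> * p) = 0"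
  using S.alg_extension[OF is_algebra_field, of "\<lambda>_. 0"] by (simp_all add: counit_def)

text \<open>For \<open>\<xi>\<^sub>1, \<dots>, \<xi>\<^sub>n \<in> g\<^sup>*\<close> the recursion amounts to \<open>sigma sA j n (\<xi>\<^sub>1 \<cdots> \<xi>\<^sub>n) = \<Sum> j \<xi>\<^sub>s\<^sub>1 \<cdots> j \<xi>\<^sub>s\<^sub>n\<close>, summed over the
  permutations \<open>s\<close>, and to \<open>0\<close> on products of any other length. Defining it through the derivations \<open>part\<close>
  makes well-definedness on the quotient \<open>S(g\<^sup>*)\<close> automatic.\<close>

primrec sigma :: "('k \<Rightarrow> 'a::ring_1 \<Rightarrow> 'a) \<Rightarrow> (('g \<Rightarrow> 'k) \<Rightarrow> 'a) \<Rightarrow> nat \<Rightarrow> 's \<Rightarrow> 'a" where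
  "sigma sA j 0 p = sA (counit p) 1"
| "sigma sA j (Suc n) p = (\<Sum>i<N. j (co i) * sigma sA j n (part (e i) p))"

lemma sigma_linear:
  assumes algA: "is_algebra sA"
  shows "Vector_Spaces.linear sS sA (sigma sA j n)"
proof -
  interpret A: tens_algebra sA by unfold_locales (rule algA)
  interpret VA: vector_space sA by (rule A.vs_s)
  have "sigma sA j n (p + q) = sigma sA j n p + sigma sA j n q" for p q
    by (induction n arbitrary: p q)
      (simp_all add: lin_add[OF counit(1)] VA.scale_left_distrib lin_add[OF part(1)] distrib_left sum.distrib)
  moreover have "sigma sA j n (sS c p) = sA c (sigma sA j n p)" for p c
    by (induction n arbitrary: p)
      (simp_all add: lin_scale[OF counit(1)] lin_scale[OF part(1)] A.s_mult VA.scale_sum_right)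
  ultimately show ?thesis by (intro linearI S.vs A.vs_s)
qed

text \<open>Modulo lower degree the \<open>n + 1\<close> positions of \<open>j \<xi>\<close> are equivalent, hence the factor \<open>n + 1\<close>. In the
  induction, \<open>\<partial>\<^sub>i(\<xi> p) = \<xi>(e\<^sub>i) p + \<xi> \<partial>\<^sub>i p\<close>: the first terms add up to \<open>j \<xi>\<close> in first position, the second
  terms contribute \<open>n\<close> more copies once \<open>j \<xi>\<close> has been moved to the front.\<close>

lemma sigma_symbol:
  assumes "env_lie h sA \<iota>A" and J: "\<And>\<xi>. \<xi> \<in> V \<Longrightarrow> J \<xi> \<in> carr h"
    and j_add: "\<And>\<xi> \<eta>. \<xi> \<in> V \<Longrightarrow> \<eta> \<in> V \<Longrightarrow> \<iota>A (J (\<xi> + \<eta>)) = \<iota>A (J \<xi>) + \<iota>A (J \<eta>)"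
    and j_scale: "\<And>\<xi> c. \<xi> \<in> V \<Longrightarrow> \<iota>A (J (scl d c \<xi>)) = sA c (\<iota>A (J \<xi>))"
  defines "j \<equiv> \<lambda>\<xi>. \<iota>A (J \<xi>)"
  shows "sigma sA j n p \<in> degree_below (carr h) sA \<iota>A (Suc n)"
    and "\<xi> \<in> V \<Longrightarrow> sigma sA j (Suc n) (\<iota>S \<xi> * p) - sA (of_nat (Suc n)) (j \<xi> * sigma sA j n p) \<in> degree_below (carr h) sA \<iota>A (Suc n)"
proof -
  interpret A: env_lie h sA \<iota>A by fact
  let ?\<sigma> = "sigma sA j"
  have algA: "is_algebra sA" using A.enveloping by (simp add: enveloping_algebra_def)
  note lin = sigma_linear[OF algA, where j = j]
  have filt: "?\<sigma> n p \<in> A.filt (Suc n)" for n p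
    by (induction n arbitrary: p)
      (auto simp: j_def intro!: A.filt_scale A.filt_one A.filt_sum A.filt_mult J co_V)
  then show "?\<sigma> n p \<in> A.filt (Suc n)" .
  assume \<xi>: "\<xi> \<in> V"
  have j0: "j 0 = 0" using j_scale[OF V_zero, of 0] by (simp add: j_def)
  have j_sum: "(\<Sum>i<N. sA (\<xi> (e i)) (j (co i))) = j \<xi>"
  proof -
    have "j (\<Sum>i\<in>I. scl d (\<xi> (e i)) (co i)) = (\<Sum>i\<in>I. sA (\<xi> (e i)) (j (co i)))" for I :: "nat set"
      by (induction I rule: infinite_finite_induct)
        (use j0 in \<open>auto simp: j_def j_add j_scale co_V V_sum V_scale\<close>)
    from this[of "{..<N}"] show ?thesis unfolding V_expand[OF \<xi>, symmetric] by simp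
  qed
  have rec: "?\<sigma> (Suc n) (\<iota>S \<xi> * p) = j \<xi> * ?\<sigma> n p + (\<Sum>i<N. j (co i) * ?\<sigma> n (\<iota>S \<xi> * part (e i) p))" for n p
  proof -
    have "?\<sigma> (Suc n) (\<iota>S \<xi> * p) = (\<Sum>i<N. sA (\<xi> (e i)) (j (co i))) * ?\<sigma> n p + (\<Sum>i<N. j (co i) * ?\<sigma> n (\<iota>S \<xi> * part (e i) p))"
      using \<xi> by (simp add: part lin_add[OF lin] lin_scale[OF lin] distrib_left sum.distrib A.scale_mult sum_distrib_right)
    then show ?thesis by (simp only: j_sum)
  qed
  show "?\<sigma> (Suc n) (\<iota>S \<xi> * p) - sA (of_nat (Suc n)) (j \<xi> * ?\<sigma> n p) \<in> A.filt (Suc n)"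
  proof (induction n arbitrary: p)
    case 0
    have "?\<sigma> (Suc 0) (\<iota>S \<xi> * p) = j \<xi> * ?\<sigma> 0 p"
      unfolding rec using \<xi> by (simp add: counit)
    then show ?case by (simp add: A.filt_zero del: sigma.simps)
  next
    case (Suc n)
    let ?p = "\<lambda>i. part (e i) p"
    have "?\<sigma> (Suc (Suc n)) (\<iota>S \<xi> * p) - sA (of_nat (Suc (Suc n))) (j \<xi> * ?\<sigma> (Suc n) p) =
       (\<Sum>i<N. j (co i) * ?\<sigma> (Suc n) (\<iota>S \<xi> * ?p i)) - sA (of_nat (Suc n)) (j \<xi> * ?\<sigma> (Suc n) p)"
      unfolding rec of_nat_Suc[of "Suc n"] A.V.scale_left_distrib A.V.scale_one by (simp only: add_diff_add diff_self add_0)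
    also have "\<dots> = (\<Sum>i<N. j (co i) * (?\<sigma> (Suc n) (\<iota>S \<xi> * ?p i) - sA (of_nat (Suc n)) (j \<xi> * ?\<sigma> n (?p i)))
        + sA (of_nat (Suc n)) ((j (co i) * j \<xi> - j \<xi> * j (co i)) * ?\<sigma> n (?p i)))"
      unfolding sigma.simps(2)[of sA j n p] sum_distrib_left A.V.scale_sum_right sum_subtractf[symmetric]
      by (intro sum.cong refl)
        (simp add: right_diff_distrib left_diff_distrib A.scale_mult A.V.scale_right_diff_distrib mult.assoc del: sigma.simps of_nat_Suc)
    also have "\<dots> \<in> A.filt (Suc (Suc n))"
    proof (intro A.filt_sum A.filt_add A.filt_scale)
      fix i
      show "j (co i) * (?\<sigma> (Suc n) (\<iota>S \<xi> * ?p i) - sA (of_nat (Suc n)) (j \<xi> * ?\<sigma> n (?p i))) \<in> A.filt (Suc (Suc n))"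
        unfolding j_def using Suc.IH[of "?p i"] by (intro A.filt_mult J co_V) (simp add: j_def)
      have "(j (co i) * j \<xi> - j \<xi> * j (co i)) * ?\<sigma> n (?p i) = \<iota>A (brk h (J (co i)) (J \<xi>)) * ?\<sigma> n (?p i)"
        unfolding j_def by (simp add: A.\<iota>_brk J co_V \<xi>)
      then show "(j (co i) * j \<xi> - j \<xi> * j (co i)) * ?\<sigma> n (?p i) \<in> A.filt (Suc (Suc n))"
        using filt by (simp add: A.filt_mult A.brk_closed J co_V \<xi>)
    qed
    finally show ?case .
  qed
qed

abbreviation "\<sigma>W \<equiv> sigma sW \<iota>W"
abbreviation "\<sigma>U \<equiv> sigma sU (\<lambda>\<xi>. \<iota>U (\<tau> \<xi>))"

lemma \<iota>W_add: "\<xi> \<in> V \<Longrightarrow> \<eta> \<in> V \<Longrightarrow> \<iota>W (\<xi> + \<eta>) = \<iota>W \<xi> + \<iota>W \<eta>"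
  and \<iota>W_scale: "\<xi> \<in> V \<Longrightarrow> \<iota>W (scl d c \<xi>) = sW c (\<iota>W \<xi>)"
  and \<iota>W_brk: "\<xi> \<in> V \<Longrightarrow> \<eta> \<in> V \<Longrightarrow> \<iota>W (brk d \<xi> \<eta>) = \<iota>W \<xi> * \<iota>W \<eta> - \<iota>W \<eta> * \<iota>W \<xi>"
  using W.\<iota>_add W.\<iota>_scale W.\<iota>_brk by simp_all

lemma \<sigma>W: "\<sigma>W n p \<in> W.filt (Suc n)"
  "\<xi> \<in> V \<Longrightarrow> \<sigma>W (Suc n) (\<iota>S \<xi> * p) - sW (of_nat (Suc n)) (\<iota>W \<xi> * \<sigma>W n p) \<in> W.filt (Suc n)"
  using sigma_symbol[OF W.env_lie_axioms, of "\<lambda>\<xi>. \<xi>"] by (simp_all add: \<iota>W_add \<iota>W_scale del: sigma.simps of_nat_Suc)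

lemma \<sigma>U: "\<sigma>U n p \<in> U.filt (Suc n)"
  "\<xi> \<in> V \<Longrightarrow> \<sigma>U (Suc n) (\<iota>S \<xi> * p) - sU (of_nat (Suc n)) (\<iota>U (\<tau> \<xi>) * \<sigma>U n p) \<in> U.filt (Suc n)"
  using sigma_symbol[OF U.env_lie_axioms, of \<tau>] by (simp_all add: \<iota>U_lin \<tau>_add \<tau>_scale univ del: sigma.simps of_nat_Suc)

lemmas \<sigma>W_lin = sigma_linear[OF alg_W, of \<iota>W]
lemmas \<sigma>U_lin = sigma_linear[OF alg_U, of "\<lambda>\<xi>. \<iota>U (\<tau> \<xi>)"]

lemma W_filt_0 [simp]: "degree_below V sW \<iota>W 0 = {0}"
  using W.filt_0 by simp

definition "symb x = \<iota>S (inv_into V \<tau> x)"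

lemma symb_\<tau>: "\<xi> \<in> V \<Longrightarrow> symb (\<tau> \<xi>) = \<iota>S \<xi>"
  using \<tau>_bij by (simp add: symb_def bij_betw_def)

lemma \<tau>_cases: obtains \<xi> where "\<xi> \<in> V" "x = \<tau> \<xi>"
  using \<tau>_bij by (auto simp: bij_betw_def)

lemma symb_linear: "Vector_Spaces.linear (scl g) sS symb"
proof (rule linearI[OF vs_g S.vs])
  fix x y c
  obtain \<xi> where \<xi>: "\<xi> \<in> V" "x = \<tau> \<xi>" by (rule \<tau>_cases)
  obtain \<eta> where \<eta>: "\<eta> \<in> V" "y = \<tau> \<eta>" by (rule \<tau>_cases)
  show "symb (x + y) = symb x + symb y"
    using \<xi> \<eta> symb_\<tau>[OF V_add[of \<xi> \<eta>]] by (simp add: \<tau>_add symb_\<tau> \<iota>S_add)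
  show "symb (scl g c x) = sS c (symb x)"
    using \<xi> symb_\<tau>[OF V_scale[of \<xi> c]] by (simp add: \<tau>_scale symb_\<tau> \<iota>S_scale)
qed

text \<open>The symbol maps of \<open>U(g)\<close> with values in \<open>S(g\<^sup>*)\<close>, where \<open>g\<close> is identified with \<open>g\<^sup>*\<close> by means of \<open>\<tau>\<close>.\<close>

definition \<pi> :: "nat \<Rightarrow> 'u \<Rightarrow> 's" where
  "\<pi> = (SOME \<pi>. (\<forall>n. Vector_Spaces.linear sU sS (\<pi> n)) \<and> \<pi> 0 1 = 1 \<and> (\<forall>n. \<forall>u\<in>U.filt n. \<pi> n u = 0) \<and>
    (\<forall>n x. \<forall>u\<in>U.filt (Suc n). \<pi> (Suc n) (\<iota>U x * u) = symb x * \<pi> n u))"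

lemma \<pi>: "Vector_Spaces.linear sU sS (\<pi> n)" "\<pi> 0 1 = 1" "u \<in> U.filt n \<Longrightarrow> \<pi> n u = 0"
  "u \<in> U.filt (Suc n) \<Longrightarrow> \<pi> (Suc n) (\<iota>U x * u) = symb x * \<pi> n u"
proof -
  have "\<exists>\<pi>. (\<forall>n. Vector_Spaces.linear sU sS (\<pi> n)) \<and> \<pi> 0 1 = 1 \<and> (\<forall>n. \<forall>u\<in>U.filt n. \<pi> n u = 0) \<and>
    (\<forall>n x. \<forall>u\<in>U.filt (Suc n). \<pi> (Suc n) (\<iota>U x * u) = symb x * \<pi> n u)"
    unfolding univ by (rule enveloping_symbol_maps[OF env_U alg_S symb_linear]) blast
  from someI_ex[OF this] show "Vector_Spaces.linear sU sS (\<pi> n)" "\<pi> 0 1 = 1" "u \<in> U.filt n \<Longrightarrow> \<pi> n u = 0"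
    "u \<in> U.filt (Suc n) \<Longrightarrow> \<pi> (Suc n) (\<iota>U x * u) = symb x * \<pi> n u"
    unfolding \<pi>_def[symmetric] by blast+
qed

lemma \<pi>_right:
  assumes "u \<in> U.filt (Suc n)"
  shows "\<pi> (Suc n) (u * \<iota>U x) = symb x * \<pi> n u"
proof -
  have "\<pi> (Suc n) (\<iota>U x * u - u * \<iota>U x) = 0"
    using U.filt_commute[of x u "Suc n"] assms by (simp add: \<pi>(3) univ)
  then show ?thesis using assms by (simp add: lin_diff[OF \<pi>(1)] \<pi>(4))
qed

lemma \<alpha>_filt: "u \<in> W.filt n \<Longrightarrow> \<alpha> u \<in> U.filt n"
proof (induction n arbitrary: u)
  case 0
  then show ?case by (simp add: lin_zero[OF alpha(1)])
next
  case (Suc n)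
  from Suc.prems show ?case
  proof (induction rule: W.filt_Suc_induct)
    case (mult \<xi> u)
    have "\<iota>U (L \<xi>) * \<alpha> u \<in> U.filt (Suc n)" "\<alpha> u * \<iota>U (R \<xi>) \<in> U.filt (Suc n)"
      using Suc.IH[OF mult(2)] by (intro U.filt_mult U.filt_mult_right; simp add: univ)+
    then show ?case using mult U.filt_diff by (simp add: alpha)
  qed (auto simp: lin_add[OF alpha(1)] lin_scale[OF alpha(1)] alpha(2) intro: U.filt_add U.filt_scale U.filt_one)
qed

text \<open>\<open>\<tau> \<xi> \<cdot> v = (L \<xi> \<cdot> v - v \<cdot> R \<xi>) - [R \<xi>, v]\<close>: the first part is the image of \<open>\<xi> u\<close> if \<open>v = \<alpha> u\<close>, and the commutator
  has the degree of \<open>v\<close>.\<close>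

lemma \<alpha>_onto_filt: "v \<in> U.filt n \<Longrightarrow> \<exists>u\<in>W.filt n. \<alpha> u = v"
proof (induction n arbitrary: v)
  case 0
  then show ?case by (simp add: lin_zero[OF alpha(1)])
next
  case (Suc n)
  from Suc.prems show ?case
  proof (induction rule: U.filt_Suc_induct)
    case (add u v)
    then show ?case by (metis W.filt_add lin_add[OF alpha(1)])
  next
    case (scale c u)
    then show ?case by (metis W.filt_scale lin_scale[OF alpha(1)])
  next
    case one
    show ?case using W.filt_one alpha(2) by blast
  next
    case (mult x v)
    obtain \<xi> where \<xi>: "\<xi> \<in> V" "x = \<tau> \<xi>" by (rule \<tau>_cases)
    obtain u where u: "u \<in> W.filt n" "\<alpha> u = v" using Suc.IH mult by blast
    have "\<iota>U (R \<xi>) * v - v * \<iota>U (R \<xi>) \<in> U.filt n"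
      using mult U.filt_commute[of "R \<xi>" v n] by (simp add: univ)
    then obtain u' where u': "u' \<in> W.filt n" "\<alpha> u' = \<iota>U (R \<xi>) * v - v * \<iota>U (R \<xi>)" using Suc.IH by blast
    have "\<iota>U (L \<xi>) = \<iota>U x + \<iota>U (R \<xi>)" by (simp add: \<xi>(2) \<tau>_def \<iota>U_lin)
    then have "\<alpha> (\<iota>W \<xi> * u - u') = \<iota>U x * v"
      using \<xi>(1) u u' by (simp add: lin_diff[OF alpha(1)] alpha algebra_simps)
    moreover have "\<iota>W \<xi> * u - u' \<in> W.filt (Suc n)"
      using \<xi> u u' by (intro W.filt_diff W.filt_mult W.filt_Suc) simp_all
    ultimately show ?case by blast
  qed
qed

lemma \<pi>_\<alpha>:
  assumes "u \<in> W.filt (Suc n)" "\<xi> \<in> V"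
  shows "\<pi> (Suc n) (\<alpha> (\<iota>W \<xi> * u)) = \<iota>S \<xi> * \<pi> n (\<alpha> u)"
proof -
  have "\<alpha> u \<in> U.filt (Suc n)" using assms \<alpha>_filt by blast
  then have "\<pi> (Suc n) (\<alpha> (\<iota>W \<xi> * u)) = (symb (L \<xi>) - symb (R \<xi>)) * \<pi> n (\<alpha> u)"
    using assms by (simp add: alpha lin_diff[OF \<pi>(1)] \<pi>(4) \<pi>_right left_diff_distrib)
  also have "symb (L \<xi>) - symb (R \<xi>) = \<iota>S \<xi>"
    using symb_\<tau>[OF assms(2)] by (simp add: \<tau>_def lin_diff[OF symb_linear])
  finally show ?thesis .
qed

text \<open>On symbols, polarisation inverts the symbol map up to the factor \<open>n!\<close>. In particular an element of
  degree at most \<open>n\<close> that is killed by \<open>\<alpha>\<close> has degree less than \<open>n\<close>, which yields injectivity.\<close>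

lemma \<sigma>W_\<pi>: "u \<in> W.filt (Suc n) \<Longrightarrow> \<sigma>W n (\<pi> n (\<alpha> u)) - sW (fact n) u \<in> W.filt n"
proof (induction n arbitrary: u rule: less_induct)
  case (less n)
  let ?f = "\<lambda>u. \<sigma>W n (\<pi> n (\<alpha> u)) - sW (fact n) u"
  note lin = \<sigma>W_lin \<pi>(1) alpha(1)
  from less.prems show ?case
  proof (induction rule: W.filt_Suc_induct)
    case (add u v)
    then have "?f u + ?f v \<in> W.filt n" by (rule W.filt_add)
    then show ?case by (simp add: lin[THEN lin_add] W.V.scale_right_distrib add_diff_add del: sigma.simps fact_Suc)
  next
    case (scale c u)
    then have "sW c (?f u) \<in> W.filt n" by (rule W.filt_scale)
    then show ?case
      by (simp add: lin[THEN lin_scale] W.V.scale_right_diff_distrib mult.commute del: sigma.simps fact_Suc)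
  next
    case one
    show ?case
    proof (cases n)
      case 0
      then show ?thesis by (simp add: alpha \<pi> counit)
    next
      case (Suc k)
      have "\<pi> n 1 = 0" using U.filt_one \<pi>(3) Suc by blast
      then have "\<sigma>W n (\<pi> n (\<alpha> 1)) = 0" by (simp add: alpha lin_zero[OF \<sigma>W_lin] del: sigma.simps)
      then show ?thesis using W.filt_diff[OF W.filt_zero W.filt_scale[OF W.filt_one[of k]]] Suc by (simp del: sigma.simps)
    qed
  next
    case (mult \<xi> u)
    then have \<xi>: "\<xi> \<in> V" by simp
    show ?case
    proof (cases n)
      case 0
      then have "u = 0" using mult by simp
      then show ?thesis using W.filt_zero by (simp add: lin[THEN lin_zero] del: sigma.simps carr_d)
    next
      case (Suc k)
      let ?p = "\<pi> k (\<alpha> u)" and ?k = "of_nat (Suc k)"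
      have u: "u \<in> W.filt (Suc k)" using mult Suc by simp
      have "sW ?k (\<iota>W \<xi> * (\<sigma>W k ?p - sW (fact k) u)) \<in> W.filt (Suc k)"
        using mult u less.IH[of k u] Suc by (intro W.filt_scale W.filt_mult) simp_all
      from \<sigma>W(2)[OF \<xi>] this have "(\<sigma>W (Suc k) (\<iota>S \<xi> * ?p) - sW ?k (\<iota>W \<xi> * \<sigma>W k ?p)) + sW ?k (\<iota>W \<xi> * (\<sigma>W k ?p - sW (fact k) u)) \<in> W.filt (Suc k)"
        by (rule W.filt_add)
      also have "(\<sigma>W (Suc k) (\<iota>S \<xi> * ?p) - sW ?k (\<iota>W \<xi> * \<sigma>W k ?p)) + sW ?k (\<iota>W \<xi> * (\<sigma>W k ?p - sW (fact k) u))
         = \<sigma>W (Suc k) (\<iota>S \<xi> * ?p) - sW (fact (Suc k)) (\<iota>W \<xi> * u)"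
        by (simp add: right_diff_distrib W.scale_mult W.V.scale_right_diff_distrib del: sigma.simps)
      finally show ?thesis unfolding Suc by (simp only: \<pi>_\<alpha>[OF u \<xi>])
    qed
  qed
qed

lemma \<alpha>_kernel: "\<alpha> u = 0 \<Longrightarrow> u = 0"
proof -
  assume \<alpha>: "\<alpha> u = 0"
  have "u = 0" if "u \<in> W.filt n" for n
    using that
  proof (induction n)
    case (Suc n)
    have "- sW (fact n) u \<in> W.filt n"
      using \<sigma>W_\<pi>[OF Suc.prems] by (simp add: \<alpha> lin_zero[OF \<pi>(1)] lin_zero[OF \<sigma>W_lin])
    then have "sW (- inverse (fact n)) (- sW (fact n) u) \<in> W.filt n" by (rule W.filt_scale)
    then show ?case using Suc.IH by simp
  qed simp
  then show "u = 0" using W.filt_exhaust by blast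
qed

lemma \<alpha>_bij: "bij \<alpha>"
proof (rule bijI)
  show "inj \<alpha>"
  proof (rule injI)
    fix u v assume "\<alpha> u = \<alpha> v"
    then have "\<alpha> (u - v) = 0" by (simp add: lin_diff[OF alpha(1)])
    then show "u = v" using \<alpha>_kernel by fastforce
  qed
  show "surj \<alpha>"
    using \<alpha>_onto_filt U.filt_exhaust by (metis surjI surj_def)
qed

lemma \<alpha>_filt_iff: "\<alpha> u \<in> U.filt n \<longleftrightarrow> u \<in> W.filt n"
  using \<alpha>_filt \<alpha>_onto_filt \<alpha>_bij by (metis bij_def injD)

end

section \<open>The adjoint action on \<open>U(g\<^sup>*)\<close> and the subalgebra \<open>C\<^sub>1\<close>\<close>

context semenov_sym
begin

lemma center_iff: "z \<in> center \<longleftrightarrow> (\<forall>x. \<iota>U x * z = z * \<iota>U x)"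
proof
  assume "z \<in> center"
  then show "\<forall>x. \<iota>U x * z = z * \<iota>U x" by (simp add: center_def)
next
  assume z: "\<forall>x. \<iota>U x * z = z * \<iota>U x"
  have "z * u = u * z" for u
  proof (induction u rule: U.env_induct)
    case (mult x u)
    have "z * (\<iota>U x * u) = \<iota>U x * (z * u)" using z by (metis mult.assoc)
    then show ?case using mult by (simp add: mult.assoc)
  qed (simp_all add: distrib_left distrib_right U.scale_mult)
  then show "z \<in> center" by (simp add: center_def)
qed

text \<open>The adjoint action of \<open>g\<close> on \<open>U(g)\<close>, transported along \<open>\<alpha>\<close>. In terms of the double it is the action of \<open>g\<close>
  on the module induced from the trivial representation of \<open>g\<close>.\<close>

definition "ad_W x u = inv \<alpha> (\<iota>U x * \<alpha> u - \<alpha> u * \<iota>U x)"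

lemma \<alpha>_ad_W: "\<alpha> (ad_W x u) = \<iota>U x * \<alpha> u - \<alpha> u * \<iota>U x"
  unfolding ad_W_def by (rule surj_f_inv_f) (use \<alpha>_bij in \<open>simp add: bij_def\<close>)

lemma \<alpha>_eqI: "\<alpha> u = \<alpha> v \<Longrightarrow> u = v"
  using \<alpha>_bij by (auto simp: bij_def dest: injD)

lemma ad_W_add: "ad_W (x + y) u = ad_W x u + ad_W y u" "ad_W x (u + v) = ad_W x u + ad_W x v"
  and ad_W_scale: "ad_W (scl g c x) u = sW c (ad_W x u)" "ad_W x (sW c u) = sW c (ad_W x u)"
  and ad_W_zero: "ad_W 0 u = 0"
  and ad_W_one: "ad_W x 1 = 0"
proof -
  show "ad_W (x + y) u = ad_W x u + ad_W y u" "ad_W x (u + v) = ad_W x u + ad_W x v"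
    by (rule \<alpha>_eqI; simp add: \<alpha>_ad_W lin_add[OF alpha(1)] \<iota>U_lin algebra_simps)+
  show sc: "ad_W (scl g c x) u = sW c (ad_W x u)" "ad_W x (sW c u) = sW c (ad_W x u)" for c
    by (rule \<alpha>_eqI; simp add: \<alpha>_ad_W lin_scale[OF alpha(1)] \<iota>U_lin U.scale_mult U.V.scale_right_diff_distrib)+
  show "ad_W 0 u = 0" using ad_W_def sc(1)[of 0] by (metis G.scale_zero_left W.V.scale_zero_left \<alpha>_eqI \<alpha>_ad_W lin_scale[OF alpha(1)] \<iota>U_lin(2))
  show "ad_W x 1 = 0" by (rule \<alpha>_eqI) (simp add: \<alpha>_ad_W alpha lin_zero[OF alpha(1)])
qed

lemma ad_W_mult:
  assumes \<xi>: "\<xi> \<in> V"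
  shows "ad_W x (\<iota>W \<xi> * u) = \<iota>W (ad_star x \<xi>) * u + ad_W (dress x \<xi>) u + \<iota>W \<xi> * ad_W x u"
proof (rule \<alpha>_eqI)
  have L: "\<iota>U x * \<iota>U (L \<xi>) - \<iota>U (L \<xi>) * \<iota>U x = \<iota>U (dress x \<xi>) + \<iota>U (L (ad_star x \<xi>))"
    unfolding dress_def by (simp add: \<iota>U_lin)
  have R: "\<iota>U x * \<iota>U (R \<xi>) - \<iota>U (R \<xi>) * \<iota>U x = \<iota>U (dress x \<xi>) + \<iota>U (R (ad_star x \<xi>))"
    unfolding dress_R[OF \<xi>] by (simp add: \<iota>U_lin)
  have "\<alpha> (ad_W x (\<iota>W \<xi> * u)) = (\<iota>U x * \<iota>U (L \<xi>) - \<iota>U (L \<xi>) * \<iota>U x) * \<alpha> u - \<alpha> u * (\<iota>U x * \<iota>U (R \<xi>) - \<iota>U (R \<xi>) * \<iota>U x)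
     + (\<iota>U (L \<xi>) * (\<iota>U x * \<alpha> u - \<alpha> u * \<iota>U x) - (\<iota>U x * \<alpha> u - \<alpha> u * \<iota>U x) * \<iota>U (R \<xi>))"
    using \<xi> by (simp add: \<alpha>_ad_W alpha algebra_simps)
  also have "\<dots> = \<alpha> (\<iota>W (ad_star x \<xi>) * u + ad_W (dress x \<xi>) u + \<iota>W \<xi> * ad_W x u)"
    unfolding L R using \<xi> by (simp add: lin_add[OF alpha(1)] \<alpha>_ad_W alpha ad_star_V algebra_simps)
  finally show "\<alpha> (ad_W x (\<iota>W \<xi> * u)) = \<alpha> (\<iota>W (ad_star x \<xi>) * u + ad_W (dress x \<xi>) u + \<iota>W \<xi> * ad_W x u)" .
qed

lemma ad_W_linear: "Vector_Spaces.linear sW sW (ad_W x)"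
  by (intro linearI W.vs ad_W_add ad_W_scale)

abbreviation "D \<equiv> der_extension d sW \<iota>W (dual_D g r)"

text \<open>Since \<open>dress\<close> vanishes at \<open>h\<^sub>r\<close>, the operator \<open>ad_W\<close> of a multiple of \<open>h\<^sub>r\<close> satisfies the Leibniz rule.\<close>

lemma D_eq: "D = ad_W (scl g (1 / 2) h\<^sub>r)"
  and D_mult: "\<xi> \<in> V \<Longrightarrow> D (\<iota>W \<xi> * u) = \<iota>W (dual_D g r \<xi>) * u + \<iota>W \<xi> * D u"
proof -
  let ?x = "scl g (1 / 2) h\<^sub>r"
  have rec: "ad_W ?x (\<iota>W \<xi> * u) = \<iota>W (dual_D g r \<xi>) * u + \<iota>W \<xi> * ad_W ?x u" if "\<xi> \<in> V" for \<xi> u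
  proof -
    have "ad_W ?x (\<iota>W \<xi> * u) = sW (1 / 2) (\<iota>W (ad_star h\<^sub>r \<xi>) * u + ad_W 0 u + \<iota>W \<xi> * ad_W h\<^sub>r u)"
      using that by (simp add: ad_W_scale ad_W_mult dress_h\<^sub>r)
    then show ?thesis
      using that by (simp add: ad_W_zero ad_W_scale W.V.scale_right_distrib dual_D_eq \<iota>W_scale ad_star_V W.scale_mult)
  qed
  show eq: "D = ad_W ?x"
    by (rule W.der_extension_eq(1)[OF ad_W_linear ad_W_one]) (simp add: rec)
  show "\<xi> \<in> V \<Longrightarrow> D (\<iota>W \<xi> * u) = \<iota>W (dual_D g r \<xi>) * u + \<iota>W \<xi> * D u"
    unfolding eq by (rule rec)
qed

abbreviation "ten \<equiv> W.TA.ten"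
abbreviation "TT \<equiv> W.TA.TT"
abbreviation "tsc \<equiv> W.TA.tsc"
abbreviation tmul (infixl "\<odot>" 70) where "tmul \<equiv> tens_mult sW"
abbreviation "\<Delta> \<equiv> W.\<Delta>"
abbreviation "prim \<equiv> W.prim"

definition "delta \<xi> = (\<Sum>i<N. ten (\<iota>W (ad_star (e i) \<xi>)) (\<iota>W (co i)))"

lemma delta_T: "delta \<xi> \<in> TT"
  unfolding delta_def by (intro W.TA.TP.T_sum W.TA.ten_T)

lemma delta_eq:
  assumes "\<xi> \<in> V"
  shows "lift d d (\<lambda>m n. ten (\<iota>W m) (\<iota>W n)) (dual_cobracket g r \<xi>) = delta \<xi>"
proof -
  have "bilinear_on d d tsc (\<lambda>m n. ten (\<iota>W m) (\<iota>W n))"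
    by (rule bilinear_onI) (simp_all add: \<iota>W_add \<iota>W_scale W.TA.ten_lin)
  then show ?thesis
    unfolding dual_cobracket_eq[OF assms] delta_def
    by (rule TD.lift_sum_tens[OF vs_tensor]) (use assms in \<open>simp_all add: ad_star_V co_V\<close>)
qed

lemma \<iota>W_sum:
  "(\<And>i. i \<in> I \<Longrightarrow> f i \<in> V) \<Longrightarrow> \<iota>W (\<Sum>i\<in>I. scl d (c i) (f i)) = (\<Sum>i\<in>I. sW (c i) (\<iota>W (f i)))"
  using \<iota>W_scale[OF V_zero, of 0]
  by (induction I rule: infinite_finite_induct) (auto simp: \<iota>W_add \<iota>W_scale V_scale V_sum)

text \<open>The cobracket is antisymmetric, so multiplying its two factors in the opposite order changes the sign
  of the product, which is \<open>D \<xi>\<close>.\<close>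

lemma dual_D_commuted:
  assumes \<xi>: "\<xi> \<in> V"
  shows "(\<Sum>i<N. \<iota>W (co i) * \<iota>W (ad_star (e i) \<xi>)) = - \<iota>W (dual_D g r \<xi>)"
proof -
  let ?p = "\<Sum>i<N. \<iota>W (co i) * \<iota>W (ad_star (e i) \<xi>)" and ?q = "\<Sum>i<N. \<iota>W (ad_star (e i) \<xi>) * \<iota>W (co i)"
  have ad: "\<iota>W (ad_star (e i) \<xi>) = (\<Sum>j<N. sW (- \<xi> (brk g (e i) (e j))) (\<iota>W (co j)))" for i
  proof -
    have "ad_star (e i) \<xi> = (\<Sum>j<N. scl d (ad_star (e i) \<xi> (e j)) (co j))"
      by (rule V_expand[OF ad_star_V[OF \<xi>]])
    then have "\<iota>W (ad_star (e i) \<xi>) = (\<Sum>j<N. sW (ad_star (e i) \<xi> (e j)) (\<iota>W (co j)))"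
      using \<iota>W_sum[of "{..<N}" co] co_V by metis
    then show ?thesis by (simp add: coad_def)
  qed
  have "?q = (\<Sum>i<N. \<Sum>j<N. sW (- \<xi> (brk g (e i) (e j))) (\<iota>W (co j) * \<iota>W (co i)))"
    by (simp only: ad sum_distrib_right W.scale_mult)
  also have "\<dots> = (\<Sum>j<N. \<Sum>i<N. sW (- \<xi> (brk g (e i) (e j))) (\<iota>W (co j) * \<iota>W (co i)))"
    by (rule sum.swap)
  also have "\<dots> = - (\<Sum>j<N. \<Sum>i<N. sW (- \<xi> (brk g (e j) (e i))) (\<iota>W (co j) * \<iota>W (co i)))"
  proof -
    have "- \<xi> (brk g (e i) (e j)) = - (- \<xi> (brk g (e j) (e i)))" for i j
      using \<xi> brk_anti[of "e i" "e j"] by (simp add: V_lin)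
    then have "sW (- \<xi> (brk g (e i) (e j))) u = - sW (- \<xi> (brk g (e j) (e i))) u" for i j u
      by (metis W.V.scale_minus_left)
    then show ?thesis unfolding sum_negf[symmetric] by (intro sum.cong refl) 
  qed
  also have "\<dots> = - ?p"
    by (simp only: ad sum_distrib_left W.scale_mult)
  finally have q: "?q = - ?p" .
  have "\<iota>W (dual_D g r \<xi>) = sW (1/2) (\<iota>W (\<Sum>i<N. scl d 1 (brk d (ad_star (e i) \<xi>) (co i))))"
    unfolding dual_D_sum[OF \<xi>] using \<xi> by (subst \<iota>W_scale) (auto intro!: V_sum brk_d_V ad_star_V co_V)
  also have "\<dots> = sW (1/2) (?q - ?p)"
    using \<xi> by (subst \<iota>W_sum) (auto simp: \<iota>W_brk brk_d_V ad_star_V co_V sum_subtractf)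
  also have "\<dots> = - ?p"
  proof -
    have "sW (1/2) (- ?p - ?p) = - (sW (1/2) ?p + sW (1/2) ?p)"
      by (simp only: W.V.scale_right_diff_distrib W.V.scale_right_distrib W.V.scale_minus_right minus_add_distrib diff_conv_add_uminus)
    then show ?thesis unfolding q W.V.scale_left_distrib[symmetric] by simp
  qed
  finally show ?thesis by simp
qed

text \<open>This is going to be \<open>\<delta> - (id \<otimes> D) \<circ> \<Delta>\<close>, see \<open>copoisson_eq\<close>.\<close>

definition "defect u = (\<Sum>i<N. ten 1 (\<iota>W (co i)) \<odot> \<Delta> (ad_W (e i) u))"

lemma defect_T: "defect u \<in> TT"
  unfolding defect_def by (intro W.TA.TP.T_sum W.TA.tmult_T W.coproduct W.TA.ten_T)

lemma defect_linear: "Vector_Spaces.linear sW tsc defect"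
  by (rule linearI[OF W.vs vs_tensor])
    (simp_all add: defect_def ad_W_add ad_W_scale lin_add[OF W.coproduct(1)] lin_scale[OF W.coproduct(1)]
      W.TA.tmult_add W.TA.tmult_scale W.coproduct(2) sum.distrib W.TA.TP.T.scale_sum_right)

lemma defect_one: "defect 1 = 0"
  by (simp add: defect_def ad_W_one lin_zero[OF W.coproduct(1)])

text \<open>Expand \<open>ad_W (e i) (\<xi> u)\<close> into its three terms. The coadjoint terms yield \<open>delta \<xi>\<close> and, through the second
  summand of a primitive element, the product \<open>\<Sum> e\<^sup>i ad\<^sup>*(e\<^sub>i) \<xi> = - D \<xi>\<close>. Moving \<open>prim \<xi>\<close> to the front
  in the third terms produces \<open>- (1 \<otimes> [\<xi>, e\<^sup>i])\<close>, and this cancels the terms with \<open>dress\<close>, since \<open>dress\<close> is the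
  transpose of the bracket with \<open>\<xi>\<close>.\<close>

lemma defect_mult:
  assumes \<xi>: "\<xi> \<in> V"
  shows "defect (\<iota>W \<xi> * u) = delta \<xi> \<odot> \<Delta> u - ten 1 (\<iota>W (dual_D g r \<xi>)) \<odot> \<Delta> u + prim \<xi> \<odot> defect u"
proof -
  note T = W.coproduct(2) W.TA.ten_T W.prim_T W.TA.tmult_T
  let ?c = "\<lambda>i. \<iota>W (co i)"
  have "defect (\<iota>W \<xi> * u) = (\<Sum>i<N. ten 1 (?c i) \<odot> prim (ad_star (e i) \<xi>) \<odot> \<Delta> u) + (\<Sum>i<N. ten 1 (?c i) \<odot> \<Delta> (ad_W (dress (e i) \<xi>) u))
     + (\<Sum>i<N. ten 1 (?c i) \<odot> prim \<xi> \<odot> \<Delta> (ad_W (e i) u))"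
    using \<xi> by (simp add: defect_def ad_W_mult lin_add[OF W.coproduct(1)] W.coproduct_gen ad_star_V W.TA.tmult_add T W.TA.TP.T_add
       W.TA.tmult_assoc sum.distrib)
  moreover have "(\<Sum>i<N. ten 1 (?c i) \<odot> prim (ad_star (e i) \<xi>) \<odot> \<Delta> u) = delta \<xi> \<odot> \<Delta> u - ten 1 (\<iota>W (dual_D g r \<xi>)) \<odot> \<Delta> u"
  proof -
    have "(\<Sum>i<N. ten 1 (?c i) \<odot> prim (ad_star (e i) \<xi>)) = delta \<xi> + ten 1 (\<Sum>i<N. ?c i * \<iota>W (ad_star (e i) \<xi>))"
      by (simp add: W.prim_def W.TA.tmult_add W.TA.tmult_ten sum.distrib delta_def W.TA.ten_sum)
    also have "\<dots> = delta \<xi> - ten 1 (\<iota>W (dual_D g r \<xi>))"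
      by (simp add: dual_D_commuted \<xi> W.TA.ten_neg)
    finally have "(\<Sum>i<N. ten 1 (?c i) \<odot> prim (ad_star (e i) \<xi>)) \<odot> \<Delta> u = (delta \<xi> - ten 1 (\<iota>W (dual_D g r \<xi>))) \<odot> \<Delta> u"
      by simp
    then show ?thesis by (simp add: W.TA.tmult_sum W.TA.tmult_diff T delta_T)
  qed
  moreover have "(\<Sum>i<N. ten 1 (?c i) \<odot> prim \<xi> \<odot> \<Delta> (ad_W (e i) u)) =
     prim \<xi> \<odot> defect u - (\<Sum>i<N. ten 1 (\<iota>W (brk d \<xi> (co i))) \<odot> \<Delta> (ad_W (e i) u))"
  proof -
    have c: "ten 1 (?c i) \<odot> prim \<xi> = prim \<xi> \<odot> ten 1 (?c i) - ten 1 (\<iota>W (brk d \<xi> (co i)))" for i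
      using \<xi> by (simp add: W.prim_def W.TA.tmult_add W.TA.tmult_ten \<iota>W_brk co_V W.TA.ten_diff)
    show ?thesis unfolding c defect_def
      by (simp add: W.TA.tmult_diff W.TA.tmult_sum W.TA.tmult_assoc T sum_subtractf)
  qed
  moreover have "(\<Sum>i<N. ten 1 (\<iota>W (brk d \<xi> (co i))) \<odot> \<Delta> (ad_W (e i) u)) = (\<Sum>i<N. ten 1 (?c i) \<odot> \<Delta> (ad_W (dress (e i) \<xi>) u))"
    by (rule canonical_transpose[OF vs_tensor, where A = "brk d \<xi>" and A' = "\<lambda>x. dress x \<xi>"
          and B = "\<lambda>\<eta> x. ten 1 (\<iota>W \<eta>) \<odot> \<Delta> (ad_W x u)"])
      (use \<xi> in \<open>simp_all add: \<iota>W_add \<iota>W_scale W.TA.ten_lin W.TA.tmult_add W.TA.tmult_scale T ad_W_add ad_W_scale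
        lin_add[OF W.coproduct(1)] lin_scale[OF W.coproduct(1)] brk_d_V dress_pairing\<close>)
  ultimately show ?thesis by simp
qed

definition "idD = lift_alg sW (\<lambda>a b. ten a (D b))"

lemma idD:
  shows "T \<in> TT \<Longrightarrow> T' \<in> TT \<Longrightarrow> idD (T + T') = idD T + idD T'" "T \<in> TT \<Longrightarrow> idD (tsc c T) = tsc c (idD T)"
    "idD 0 = 0" "idD (ten x y) = ten x (D y)" "T \<in> TT \<Longrightarrow> idD T \<in> TT"
proof -
  have b: "bilinear_on (full sW) (full sW) tsc (\<lambda>a b. ten a (D b))"
    by (rule W.TA.bilin_UNIV) (simp_all add: D_eq ad_W_add ad_W_scale W.TA.ten_lin W.TA.TP.T.scale_right_distrib mult.commute)
  show "T \<in> TT \<Longrightarrow> T' \<in> TT \<Longrightarrow> idD (T + T') = idD T + idD T'" "T \<in> TT \<Longrightarrow> idD (tsc c T) = tsc c (idD T)"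
    "idD 0 = 0" "idD (ten x y) = ten x (D y)" "T \<in> TT \<Longrightarrow> idD T \<in> TT"
    unfolding idD_def
    by (simp_all add: W.TA.TP.lift_add[OF vs_tensor b] W.TA.TP.lift_scale[OF vs_tensor b] W.TA.TP.lift_zero[OF vs_tensor b]
      W.TA.TP.lift_tens[OF vs_tensor b] W.TA.TP.lift_closed[OF vs_tensor b W.TA.TP.T_sub])
qed

lemma idD_prim:
  assumes \<xi>: "\<xi> \<in> V" and T: "T \<in> TT"
  shows "idD (prim \<xi> \<odot> T) = ten 1 (\<iota>W (dual_D g r \<xi>)) \<odot> T + prim \<xi> \<odot> idD T"
  using T
proof (induction T rule: W.TA.TP.T_induct)
  case (add x y T)
  have "idD (prim \<xi> \<odot> ten x y) = ten 1 (\<iota>W (dual_D g r \<xi>)) \<odot> ten x y + prim \<xi> \<odot> idD (ten x y)"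
    using \<xi> by (simp add: W.prim_ten idD W.TA.TP.T_add D_mult W.TA.ten_lin W.TA.tmult_ten)
  then show ?case using add by (simp add: W.TA.tmult_add W.TA.tmult_T idD algebra_simps)
qed (simp add: idD W.TA.TP.T_zero)

text \<open>The right-hand side satisfies the defining conditions of the co-Poisson map: the terms containing \<open>D \<xi>\<close> in
  the recursions of its two summands cancel. Existence of the co-Poisson map, that is, the cocycle condition
  for \<open>g\<^sup>*\<close>, follows at the same time.\<close>

lemma copoisson_eq: "copoisson g r sW \<iota>W u = defect u + idD (\<Delta> u)"
proof -
  define \<phi> where "\<phi> u = defect u + idD (\<Delta> u)" for u
  note T = W.coproduct(2) W.TA.ten_T W.prim_T W.TA.tmult_T delta_T
  have lin: "Vector_Spaces.linear sW tsc \<phi>"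
    by (rule linearI[OF W.vs vs_tensor])
      (simp_all add: \<phi>_def lin_add[OF defect_linear] lin_scale[OF defect_linear] lin_add[OF W.coproduct(1)] lin_scale[OF W.coproduct(1)]
        idD T W.TA.TP.T.scale_right_distrib)
  have \<phi>T: "\<phi> u \<in> TT" for u by (simp add: \<phi>_def W.TA.TP.T_add defect_T idD T)
  have \<phi>1: "\<phi> 1 = 0"
    by (simp add: \<phi>_def defect_one W.coproduct(3) idD D_eq ad_W_one W.TA.ten_lin)
  have rec: "\<phi> (\<iota>W \<xi> * u) = delta \<xi> \<odot> \<Delta> u + prim \<xi> \<odot> \<phi> u" if "\<xi> \<in> V" for \<xi> u
    using that by (simp add: \<phi>_def defect_mult W.coproduct_gen idD_prim T W.TA.tmult_add defect_T idD)
  have gen: "\<phi> (\<iota>W \<xi>) = delta \<xi>" if "\<xi> \<in> V" for \<xi>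
    using rec[OF that, of 1] by (simp add: \<phi>1 W.coproduct(3) W.TA.tmult_one T)
  have leib: "\<phi> (u * v) = \<phi> u \<odot> \<Delta> v + \<Delta> u \<odot> \<phi> v" for u v
  proof (induction u rule: W.env_induct)
    case one
    then show ?case by (simp add: \<phi>1 W.coproduct(3) W.TA.tmult_one T \<phi>T)
  next
    case (mult \<xi> u)
    then show ?case
      by (simp add: rec mult.assoc W.coproduct(4,5) W.TA.tmult_add W.TA.tmult_assoc T \<phi>T add.assoc)
  next
    case (add u u')
    then show ?case
      by (simp add: lin_add[OF lin] lin_add[OF W.coproduct(1)] ring_distribs W.TA.tmult_add T \<phi>T algebra_simps)
  next
    case (scale c u)
    then show ?case
      by (simp add: lin_scale[OF lin] lin_scale[OF W.coproduct(1)] W.scale_mult W.TA.tmult_scale T \<phi>T W.TA.TP.T.scale_right_distrib)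
  qed
  have "copoisson g r sW \<iota>W = \<phi>" unfolding copoisson_def Let_def
  proof (rule the_equality)
    show "Vector_Spaces.linear sW tsc \<phi> \<and> (\<forall>x. \<phi> x \<in> TT) \<and> (\<forall>x y. \<phi> (x * y) = \<phi> x \<odot> \<Delta> y + \<Delta> x \<odot> \<phi> y) \<and>
        (\<forall>\<xi>\<in>carr d. \<phi> (\<iota>W \<xi>) = lift d d (\<lambda>m n. ten (\<iota>W m) (\<iota>W n)) (dual_cobracket g r \<xi>))"
      using lin \<phi>T leib gen by (simp add: delta_eq)
    fix \<psi> assume \<psi>: "Vector_Spaces.linear sW tsc \<psi> \<and> (\<forall>x. \<psi> x \<in> TT) \<and> (\<forall>x y. \<psi> (x * y) = \<psi> x \<odot> \<Delta> y + \<Delta> x \<odot> \<psi> y) \<and>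
        (\<forall>\<xi>\<in>carr d. \<psi> (\<iota>W \<xi>) = lift d d (\<lambda>m n. ten (\<iota>W m) (\<iota>W n)) (dual_cobracket g r \<xi>))"
    then have "\<psi> (1 * 1) = \<psi> 1 \<odot> \<Delta> 1 + \<Delta> 1 \<odot> \<psi> 1" by blast
    \<comment> \<open>The Leibniz rule at \<open>1 \<cdot> 1\<close> fixes the value at \<open>1\<close>, which the conditions leave implicit.\<close>
    then have "\<psi> 1 = \<psi> 1 + \<psi> 1" using \<psi> by (simp add: W.coproduct(3) W.TA.tmult_one)
    then have "\<psi> 1 = 0" by simp
    then show "\<psi> = \<phi>" using \<psi> lin
      by (intro W.linear_eqI) (simp_all add: \<phi>1 rec delta_eq W.coproduct(5))
  qed
  then show ?thesis by (simp add: \<phi>_def)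
qed

lemma C1_iff: "u \<in> C1 g r sW \<iota>W \<longleftrightarrow> defect u = 0"
  by (simp add: C1_def Let_def copoisson_eq flip: idD_def)

text \<open>A linear form on \<open>U(g\<^sup>*)\<close> extending evaluation at \<open>x\<close> on \<open>g\<^sup>*\<close>; in particular \<open>\<iota>W\<close> is
  injective.\<close>

definition "coord x u = counit (part x (\<pi> 1 (\<alpha> u)))"

lemma coord_linear: "Vector_Spaces.linear sW (*) (coord x)"
  by (rule linearI[OF W.vs vector_space_field])
    (simp_all add: coord_def lin_add[OF alpha(1)] lin_add[OF \<pi>(1)] lin_add[OF part(1)] lin_add[OF counit(1)]
      lin_scale[OF alpha(1)] lin_scale[OF \<pi>(1)] lin_scale[OF part(1)] lin_scale[OF counit(1)])

lemma coord_\<iota>W: "\<xi> \<in> V \<Longrightarrow> coord x (\<iota>W \<xi>) = \<xi> x"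
proof -
  assume \<xi>: "\<xi> \<in> V"
  have "\<pi> 1 (\<alpha> (\<iota>W \<xi> * 1)) = \<iota>S \<xi> * 1"
    using \<pi>_\<alpha>[OF W.filt_one[of 0] \<xi>] by (simp add: alpha(2) \<pi>(2))
  then show ?thesis
    using part(3)[OF \<xi>, of x 1] \<xi> by (simp add: coord_def part(2) lin_scale[OF counit(1)] counit(2))
qed

text \<open>If all \<open>y i\<close> have degree at most \<open>n\<close>, then the sum is \<open>\<Sum> y i \<otimes> e\<^sup>i\<close> up to terms whose first factor has
  degree less than \<open>n\<close>. Evaluating the second factor at \<open>e j\<close> shows that \<open>y j\<close> has degree less than \<open>n\<close>, and
  one descends to degree less than \<open>0\<close>.\<close>

lemma canonical_coproduct_injective:
  assumes zero: "(\<Sum>i<N. ten 1 (\<iota>W (co i)) \<odot> \<Delta> (y i)) = 0" and j: "j < N"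
  shows "y j = 0"
proof -
  define P where "P x = lift_alg sW (\<lambda>a b. sW (coord x b) a)" for x
  have b: "bilinear_on (full sW) (full sW) sW (\<lambda>a b. sW (coord x b) a)" for x
    by (rule W.TA.bilin_UNIV)
      (simp_all add: lin_add[OF coord_linear] lin_scale[OF coord_linear] W.V.scale_left_distrib W.V.scale_right_distrib mult.commute)
  have P: "T \<in> TT \<Longrightarrow> T' \<in> TT \<Longrightarrow> P x (T + T') = P x T + P x T'" "T \<in> TT \<Longrightarrow> P x (tsc c T) = sW c (P x T)"
     "P x 0 = 0" "P x (ten u v) = sW (coord x v) u" for x c T T' u v
    unfolding P_def
    by (simp_all add: W.TA.TP.lift_add[OF W.vs b] W.TA.TP.lift_scale[OF W.vs b] W.TA.TP.lift_zero[OF W.vs b] W.TA.TP.lift_tens[OF W.vs b])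
  have left: "ten 1 v \<odot> T \<in> TT \<and> P x (ten 1 v \<odot> T) \<in> W.filt n" if "T \<in> W.left_below n" for x T v n
  proof -
    have "T \<in> TT \<and> P x (ten 1 v \<odot> T) \<in> W.filt n"
      using that unfolding W.left_below_def
    proof (rule W.TA.TP.T.span_induct)
      show "W.TA.TP.T.subspace {T. T \<in> TT \<and> P x (ten 1 v \<odot> T) \<in> W.filt n}"
        by (rule W.TA.TP.T.subspaceI)
          (auto simp del: carr_d simp: W.TA.tmult_add W.TA.tmult_scale W.TA.tmult_T W.TA.TP.T_add W.TA.TP.T_zero W.TA.TP.T_scale P
            intro: W.filt_zero W.filt_add W.filt_scale)
      fix T assume "T \<in> {ten u v |u v. u \<in> W.filt n}"
      then obtain u w where "T = ten u w" "u \<in> W.filt n" by blast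
      then show "T \<in> TT \<and> P x (ten 1 v \<odot> T) \<in> W.filt n" by (simp add: W.TA.tmult_ten P W.filt_scale del: carr_d)
    qed
    then show ?thesis by (simp add: W.TA.tmult_T)
  qed
  have step: "y j \<in> W.filt n" if below: "\<forall>i<N. y i \<in> W.filt (Suc n)" and j: "j < N" for n j
  proof -
    let ?d = "\<lambda>i. \<Delta> (y i) - ten (y i) 1"
    have d: "?d i \<in> W.left_below n" if "i < N" for i
      using below that W.coproduct_left_below by blast
    have co: "ten 1 (\<iota>W (co i)) \<odot> \<Delta> (y i) = ten 1 (\<iota>W (co i)) \<odot> ?d i + ten (y i) (\<iota>W (co i))" for i
      by (simp add: W.TA.tmult_diff W.coproduct(2) W.TA.tmult_ten)
    have Psum: "P x (\<Sum>i\<in>I. T i) = (\<Sum>i\<in>I. P x (T i))" if "\<And>i. i \<in> I \<Longrightarrow> T i \<in> TT" for x I and T :: "nat \<Rightarrow> _"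
      using that by (induction I rule: infinite_finite_induct) (auto simp: P W.TA.TP.T_sum)
    have "0 = P (e j) (\<Sum>i<N. ten 1 (\<iota>W (co i)) \<odot> ?d i + ten (y i) (\<iota>W (co i)))"
      using zero by (simp only: co P)
    also have "\<dots> = (\<Sum>i<N. P (e j) (ten 1 (\<iota>W (co i)) \<odot> ?d i)) + (\<Sum>i<N. sW (co i (e j)) (y i))"
    proof -
      have "ten 1 (\<iota>W (co i)) \<odot> ?d i \<in> TT" for i
        by (intro W.TA.tmult_T W.TA.TP.T_diff W.coproduct W.TA.ten_T)
      then show ?thesis by (subst Psum) (simp_all add: W.TA.TP.T_add P coord_\<iota>W co_V sum.distrib)
    qed
    also have "(\<Sum>i<N. sW (co i (e j)) (y i)) = (\<Sum>i<N. if i = j then y j else 0)"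
      by (rule sum.cong) (use j in \<open>auto simp: co_e\<close>)
    also have "\<dots> = y j" using j by simp
    finally have "y j + (\<Sum>i<N. P (e j) (ten 1 (\<iota>W (co i)) \<odot> ?d i)) = 0"
      by (simp only: add.commute)
    then have "y j = - (\<Sum>i<N. P (e j) (ten 1 (\<iota>W (co i)) \<odot> ?d i))"
      by (simp only: eq_neg_iff_add_eq_0)
    also have "\<dots> \<in> W.filt n"
      using left d by (intro W.V.subspace_neg[OF W.filt_subspace] W.filt_sum) simp
    finally show ?thesis .
  qed
  have all: "\<forall>i<N. y i = 0" if "\<forall>i<N. y i \<in> W.filt n" for n
    using that
  proof (induction n)
    case (Suc n)
    then show ?case using step by blast
  qed simp
  have "\<forall>i. \<exists>n. y i \<in> W.filt n" using W.filt_exhaust by blast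
  then obtain n where n: "\<And>i. y i \<in> W.filt (n i)" by metis
  have "y i \<in> W.filt (\<Sum>i<N. n i)" if "i < N" for i
    using n[of i] W.filt_mono[of "n i" "\<Sum>i<N. n i"] member_le_sum[of i "{..<N}" n] that by auto
  then show ?thesis using all j by blast
qed

theorem C1_eq: "C1 g r sW \<iota>W = {u. \<alpha> u \<in> center}"
proof -
  have "defect u = 0 \<longleftrightarrow> \<alpha> u \<in> center" for u
  proof
    assume "defect u = 0"
    then have ad_W: "ad_W (e i) u = 0" if "i < N" for i
      using canonical_coproduct_injective[of "\<lambda>i. ad_W (e i) u"] that by (simp add: defect_def)
    have "ad_W x u = 0" for x
    proof -
      have lin: "Vector_Spaces.linear (scl g) sW (\<lambda>x. ad_W x u)"
        by (intro linearI vs_g W.vs ad_W_add ad_W_scale)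
      show ?thesis using linear_expand[OF lin, of x] ad_W by simp
    qed
    then have "\<iota>U x * \<alpha> u - \<alpha> u * \<iota>U x = 0" for x
      using \<alpha>_ad_W[of x u] by (simp add: lin_zero[OF alpha(1)])
    then show "\<alpha> u \<in> center" by (simp add: center_iff)
  next
    assume "\<alpha> u \<in> center"
    then have "\<alpha> (ad_W x u) = 0" for x by (simp add: \<alpha>_ad_W center_iff)
    then have "ad_W x u = 0" for x by (rule \<alpha>_kernel)
    then show "defect u = 0" by (simp add: defect_def lin_zero[OF W.coproduct(1)])
  qed
  then show ?thesis using C1_iff by blast
qed

lemma Theta_image: "Theta g r sU \<iota>U sW \<iota>W ` center = {u. \<alpha> u \<in> center}"
proof -
  have "Theta g r sU \<iota>U sW \<iota>W ` center = inv \<alpha> ` center"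
    by (simp add: Theta_def)
  also have "\<dots> = \<alpha> -` center" using \<alpha>_bij by (rule bij_vimage_eq_inv_image[symmetric])
  finally show ?thesis by (simp add: vimage_def)
qed

section \<open>The associated graded of \<open>C\<^sub>1\<close>\<close>

abbreviation "actS x \<equiv> der_extension d sS \<iota>S (coad g x)"

lemma actS: "Vector_Spaces.linear sS sS (actS x)" "actS x 1 = 0"
  "\<xi> \<in> V \<Longrightarrow> actS x (\<iota>S \<xi> * p) = \<iota>S (ad_star x \<xi>) * p + \<iota>S \<xi> * actS x p"
proof -
  obtain \<phi> where \<phi>: "Vector_Spaces.linear sS sS \<phi>" "\<phi> 1 = 0"
    "\<And>\<xi> p. \<xi> \<in> V \<Longrightarrow> \<phi> (\<iota>S \<xi> * p) = \<iota>S (ad_star x \<xi>) * p + \<iota>S \<xi> * \<phi> p"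
    by (rule S_derivation[of "\<lambda>\<xi>. \<iota>S (ad_star x \<xi>)"]) (auto simp: ad_star_add ad_star_scale ad_star_V \<iota>S_add \<iota>S_scale)
  have "der_extension d\<^sub>0 sS \<iota>S (coad g x) = \<phi>"
    by (rule S.der_extension_eq(1)[OF \<phi>(1,2)]) (simp add: \<phi>(3))
  then have "actS x = \<phi>" by (simp add: der_extension_def)
  then show "Vector_Spaces.linear sS sS (actS x)" "actS x 1 = 0"
    "\<xi> \<in> V \<Longrightarrow> actS x (\<iota>S \<xi> * p) = \<iota>S (ad_star x \<xi>) * p + \<iota>S \<xi> * actS x p"
    using \<phi> by simp_all
qed

lemma \<pi>_equivariant: "u \<in> U.filt (Suc n) \<Longrightarrow> \<pi> n (\<iota>U x * u - u * \<iota>U x) = actS x (\<pi> n u)"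
proof (induction n arbitrary: u rule: less_induct)
  case (less n)
  from less.prems show ?case
  proof (induction rule: U.filt_Suc_induct)
    case (add u v)
    have "\<iota>U x * (u + v) - (u + v) * \<iota>U x = (\<iota>U x * u - u * \<iota>U x) + (\<iota>U x * v - v * \<iota>U x)" by (simp add: algebra_simps)
    then show ?case using add by (simp only: lin_add[OF \<pi>(1)] lin_add[OF actS(1)])
  next
    case (scale c u)
    have "\<iota>U x * sU c u - sU c u * \<iota>U x = sU c (\<iota>U x * u - u * \<iota>U x)" by (simp add: U.scale_mult U.V.scale_right_diff_distrib)
    then show ?case using scale by (simp only: lin_scale[OF \<pi>(1)] lin_scale[OF actS(1)])
  next
    case one
    have "actS x (\<pi> n 1) = 0"
      using \<pi>(3)[OF U.filt_one] by (cases n) (simp_all add: \<pi>(2) actS(2) lin_zero[OF actS(1)])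
    then show ?case by (simp add: lin_zero[OF \<pi>(1)])
  next
    case (mult y v)
    show ?case
    proof (cases n)
      case 0
      then have "v = 0" using mult by simp
      then show ?thesis by (simp add: lin_zero[OF \<pi>(1)] lin_zero[OF actS(1)])
    next
      case (Suc k)
      have v: "v \<in> U.filt (Suc k)" using mult Suc by simp
      obtain \<eta> where \<eta>: "\<eta> \<in> V" "y = \<tau> \<eta>" by (rule \<tau>_cases)
      have s: "symb y = \<iota>S \<eta>" "symb (brk g x y) = \<iota>S (ad_star x \<eta>)"
        using \<eta> by (simp_all add: symb_\<tau> \<tau>_equivariant ad_star_V)
      have comm: "\<iota>U x * v - v * \<iota>U x \<in> U.filt (Suc k)"
        by (rule U.filt_commute) (use v in \<open>simp_all add: univ\<close>)
      have IH: "\<pi> k (\<iota>U x * v - v * \<iota>U x) = actS x (\<pi> k v)" using less.IH v Suc by blast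
      have "\<iota>U x * (\<iota>U y * v) - \<iota>U y * v * \<iota>U x = \<iota>U (brk g x y) * v + \<iota>U y * (\<iota>U x * v - v * \<iota>U x)"
        by (simp add: \<iota>U_lin algebra_simps)
      then show ?thesis
        by (simp only: Suc lin_add[OF \<pi>(1)] \<pi>(4)[OF v] \<pi>(4)[OF comm] s IH actS(3)[OF \<eta>(1)])
    qed
  qed
qed

lemma \<pi>_monomial:
  assumes "set w \<subseteq> V"
  shows "\<pi> (length w) (\<alpha> (prod_list (map \<iota>W w))) = prod_list (map \<iota>S w)"
  using assms
proof (induction w)
  case (Cons \<xi> w)
  then show ?case using \<pi>_\<alpha>[of "prod_list (map \<iota>W w)" "length w" \<xi>] W.filt_monomial[of w] by simp
qed (simp add: alpha \<pi>)

text \<open>A symbol in the sense of words is unique, and it is computed by \<open>\<pi>\<close> after applying \<open>\<alpha>\<close>, because \<open>\<alpha>\<close> has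
  the associated graded \<open>\<tau>\<close>, which is built into \<open>\<pi>\<close>.\<close>

lemma has_symbolD:
  assumes "has_symbol V sW \<iota>W sS \<iota>S n u p"
  shows "u \<in> W.filt (Suc n)" "p = \<pi> n (\<alpha> u)"
proof -
  obtain c where c: "c \<in> word_combs V" "\<forall>w\<in>keys c. length w = n"
    "word_eval sS \<iota>S c = p" "u - word_eval sW \<iota>W c \<in> W.filt n"
    using assms by (auto simp: has_symbol_def)
  have "\<forall>w\<in>keys c. set w \<subseteq> V \<and> length w = n" using c by (simp add: word_combs_def)
  then have 1: "word_eval sW \<iota>W c \<in> W.filt (Suc n) \<and> \<pi> n (\<alpha> (word_eval sW \<iota>W c)) = word_eval sS \<iota>S c"
  proof (induction rule: poly_mapping_keys_induct)
    case zero
    then show ?case using W.filt_zero by (simp add: word_eval_linext lin_zero[OF \<pi>(1)] lin_zero[OF alpha(1)])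
  next
    case (add c w k)
    have "prod_list (map \<iota>W w) \<in> W.filt (Suc n)" using add W.filt_monomial[of w "Suc n"] by simp
    then show ?case using add \<pi>_monomial[of w] W.filt_add W.filt_scale
      by (simp add: word_eval_linext linext_add W.vs S.vs lin_add[OF \<pi>(1)] lin_add[OF alpha(1)] lin_scale[OF \<pi>(1)] lin_scale[OF alpha(1)])
  qed
  then show "u \<in> W.filt (Suc n)" using W.filt_add[OF W.filt_Suc[OF c(4)], of "word_eval sW \<iota>W c"] by simp
  have "\<pi> n (\<alpha> (u - word_eval sW \<iota>W c)) = 0" by (rule \<pi>(3)[OF \<alpha>_filt[OF c(4)]])
  then show "p = \<pi> n (\<alpha> u)" using 1 c by (simp add: lin_diff[OF alpha(1)] lin_diff[OF \<pi>(1)])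
qed

lemma has_symbolI:
  assumes "u \<in> W.filt (Suc n)"
  shows "has_symbol V sW \<iota>W sS \<iota>S n u (\<pi> n (\<alpha> u))"
proof -
  interpret PM: vector_space "pscale :: 'k \<Rightarrow> (('g \<Rightarrow> 'k) list \<Rightarrow>\<^sub>0 'k) \<Rightarrow> _" by (rule vector_space_pscale)
  define Q where "Q = {c :: ('g \<Rightarrow> 'k) list \<Rightarrow>\<^sub>0 'k. \<forall>w\<in>keys c. set w \<subseteq> V \<and> length w = n}"
  have Q_add: "c + c' \<in> Q" if "c \<in> Q" "c' \<in> Q" for c c'
    using that Poly_Mapping.keys_add[of c c'] unfolding Q_def by blast
  have Q_scale: "pscale k c \<in> Q" if "c \<in> Q" for k c
    using that by (auto simp: Q_def in_keys_iff)
  have "\<exists>c\<in>Q. u - word_eval sW \<iota>W c \<in> W.filt n"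
    using assms unfolding degree_below_def[of _ _ _ "Suc n"]
  proof (rule W.V.span_induct)
    show "W.V.subspace {u. \<exists>c\<in>Q. u - word_eval sW \<iota>W c \<in> W.filt n}"
    proof (rule W.V.subspaceI; clarsimp simp del: carr_d)
      show "\<exists>c\<in>Q. - word_eval sW \<iota>W c \<in> W.filt n"
        by (rule bexI[of _ 0]) (simp_all add: Q_def word_eval_linext W.filt_zero del: carr_d)
    next
      fix u v c c' assume c: "c \<in> Q" "u - word_eval sW \<iota>W c \<in> W.filt n" and c': "c' \<in> Q" "v - word_eval sW \<iota>W c' \<in> W.filt n"
      have "u + v - word_eval sW \<iota>W (c + c') = (u - word_eval sW \<iota>W c) + (v - word_eval sW \<iota>W c')"
        by (simp add: word_eval_linext linext_add W.vs)
      then show "\<exists>c\<in>Q. u + v - word_eval sW \<iota>W c \<in> W.filt n"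
        using Q_add[OF c(1) c'(1)] W.filt_add[OF c(2) c'(2)] by metis
    next
      fix k u c assume c: "c \<in> Q" "u - word_eval sW \<iota>W c \<in> W.filt n"
      have "sW k u - word_eval sW \<iota>W (pscale k c) = sW k (u - word_eval sW \<iota>W c)"
        by (simp add: word_eval_linext linext_pscale W.vs W.V.scale_right_diff_distrib)
      then show "\<exists>c\<in>Q. sW k u - word_eval sW \<iota>W c \<in> W.filt n"
        using Q_scale[OF c(1), of k] W.filt_scale[OF c(2), of k] by metis
    qed
  next
    fix v assume "v \<in> {prod_list (map \<iota>W w) |w. set w \<subseteq> carr d \<and> length w < Suc n}"
    then obtain w where w: "v = prod_list (map \<iota>W w)" "set w \<subseteq> carr d" "length w < Suc n" by blast
    show "\<exists>c\<in>Q. v - word_eval sW \<iota>W c \<in> W.filt n"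
    proof (cases "length w = n")
      case True
      show ?thesis
        by (rule bexI[of _ "single w 1"])
          (use w True W.filt_zero in \<open>simp_all add: Q_def word_eval_linext W.vs\<close>)
    next
      case False
      show ?thesis
        by (rule bexI[of _ 0]) (use w False W.filt_monomial[of w n] in \<open>simp_all add: Q_def word_eval_linext\<close>)
    qed
  qed
  then obtain c where c: "c \<in> Q" "u - word_eval sW \<iota>W c \<in> W.filt n" by blast
  then have "has_symbol V sW \<iota>W sS \<iota>S n u (word_eval sS \<iota>S c)"
    unfolding has_symbol_def by (intro bexI[of _ c]) (auto simp: Q_def word_combs_def)
  with has_symbolD(2)[OF this] show ?thesis by simp
qed

lemma counit_actS: "counit (actS x p) = 0"
  by (induction p rule: S.env_induct)
    (simp_all add: lin_add[OF actS(1)] lin_scale[OF actS(1)] lin_add[OF counit(1)] lin_scale[OF counit(1)]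
       actS counit ad_star_V lin_zero[OF counit(1)])

lemma actS_part: "actS x (part y p) = part y (actS x p) + part (brk g x y) p"
proof (induction p rule: S.env_induct)
  case (add p q)
  then show ?case by (simp add: lin_add[OF actS(1)] lin_add[OF part(1)] algebra_simps)
next
  case (scale c p)
  then show ?case by (simp add: lin_scale[OF actS(1)] lin_scale[OF part(1)] S.V.scale_right_distrib)
next
  case one
  show ?case by (simp add: actS part lin_zero[OF actS(1)] lin_zero[OF part(1)])
next
  case (mult \<xi> p)
  then have \<xi>: "\<xi> \<in> V" "ad_star x \<xi> \<in> V" by (simp_all add: ad_star_V)
  have c: "ad_star x \<xi> y = - \<xi> (brk g x y)" by (simp add: coad_def)
  show ?case
    by (simp only: part(3)[OF \<xi>(1)] part(3)[OF \<xi>(2)] actS(3)[OF \<xi>(1)] lin_add[OF actS(1)] lin_add[OF part(1)]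
        lin_scale[OF actS(1)] mult.IH c S.V.scale_minus_left distrib_left) (simp add: algebra_simps)
qed

text \<open>Both \<open>\<tau>\<close> and the canonical element \<open>\<Sum> e\<^sup>i \<otimes> e\<^sub>i\<close>, from which polarisation is built, are invariant. The
  failure of \<open>actS x\<close> to commute with the derivatives in constant directions compensates the action of
  \<open>x\<close> on the \<open>e\<^sup>i\<close>.\<close>

lemma \<sigma>U_equivariant: "\<iota>U x * \<sigma>U n p - \<sigma>U n p * \<iota>U x = \<sigma>U n (actS x p)"
proof (induction n arbitrary: p)
  case 0
  show ?case by (simp add: counit_actS U.scale_mult)
next
  case (Suc n)
  let ?T = "\<lambda>\<xi>. \<iota>U (\<tau> \<xi>)"
  have "\<iota>U x * \<sigma>U (Suc n) p - \<sigma>U (Suc n) p * \<iota>U x =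
     (\<Sum>i<N. ?T (ad_star x (co i)) * \<sigma>U n (part (e i) p)) + (\<Sum>i<N. ?T (co i) * \<sigma>U n (actS x (part (e i) p)))"
  proof -
    have "\<iota>U x * (?T (co i) * q) - ?T (co i) * q * \<iota>U x = ?T (ad_star x (co i)) * q + ?T (co i) * (\<iota>U x * q - q * \<iota>U x)" for i q
      by (simp add: \<tau>_equivariant[OF co_V, symmetric] \<iota>U_lin algebra_simps)
    then show ?thesis by (simp add: sum_distrib_left sum_distrib_right sum_subtractf[symmetric] sum.distrib Suc.IH)
  qed
  also have "(\<Sum>i<N. ?T (ad_star x (co i)) * \<sigma>U n (part (e i) p)) = (\<Sum>i<N. ?T (co i) * \<sigma>U n (part (- brk g x (e i)) p))"
    by (rule canonical_transpose[OF U.vs, where B = "\<lambda>\<xi> y. ?T \<xi> * \<sigma>U n (part y p)" and A = "ad_star x" and A' = "\<lambda>y. - brk g x y"])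
      (simp_all add: \<tau>_add \<tau>_scale \<iota>U_lin part_add part_scale lin_add[OF \<sigma>U_lin] lin_scale[OF \<sigma>U_lin] U.scale_mult
         ad_star_V V_lin ring_distribs, simp add: coad_def)
  also have "\<dots> + (\<Sum>i<N. ?T (co i) * \<sigma>U n (actS x (part (e i) p))) = \<sigma>U (Suc n) (actS x p)"
  proof -
    have "part (- y) p + part y p = 0" for y p
      using part_add[of "- y" y p] part_scale[of 0 0 p] by simp
    then have "\<sigma>U n (part (- brk g x (e i)) p) + \<sigma>U n (part (brk g x (e i)) p) = 0" for i
      using lin_zero[OF \<sigma>U_lin] by (metis lin_add[OF \<sigma>U_lin])
    then have z: "?T (co i) * \<sigma>U n (part (- brk g x (e i)) p) + ?T (co i) * \<sigma>U n (part (brk g x (e i)) p) = 0" for i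
      by (simp flip: distrib_left)
    have "A + (B + C) = B" if "A + C = 0" for A B C :: 'u
      using that by (simp add: add.left_commute[of A])
    from this[OF z] have "?T (co i) * \<sigma>U n (part (- brk g x (e i)) p) + ?T (co i) * \<sigma>U n (actS x (part (e i) p))
       = ?T (co i) * \<sigma>U n (part (e i) (actS x p))" for i
      by (simp only: actS_part lin_add[OF \<sigma>U_lin] distrib_left)
    then show ?thesis by (simp flip: sum.distrib)
  qed
  finally show ?case .
qed

text \<open>The homogeneous component of degree \<open>n\<close>, expressed through \<open>U(g)\<close>.\<close>

definition "hom_part n p = sS (1 / fact n) (\<pi> n (\<sigma>U n p))"

lemma hom_part_linear: "Vector_Spaces.linear sS sS (hom_part n)"
  by (rule linearI[OF S.vs S.vs])
    (simp_all add: hom_part_def lin_add[OF \<sigma>U_lin] lin_add[OF \<pi>(1)] lin_scale[OF \<sigma>U_lin] lin_scale[OF \<pi>(1)] S.V.scale_right_distrib mult.commute)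

lemma hom_part_one: "hom_part n 1 = (if n = 0 then 1 else 0)"
  by (cases n) (simp_all add: hom_part_def counit part lin_scale[OF \<pi>(1)] \<pi>(2) lin_zero[OF \<sigma>U_lin] lin_zero[OF \<pi>(1)])

lemma hom_part_0_mult: "\<xi> \<in> V \<Longrightarrow> hom_part 0 (\<iota>S \<xi> * p) = 0"
  by (simp add: hom_part_def counit lin_zero[OF \<pi>(1)])

lemma hom_part_Suc_mult:
  assumes \<xi>: "\<xi> \<in> V"
  shows "hom_part (Suc n) (\<iota>S \<xi> * p) = \<iota>S \<xi> * hom_part n p"
proof -
  let ?k = "of_nat (Suc n) :: 'k"
  have k: "?k \<noteq> 0" using of_nat_neq_0 by blast
  have "\<pi> (Suc n) (\<sigma>U (Suc n) (\<iota>S \<xi> * p) - sU ?k (\<iota>U (\<tau> \<xi>) * \<sigma>U n p)) = 0"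
    by (rule \<pi>(3)[OF \<sigma>U(2)[OF \<xi>]])
  then have "\<pi> (Suc n) (\<sigma>U (Suc n) (\<iota>S \<xi> * p)) = sS ?k (\<pi> (Suc n) (\<iota>U (\<tau> \<xi>) * \<sigma>U n p))"
    by (simp only: lin_diff[OF \<pi>(1)] lin_scale[OF \<pi>(1)] right_minus_eq)
  also have "\<dots> = sS ?k (\<iota>S \<xi> * \<pi> n (\<sigma>U n p))"
    by (simp only: \<pi>(4)[OF \<sigma>U(1)] symb_\<tau>[OF \<xi>])
  finally have "hom_part (Suc n) (\<iota>S \<xi> * p) = sS (1 / fact (Suc n) * ?k) (\<iota>S \<xi> * \<pi> n (\<sigma>U n p))"
    by (simp only: hom_part_def S.V.scale_scale)
  also have "1 / fact (Suc n) * ?k = 1 / fact n" using k by (simp add: fact_Suc del: of_nat_Suc)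
  finally show ?thesis by (simp add: hom_part_def S.scale_mult)
qed

lemma hom_part_sum: "\<exists>M. \<forall>K\<ge>M. (\<Sum>n<K. hom_part n p) = p"
proof (induction p rule: S.env_induct)
  case (add p q)
  then obtain M M' where "\<forall>K\<ge>M. (\<Sum>n<K. hom_part n p) = p" "\<forall>K\<ge>M'. (\<Sum>n<K. hom_part n q) = q" by blast
  then have "\<forall>K\<ge>max M M'. (\<Sum>n<K. hom_part n (p + q)) = p + q"
    by (simp add: lin_add[OF hom_part_linear] sum.distrib)
  then show ?case by blast
next
  case (scale c p)
  then obtain M where "\<forall>K\<ge>M. (\<Sum>n<K. hom_part n p) = p" by blast
  then have "\<forall>K\<ge>M. (\<Sum>n<K. hom_part n (sS c p)) = sS c p"
    by (simp add: lin_scale[OF hom_part_linear] flip: S.V.scale_sum_right)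
  then show ?case by blast
next
  case one
  have "(\<Sum>n<K. hom_part n 1) = 1" if "K \<ge> 1" for K
    using that by (simp add: hom_part_one sum.If_cases) 
  then show ?case by blast
next
  case (mult \<xi> p)
  then have \<xi>: "\<xi> \<in> V" by simp
  obtain M where M: "\<forall>K\<ge>M. (\<Sum>n<K. hom_part n p) = p" using mult by blast
  have "(\<Sum>n<K. hom_part n (\<iota>S \<xi> * p)) = \<iota>S \<xi> * p" if "K \<ge> Suc M" for K
  proof -
    obtain K' where K': "K = Suc K'" "K' \<ge> M" using \<open>K \<ge> Suc M\<close> Suc_le_D by auto
    show ?thesis unfolding K'(1) sum.lessThan_Suc_shift
      using M K'(2) by (simp add: hom_part_0_mult hom_part_Suc_mult \<xi> flip: sum_distrib_left)
  qed
  then show ?case by blast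
qed

text \<open>An invariant \<open>p\<close> is the sum of its homogeneous components, and the component of degree \<open>n\<close> is the symbol
  of the preimage of the central element \<open>1/n! \<sigma>U n p\<close>. For the other inclusion, \<open>\<pi>\<close> is equivariant.\<close>

theorem assoc_graded_C1:
  "assoc_graded V sW \<iota>W sS \<iota>S (C1 g r sW \<iota>W) = sym_invariants g r sS \<iota>S"
proof
  have inv: "sym_invariants g r sS \<iota>S = {p. \<forall>x. actS x p = 0}"
    by (simp add: sym_invariants_def univ)
  show "assoc_graded V sW \<iota>W sS \<iota>S (C1 g r sW \<iota>W) \<subseteq> sym_invariants g r sS \<iota>S"
    unfolding assoc_graded_def
  proof (rule S.V.span_minimal)
    show "S.V.subspace (sym_invariants g r sS \<iota>S)"
      unfolding inv by (rule S.V.subspaceI) (auto simp: lin_zero[OF actS(1)] lin_add[OF actS(1)] lin_scale[OF actS(1)])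
    show "{p. \<exists>n. \<exists>u\<in>C1 g r sW \<iota>W. has_symbol V sW \<iota>W sS \<iota>S n u p} \<subseteq> sym_invariants g r sS \<iota>S"
      unfolding inv
    proof clarify
      fix p n u x assume u: "u \<in> C1 g r sW \<iota>W" and s: "has_symbol V sW \<iota>W sS \<iota>S n u p"
      have "\<iota>U x * \<alpha> u - \<alpha> u * \<iota>U x = 0" using u by (simp add: C1_eq center_iff)
      then show "actS x p = 0"
        using \<pi>_equivariant[OF \<alpha>_filt[OF has_symbolD(1)[OF s]], of x] has_symbolD(2)[OF s] by (simp add: lin_zero[OF \<pi>(1)])
    qed
  qed
  show "sym_invariants g r sS \<iota>S \<subseteq> assoc_graded V sW \<iota>W sS \<iota>S (C1 g r sW \<iota>W)"
  proof
    fix p assume p: "p \<in> sym_invariants g r sS \<iota>S"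
    obtain K where K: "(\<Sum>n<K. hom_part n p) = p" using hom_part_sum by blast
    have "hom_part n p \<in> assoc_graded V sW \<iota>W sS \<iota>S (C1 g r sW \<iota>W)" for n
    proof -
      define u where "u = sW (1 / fact n) (inv \<alpha> (\<sigma>U n p))"
      have \<alpha>u: "\<alpha> u = sU (1 / fact n) (\<sigma>U n p)"
        unfolding u_def lin_scale[OF alpha(1)] using \<alpha>_bij by (simp add: bij_def surj_f_inv_f)
      have "\<iota>U x * \<sigma>U n p = \<sigma>U n p * \<iota>U x" for x
        using \<sigma>U_equivariant[of x n p] p by (simp add: inv lin_zero[OF \<sigma>U_lin])
      then have "u \<in> C1 g r sW \<iota>W" by (simp add: C1_eq center_iff \<alpha>u U.scale_mult)
      moreover have "u \<in> W.filt (Suc n)"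
        unfolding \<alpha>_filt_iff[symmetric] \<alpha>u by (rule U.filt_scale[OF \<sigma>U(1)])
      then have "has_symbol V sW \<iota>W sS \<iota>S n u (\<pi> n (\<alpha> u))" by (rule has_symbolI)
      moreover have "\<pi> n (\<alpha> u) = hom_part n p" by (simp add: \<alpha>u hom_part_def lin_scale[OF \<pi>(1)])
      ultimately show ?thesis unfolding assoc_graded_def by (intro S.V.span_base) auto
    qed
    then show "p \<in> assoc_graded V sW \<iota>W sS \<iota>S (C1 g r sW \<iota>W)"
      unfolding assoc_graded_def by (subst K[symmetric]) (rule S.V.span_sum)
  qed
qed

end

theorem proposition8p4:
  fixes g :: "('k::field_char_0, 'g::ab_group_add) lie"
    and r :: "('k, 'g, 'g) tens"
    and sU :: "'k \<Rightarrow> 'u::ring_1 \<Rightarrow> 'u" and \<iota>U :: "'g \<Rightarrow> 'u"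
    and sW :: "'k \<Rightarrow> 'w::ring_1 \<Rightarrow> 'w" and \<iota>W :: "('g \<Rightarrow> 'k) \<Rightarrow> 'w"
    and sS :: "'k \<Rightarrow> 's::comm_ring_1 \<Rightarrow> 's" and \<iota>S :: "('g \<Rightarrow> 'k) \<Rightarrow> 's"
  assumes "carr g = UNIV"
    and "quasitriangular g r" and "nondegenerate g r"
    and "enveloping_algebra g sU \<iota>U"
    and "enveloping_algebra (dual_lie g r) sW \<iota>W"
    and "symmetric_algebra (dual_lie g r) sS \<iota>S"
  shows "Theta g r sU \<iota>U sW \<iota>W ` center = C1 g r sW \<iota>W \<and>
    assoc_graded (carr (dual_lie g r)) sW \<iota>W sS \<iota>S (C1 g r sW \<iota>W) = sym_invariants g r sS \<iota>S"
proof -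
  have lie: "lie_algebra g" and r: "r \<in> carr (tensor g g)" "cyb g r = 0" "\<And>x. ad2 g x (sym_part g r) = 0"
    using assms(1,2) by (simp_all add: quasitriangular_def)
  obtain B where B: "finite B" "module.span (scl g) B = carr g"
    and nd: "bij_betw (\<lambda>\<xi>. lift g g (\<lambda>a b. scl g (\<xi> a) b) (sym_part g r)) (dual_carr g) UNIV"
    using assms(1,3) by (auto simp: nondegenerate_def)
  obtain N e co where "lie_coord g N e co" by (rule ex_lie_coord[OF lie assms(1) B])
  then interpret lie_coord g N e co .
  interpret TG: tensor_pair g g using lie by unfold_locales (simp_all add: lie_algebra_def)
  obtain m :: nat and a b where "r = (\<Sum>j<m. tens g g (a j) (b j))"
    by (rule TG.T_representation[OF r(1)])
  then interpret factorizable g N e co r m a b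
    by unfold_locales (use r nd in auto)
  interpret semenov_sym g N e co r m a b sU \<iota>U sW \<iota>W sS \<iota>S
    by unfold_locales (fact assms)+
  show ?thesis using Theta_image C1_eq assoc_graded_C1 by simp
qed

end
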